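(* Consider a delayed adversarial linear bandit with convex action set $\mathcal C\subseteq\mathbb R^n$ and $T$ rounds. When $\Psi$ is an $O(n)$-self-concordant barrier over $\mathcal C$, the algorithm Banker-BOLO run with $\Psi$ ensures $$\mathfrak R_T=\tilde O\left(n^{3/2}\sqrt T+n^2\sqrt D\right),$$ where $\tilde O(\cdot)$ hides absolute constants (and the constant in "$O(n)$-self-concordant") and logarithmic factors.
   Context: **Setting.** $\mathcal C\subseteq\mathbb R^n$ is a closed convex set with non-empty interior, and $\bar{\mathcal C}=\{l\in\mathbb R^n:|\langle l,x\rangle|\le1\ \forall x\in\mathcal C\}$. An oblivious adversary picks loss vectors $l_t\in\bar{\mathcal C}$ and delays $d_t\in\{0,1,2,\dots\}$ for $t=1,\dots,T$ ($T\ge2$), all unknown to the agent; $D=\sum_{t=1}^Td_t$. In round $t$ the agent picks $A_t\in\mathcal C$ and suffers $\hat l_t=\langle l_t,A_t\rangle$, which is revealed (as the pair $(t,\hat l_t)$) at the end of round $t+d_t$. The pseudo-regret is $\mathfrak R_T=\sup_{y\in\mathcal C}\mathbb E[\sum_{t=1}^T\langle l_t,A_t-y\rangle]$. **Self-concordance.** A $C^3$ convex function $\Psi$ on (the interior of) $\mathcal C$ is self-concordant if $|D^3\Psi(x)[h,h,h]|\le2(D^2\Psi(x)[h,h])^{3/2}$ for all $x,h$; it is $\vartheta$-self-concordant if moreover $|D\Psi(x)[h]|\le\vartheta^{1/2}(D^2\Psi(x)[h,h])^{1/2}$. It is a barrier if it tends to $+\infty$ at the boundary of $\mathcal C$. "$O(n)$-self-concordant"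 means $\vartheta$-self-concordant with $\vartheta\le cn$ for an absolute constant $c$. $\Psi$ is Legendre (strictly convex, differentiable on the interior, gradient norm tending to infinity at the boundary), has positive definite Hessian on the interior, and the point $x_0=\nabla\Psi^*(\mathbf 0)$ (the minimizer of $\Psi$) exists, so that the quantities below are defined. $\Psi^*$ is the Fenchel conjugate. **Banker-BOLO.** Set $x_0=\nabla\Psi^*(\mathbf 0)$, $\mathfrak D_0=0$. In round $t=1,\dots,T$: (i) let $\mathfrak d_t$ be the number of rounds $s<t$ whose feedback has not arrived at the beginning of round $t$, $\mathfrak D_t=\mathfrak D_{t-1}+\mathfrak d_t$, and $$\sigma_t=\max\left\{\left(\sqrt{\frac{\ln T}{nt}}+\mathfrak d_t\sqrt{\frac{\ln(\mathfrak D_t+1)\ln T}{n\mathfrak D_t}}\right)^{-1},\,8n\right\}$$ (the second summand being $0$ if $\mathfrak D_t=0$); set $v_t\leftarrow\sigma_t$; (ii) set $b_t\leftarrow\sigma_t$; successively for every $s<t$ whose feedback has arrived (i.e. $s+d_s<t$), set $\sigma_{t,s}=\min\{v_s,b_t\}$ and $b_t\leftarrow b_t-\sigma_{t,s}$; for other $s<t$ set $\sigma_{t,s}=0$; then $v_s\leftarrow v_s-\sigma_{t,s}$ for all $s<t$; (iii) set $x_t=\nabla\Psi^*\bigl(\sum_{s<t}\frac{\sigma_{t,s}}{\sigma_t}\nabla\Psi(z_s)+\frac{b_t}{\sigma_t}\nabla\Psi(x_0)\bigr)$; (iv) let $e_{t,1},\dots,e_{t,n}$ be orthonormal eigenvectors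 of $\nabla^2\Psi(x_t)$ with eigenvalues $\lambda_{t,1},\dots,\lambda_{t,n}$; sample $i_t$ uniformly from $\{1,\dots,n\}$ and an independent uniform sign $\varepsilon_t\in\{\pm1\}$; play $A_t=x_t+\varepsilon_t\lambda_{t,i_t}^{-1/2}e_{t,i_t}$; (v) for each feedback $(s,\hat l_s)$ received at the end of round $t$, set $\tilde l_s=n\,\hat l_s\,\varepsilon_s\lambda_{s,i_s}^{1/2}e_{s,i_s}$ and $z_s=\nabla\Psi^*(\nabla\Psi(x_s)-\frac1{\sigma_s}\tilde l_s)$. *)

theory Defs
  imports "HOL-Probability.Probability"
begin

section \<open>Euclidean spaces of variable dimension\<close>

text \<open>
  The constants hidden in the regret bound do not depend on the dimension \<open>n\<close>, so \<open>n\<close> has to be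
  quantified after them and cannot be the cardinality of an index type.  We therefore work in one
  inner product space, the finitely supported real sequences, and realise \<open>\<real>\<^sup>n\<close> as the subspace
  \<open>Rn n\<close> of the sequences supported in \<open>{1..n}\<close>, with the inner product, norm and topology it
  inherits.
\<close>

typedef fseq = "{f :: nat \<Rightarrow> real. finite {i. f i \<noteq> 0}}"
  morphisms coord Abs_fseq
  by (rule exI[of _ "\<lambda>_. 0"]) simp

setup_lifting type_definition_fseq

lemma finite_coord [simp, intro]: "finite {i. coord x i \<noteq> 0}"
  using coord[of x] by simp

lemma fseq_eq_iff: "x = y \<longleftrightarrow> (\<forall>i. coord x i = coord y i)"
  by (auto simp: coord_inject[symmetric])

instantiation fseq :: real_vector
begin

lift_definition zero_fseq :: fseq is "\<lambda>_. 0" by simp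

lift_definition plus_fseq :: "fseq \<Rightarrow> fseq \<Rightarrow> fseq" is "\<lambda>f g i. f i + g i"
proof -
  fix f g :: "nat \<Rightarrow> real"
  assume "finite {i. f i \<noteq> 0}" "finite {i. g i \<noteq> 0}"
  then have "finite ({i. f i \<noteq> 0} \<union> {i. g i \<noteq> 0})" by simp
  then show "finite {i. f i + g i \<noteq> 0}" by (rule rev_finite_subset) auto
qed

lift_definition minus_fseq :: "fseq \<Rightarrow> fseq \<Rightarrow> fseq" is "\<lambda>f g i. f i - g i"
proof -
  fix f g :: "nat \<Rightarrow> real"
  assume "finite {i. f i \<noteq> 0}" "finite {i. g i \<noteq> 0}"
  then have "finite ({i. f i \<noteq> 0} \<union> {i. g i \<noteq> 0})" by simp
  then show "finite {i. f i - g i \<noteq> 0}" by (rule rev_finite_subset) auto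
qed

lift_definition uminus_fseq :: "fseq \<Rightarrow> fseq" is "\<lambda>f i. - f i" by simp

lift_definition scaleR_fseq :: "real \<Rightarrow> fseq \<Rightarrow> fseq" is "\<lambda>r f i. r * f i"
  by (erule rev_finite_subset) auto

instance
  by standard (transfer; simp add: fun_eq_iff algebra_simps)+

end

lemma coord_simps [simp]:
  "coord 0 i = 0" "coord (x + y) i = coord x i + coord y i"
  "coord (x - y) i = coord x i - coord y i" "coord (- x) i = - coord x i"
  "coord (r *\<^sub>R x) i = r * coord x i"
  by (transfer; simp)+

instantiation fseq :: real_inner
begin

definition inner_fseq :: "fseq \<Rightarrow> fseq \<Rightarrow> real"
  where "inner_fseq x y = (\<Sum>i | coord x i \<noteq> 0. coord x i * coord y i)"

definition norm_fseq :: "fseq \<Rightarrow> real"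
  where "norm_fseq x = sqrt (inner x x)"

definition sgn_fseq :: "fseq \<Rightarrow> fseq"
  where "sgn_fseq x = x /\<^sub>R norm x"

definition dist_fseq :: "fseq \<Rightarrow> fseq \<Rightarrow> real"
  where "dist_fseq x y = norm (x - y)"

definition uniformity_fseq :: "(fseq \<times> fseq) filter"
  where "uniformity_fseq = (INF e\<in>{0<..}. principal {(x, y). dist x y < e})"

definition open_fseq :: "fseq set \<Rightarrow> bool"
  where "open_fseq U \<longleftrightarrow> (\<forall>x\<in>U. \<forall>\<^sub>F (x', y) in uniformity. x' = x \<longrightarrow> y \<in> U)"

lemma inner_fseq_superset:
  assumes "finite A" "{i. coord x i \<noteq> 0} \<subseteq> A"
  shows "inner x y = (\<Sum>i\<in>A. coord x i * coord y i)"
  unfolding inner_fseq_def using assms by (intro sum.mono_neutral_left) auto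

instance
proof
  fix x y z :: fseq and r :: real
  let ?A = "{i. coord x i \<noteq> 0} \<union> {i. coord y i \<noteq> 0}"
  have A: "finite ?A" by simp
  show "inner x y = inner y x"
    using inner_fseq_superset[OF A, of x y] inner_fseq_superset[OF A, of y x]
    by (simp add: mult.commute)
  have "inner (x + y) z = (\<Sum>i\<in>?A. coord (x + y) i * coord z i)"
    by (rule inner_fseq_superset[OF A]) auto
  moreover have "inner x z = (\<Sum>i\<in>?A. coord x i * coord z i)"
    by (rule inner_fseq_superset[OF A]) auto
  moreover have "inner y z = (\<Sum>i\<in>?A. coord y i * coord z i)"
    by (rule inner_fseq_superset[OF A]) auto
  ultimately show "inner (x + y) z = inner x z + inner y z"
    by (simp add: sum.distrib algebra_simps)
  have "inner (r *\<^sub>R x) y = (\<Sum>i | coord x i \<noteq> 0. coord (r *\<^sub>R x) i * coord y i)"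
    by (rule inner_fseq_superset) auto
  then show "inner (r *\<^sub>R x) y = r * inner x y"
    by (simp add: inner_fseq_def sum_distrib_left algebra_simps)
  show "0 \<le> inner x x"
    by (auto simp: inner_fseq_def intro: sum_nonneg)
  show "inner x x = 0 \<longleftrightarrow> x = 0"
    by (auto simp: inner_fseq_def sum_nonneg_eq_0_iff fseq_eq_iff)
qed (simp_all add: norm_fseq_def sgn_fseq_def dist_fseq_def uniformity_fseq_def open_fseq_def)

end

definition Rn :: "nat \<Rightarrow> fseq set"
  where "Rn n = {x. \<forall>i. i \<notin> {1..n} \<longrightarrow> coord x i = 0}"


section \<open>Calculus on a finite-dimensional subspace\<close>

text \<open>
  Throughout, \<open>S\<close> is the ambient space \<open>\<real>\<^sup>n\<close>, and derivatives are taken at points interior to the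
  domain relative to \<open>S\<close>.  A derivative \<open>at x within S\<close> is a linear map on the whole type which is
  determined only on \<open>S\<close>; it is evaluated only at directions in \<open>S\<close>.
\<close>

definition interior_in :: "'a::topological_space set \<Rightarrow> 'a set \<Rightarrow> 'a set"
  where "interior_in S C = top_of_set S interior_of C"

definition deriv1 :: "'a::real_inner set \<Rightarrow> ('a \<Rightarrow> real) \<Rightarrow> 'a \<Rightarrow> 'a \<Rightarrow> real"
  where "deriv1 S f x h = frechet_derivative f (at x within S) h"

definition deriv2 :: "'a::real_inner set \<Rightarrow> ('a \<Rightarrow> real) \<Rightarrow> 'a \<Rightarrow> 'a \<Rightarrow> 'a \<Rightarrow> real"
  where "deriv2 S f x h k = deriv1 S (\<lambda>y. deriv1 S f y h) x k"

definition deriv3 :: "'a::real_inner set \<Rightarrow> ('a \<Rightarrow> real) \<Rightarrow> 'a \<Rightarrow> 'a \<Rightarrow> 'a \<Rightarrow> 'a \<Rightarrow> real"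
  where "deriv3 S f x h k m = deriv1 S (\<lambda>y. deriv2 S f y h k) x m"

text \<open>
  \<open>C_k S k U f\<close>: \<open>f\<close> is \<open>k\<close> times continuously differentiable on the open subset \<open>U\<close> of \<open>S\<close>.  As \<open>S\<close> is
  finite-dimensional, continuity of the derivatives may be asked direction by direction.
\<close>

primrec C_k :: "'a::real_inner set \<Rightarrow> nat \<Rightarrow> 'a set \<Rightarrow> ('a \<Rightarrow> real) \<Rightarrow> bool"
  where
    "C_k S 0 U f \<longleftrightarrow> continuous_on U f"
  | "C_k S (Suc k) U f \<longleftrightarrow>
       (\<forall>x\<in>U. f differentiable (at x within S)) \<and> (\<forall>h\<in>S. C_k S k U (\<lambda>x. deriv1 S f x h))"

definition gradient :: "'a::real_inner set \<Rightarrow> ('a \<Rightarrow> real) \<Rightarrow> 'a \<Rightarrow> 'a"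
  where "gradient S f x =
    (THE g. g \<in> S \<and> (f has_derivative (\<lambda>h. g \<bullet> h)) (at x within S))"

definition hessian :: "'a::real_inner set \<Rightarrow> ('a \<Rightarrow> real) \<Rightarrow> 'a \<Rightarrow> 'a \<Rightarrow> 'a"
  where "hessian S f x h = frechet_derivative (gradient S f) (at x within S) h"

text \<open>
  The Fenchel conjugate of the function that is \<open>f\<close> on \<open>U\<close> and \<open>\<infinity>\<close> elsewhere.  The supremum is
  taken in \<open>\<real>\<close>; it is finite for every \<open>\<theta>\<close> in the situation considered here, because the domain of
  a \<open>\<theta>\<close>-self-concordant barrier that has a minimiser and a positive definite Hessian is bounded.
\<close>

definition fenchel_conjugate :: "'a::real_inner set \<Rightarrow> ('a \<Rightarrow> real) \<Rightarrow> 'a \<Rightarrow> real"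
  where "fenchel_conjugate U f \<theta> = (SUP x\<in>U. \<theta> \<bullet> x - f x)"


section \<open>Self-concordant Legendre barriers\<close>

text \<open>
  In this section \<open>C\<close> is a closed convex subset of \<open>S\<close> and \<open>f\<close> matters only on its interior; the
  boundary of \<open>C\<close> is \<open>C - interior_in S C\<close>.
\<close>

definition self_concordant :: "'a::real_inner set \<Rightarrow> 'a set \<Rightarrow> ('a \<Rightarrow> real) \<Rightarrow> bool"
  where "self_concordant S C f \<longleftrightarrow>
    C_k S 3 (interior_in S C) f \<and> convex_on (interior_in S C) f \<and>
    (\<forall>x\<in>interior_in S C. \<forall>h\<in>S.
       \<bar>deriv3 S f x h h h\<bar> \<le> 2 * deriv2 S f x h h powr (3/2))"

definition theta_self_concordant :: "real \<Rightarrow> 'a::real_inner set \<Rightarrow> 'a set \<Rightarrow> ('a \<Rightarrow> real) \<Rightarrow> bool"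
  where "theta_self_concordant \<theta> S C f \<longleftrightarrow>
    self_concordant S C f \<and> 0 \<le> \<theta> \<and>
    (\<forall>x\<in>interior_in S C. \<forall>h\<in>S.
       \<bar>deriv1 S f x h\<bar> \<le> sqrt \<theta> * sqrt (deriv2 S f x h h))"

definition barrier :: "'a::real_inner set \<Rightarrow> 'a set \<Rightarrow> ('a \<Rightarrow> real) \<Rightarrow> bool"
  where "barrier S C f \<longleftrightarrow>
    (\<forall>z\<in>C - interior_in S C. filterlim f at_top (at z within interior_in S C))"

definition strictly_convex_on :: "'a::real_vector set \<Rightarrow> ('a \<Rightarrow> real) \<Rightarrow> bool"
  where "strictly_convex_on U f \<longleftrightarrow>
    (\<forall>x\<in>U. \<forall>y\<in>U. \<forall>u. x \<noteq> y \<and> 0 < u \<and> u < 1 \<longrightarrow>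
       f ((1 - u) *\<^sub>R x + u *\<^sub>R y) < (1 - u) * f x + u * f y)"

definition legendre :: "'a::real_inner set \<Rightarrow> 'a set \<Rightarrow> ('a \<Rightarrow> real) \<Rightarrow> bool"
  where "legendre S C f \<longleftrightarrow>
    strictly_convex_on (interior_in S C) f \<and>
    (\<forall>x\<in>interior_in S C. f differentiable (at x within S)) \<and>
    (\<forall>z\<in>C - interior_in S C.
       filterlim (\<lambda>x. norm (gradient S f x)) at_top (at z within interior_in S C))"

definition hessian_pos_def :: "'a::real_inner set \<Rightarrow> 'a set \<Rightarrow> ('a \<Rightarrow> real) \<Rightarrow> bool"
  where "hessian_pos_def S C f \<longleftrightarrow>
    (\<forall>x\<in>interior_in S C. \<forall>h\<in>S. h \<noteq> 0 \<longrightarrow> 0 < hessian S f x h \<bullet> h)"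

definition has_minimizer_on :: "'a set \<Rightarrow> ('a \<Rightarrow> real) \<Rightarrow> bool"
  where "has_minimizer_on U f \<longleftrightarrow> (\<exists>x\<in>U. \<forall>y\<in>U. f x \<le> f y)"

definition orthonormal_eigenbasis ::
    "nat \<Rightarrow> 'a::real_inner set \<Rightarrow> ('a \<Rightarrow> 'a) \<Rightarrow> (nat \<Rightarrow> 'a) \<Rightarrow> (nat \<Rightarrow> real) \<Rightarrow> bool"
  where "orthonormal_eigenbasis n S H e lam \<longleftrightarrow>
    (\<forall>i\<in>{1..n}. e i \<in> S \<and> H (e i) = lam i *\<^sub>R e i) \<and>
    (\<forall>i\<in>{1..n}. \<forall>j\<in>{1..n}. e i \<bullet> e j = (if i = j then 1 else 0))"


section \<open>Delayed linear bandits and Banker-BOLO\<close>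

definition polar_set :: "'a::real_inner set \<Rightarrow> 'a set \<Rightarrow> 'a set"
  where "polar_set S C = {l\<in>S. \<forall>x\<in>C. \<bar>l \<bullet> x\<bar> \<le> 1}"

text \<open>
  \<open>withdraw v ss b\<close> serves a demand \<open>b\<close> by withdrawing \<open>min (v s) b\<close>, with \<open>b\<close> the demand still
  open, from each account \<open>s\<close> in \<open>ss\<close> in turn.  It returns the amounts withdrawn and the demand
  left at the end.
\<close>

fun withdraw :: "(nat \<Rightarrow> real) \<Rightarrow> nat list \<Rightarrow> real \<Rightarrow> (nat \<Rightarrow> real) \<times> real"
  where
    "withdraw v [] b = ((\<lambda>_. 0), b)"
  | "withdraw v (s # ss) b =
       (let a = min (v s) b; (w, r) = withdraw v ss (b - a) in (w(s := a), r))"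

text \<open>
  The parameters are the dimension \<open>n\<close>, the action set \<open>C\<close>, the regulariser \<open>\<Psi>\<close>, the horizon \<open>T\<close>,
  the loss vectors \<open>l\<close> and the delays \<open>d\<close>; and the choices that the algorithm leaves open: the order
  \<open>ord t\<close> in which the arrived feedbacks are processed in round \<open>t\<close>, and the orthonormal eigenvectors
  \<open>e t x i\<close>, with eigenvalues \<open>lam t x i\<close>, used if the iterate of round \<open>t\<close> is \<open>x\<close>.

  An outcome \<open>\<omega>\<close> of the internal randomisation assigns to each round \<open>t\<close> the pair
  \<open>(i\<^sub>t, \<epsilon>\<^sub>t)\<close>.  The locale makes no assumptions; they are spelled out in the theorem.
\<close>

locale banker_bolo =
  fixes n :: nat
    and C :: "fseq set"
    and \<Psi> :: "fseq \<Rightarrow> real"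
    and T :: nat
    and l :: "nat \<Rightarrow> fseq"
    and d :: "nat \<Rightarrow> nat"
    and ord :: "nat \<Rightarrow> nat list"
    and e :: "nat \<Rightarrow> fseq \<Rightarrow> nat \<Rightarrow> fseq"
    and lam :: "nat \<Rightarrow> fseq \<Rightarrow> nat \<Rightarrow> real"
begin

definition total_delay :: nat
  where "total_delay = (\<Sum>t=1..T. d t)"

definition arrived :: "nat \<Rightarrow> nat set"
  where "arrived t = {s\<in>{1..<t}. s + d s < t}"

definition pending :: "nat \<Rightarrow> nat"
  where "pending t = card ({1..<t} - arrived t)"

definition pending_sum :: "nat \<Rightarrow> nat"
  where "pending_sum t = (\<Sum>r=1..t. pending r)"

definition sigma :: "nat \<Rightarrow> real"
  where "sigma t =
    max (inverse (sqrt (ln (real T) / (real n * real t)) +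
           (if pending_sum t = 0 then 0
            else real (pending t) *
              sqrt (ln (real (pending_sum t) + 1) * ln (real T) / (real n * real (pending_sum t))))))
        (8 * real n)"

text \<open>\<open>balance t s\<close> is the value of \<open>v\<^sub>s\<close> at the end of round \<open>t\<close>.\<close>

fun balance :: "nat \<Rightarrow> nat \<Rightarrow> real"
  where
    "balance 0 = (\<lambda>_. 0)"
  | "balance (Suc t) =
       (let v = (balance t)(Suc t := sigma (Suc t));
            w = fst (withdraw v (ord (Suc t)) (sigma (Suc t)))
        in (\<lambda>s. v s - w s))"

definition round_withdraw :: "nat \<Rightarrow> (nat \<Rightarrow> real) \<times> real"
  where "round_withdraw t =
    withdraw ((balance (t - 1))(t := sigma t)) (ord t) (sigma t)"

definition sigma2 :: "nat \<Rightarrow> nat \<Rightarrow> real"  \<comment> \<open>\<open>\<sigma>\<^sub>t\<^sub>,\<^sub>s\<close>\<close>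
  where "sigma2 t s = fst (round_withdraw t) s"

definition bank :: "nat \<Rightarrow> real"  \<comment> \<open>the final value of \<open>b\<^sub>t\<close>\<close>
  where "bank t = snd (round_withdraw t)"

abbreviation grad :: "fseq \<Rightarrow> fseq"
  where "grad \<equiv> gradient (Rn n) \<Psi>"

definition grad_conj :: "fseq \<Rightarrow> fseq"
  where "grad_conj = gradient (Rn n) (fenchel_conjugate (interior_in (Rn n) C) \<Psi>)"

definition x0 :: fseq
  where "x0 = grad_conj 0"

text \<open>The action, the revealed loss, the loss estimate and \<open>z\<^sub>t\<close>, given that the iterate \<open>x\<^sub>t\<close> is \<open>x\<close>.\<close>

definition action_at :: "(nat \<Rightarrow> nat \<times> real) \<Rightarrow> nat \<Rightarrow> fseq \<Rightarrow> fseq"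
  where "action_at \<omega> t x =
    (let (i, \<epsilon>) = \<omega> t in x + (\<epsilon> * lam t x i powr (-1/2)) *\<^sub>R e t x i)"

definition loss_at :: "(nat \<Rightarrow> nat \<times> real) \<Rightarrow> nat \<Rightarrow> fseq \<Rightarrow> real"
  where "loss_at \<omega> t x = l t \<bullet> action_at \<omega> t x"

definition estimate_at :: "(nat \<Rightarrow> nat \<times> real) \<Rightarrow> nat \<Rightarrow> fseq \<Rightarrow> fseq"
  where "estimate_at \<omega> t x =
    (let (i, \<epsilon>) = \<omega> t
     in (real n * loss_at \<omega> t x * \<epsilon> * lam t x i powr (1/2)) *\<^sub>R e t x i)"

definition z_at :: "(nat \<Rightarrow> nat \<times> real) \<Rightarrow> nat \<Rightarrow> fseq \<Rightarrow> fseq"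
  where "z_at \<omega> t x = grad_conj (grad x - (1 / sigma t) *\<^sub>R estimate_at \<omega> t x)"

text \<open>
  The iterate \<open>x\<^sub>t\<close>.  Only arrived feedback enters, as \<open>\<sigma>\<^sub>t\<^sub>,\<^sub>s = 0\<close> unless \<open>s\<close> is in \<open>ord t\<close>.
\<close>

fun iterate :: "(nat \<Rightarrow> nat \<times> real) \<Rightarrow> nat \<Rightarrow> fseq"
  where "iterate \<omega> t = grad_conj
    ((\<Sum>s\<in>{1..<t}. (sigma2 t s / sigma t) *\<^sub>R grad (z_at \<omega> s (iterate \<omega> s)))
      + (bank t / sigma t) *\<^sub>R grad x0)"

declare iterate.simps [simp del]

definition action :: "(nat \<Rightarrow> nat \<times> real) \<Rightarrow> nat \<Rightarrow> fseq"
  where "action \<omega> t = action_at \<omega> t (iterate \<omega> t)"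

text \<open>The pairs \<open>(i\<^sub>t, \<epsilon>\<^sub>t)\<close>, \<open>t = 1, \<dots>, T\<close>, are independent and uniform; the value outside the
  horizon is irrelevant.\<close>

definition randomness :: "(nat \<Rightarrow> nat \<times> real) pmf"
  where "randomness =
    Pi_pmf {1..T} (0, 0) (\<lambda>_. pair_pmf (pmf_of_set {1..n}) (pmf_of_set {-1, 1}))"

definition pseudo_regret :: real
  where "pseudo_regret =
    (SUP y\<in>C. measure_pmf.expectation randomness (\<lambda>\<omega>. \<Sum>t=1..T. l t \<bullet> (action \<omega> t - y)))"

end

end

theory Submission
  imports Defs
begin

text \<open>
  Write \<open>D\<close> for the Bregman divergence of \<open>\<Psi>\<close>.  The estimates are unbiased, and the three-point identity
  turns each \<open>\<langle>estimate, x\<^sub>t - y\<rangle>\<close> into \<open>\<sigma>\<^sub>t (D(y, x\<^sub>t) - D(y, z\<^sub>t) + D(x\<^sub>t, z\<^sub>t))\<close>.  Since \<open>D(y, x)\<close> is convex in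
  \<open>\<nabla>\<Psi>(x)\<close> and no account \<open>s\<close> pays out more than \<open>\<sigma>\<^sub>s\<close>, the first two terms telescope to
  \<open>(\<Sum>\<^sub>t b\<^sub>t) D(y, x\<^sub>0)\<close>, where \<open>D(y, x\<^sub>0) \<le> \<theta> ln T\<close> once \<open>y\<close> has been moved towards \<open>x\<^sub>0\<close> by a factor
  \<open>1 / T\<close>.  The floor \<open>8n\<close> keeps every dual step inside the region where self-concordance gives
  \<open>\<sigma>\<^sub>t D(x\<^sub>t, z\<^sub>t) = O(n\<^sup>2 / \<sigma>\<^sub>t)\<close>.  The bank lends only when all arrived accounts are empty, so the total
  loan is bounded by the deposits of one round and of the rounds pending in it; the \<open>k\<close>-th of these had
  at least \<open>k - 1\<close> pending predecessors, which yields a harmonic sum, and a round with \<open>m\<close> pending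
  predecessors forces a total delay of at least \<open>m\<^sup>2 / 2\<close>.  For \<open>T < n\<close> the trivial bound \<open>2T\<close> suffices.

  Existence and uniqueness of the dual points come from compactness: a barrier with nondegenerate
  minimiser has bounded domain, because \<open>\<phi>'' \<ge> \<phi>'\<^sup>2 / \<theta>\<close> along a ray blows up in finite time.
\<close>

section \<open>Self-concordance on a line\<close>

lemma DERIV_le_imp_increment_le:
  fixes f g :: "real \<Rightarrow> real"
  assumes "a \<le> b"
    and "\<And>t. a \<le> t \<Longrightarrow> t \<le> b \<Longrightarrow> (f has_real_derivative f' t) (at t)"
    and "\<And>t. a \<le> t \<Longrightarrow> t \<le> b \<Longrightarrow> (g has_real_derivative g' t) (at t)"
    and "\<And>t. a \<le> t \<Longrightarrow> t \<le> b \<Longrightarrow> f' t \<le> g' t"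
  shows "f b - f a \<le> g b - g a"
proof -
  have "(\<lambda>t. g t - f t) a \<le> (\<lambda>t. g t - f t) b"
  proof (rule DERIV_nonneg_imp_nondecreasing[OF assms(1)])
    fix t assume t: "a \<le> t" "t \<le> b"
    show "\<exists>y. ((\<lambda>t. g t - f t) has_real_derivative y) (at t) \<and> 0 \<le> y"
      using assms(2-4)[OF t] by (intro exI[of _ "g' t - f' t"]) (auto intro!: DERIV_diff)
  qed
  then show ?thesis by simp
qed

text \<open>Here and below, \<open>p\<close>, \<open>q\<close>, \<open>r\<close> are the first three derivatives of the restriction of the barrier
  to a line.\<close>

lemma self_concordant_inverse_sqrt_Lipschitz:
  fixes q r :: "real \<Rightarrow> real"
  assumes "a \<le> b"
    and deriv: "\<And>t. a \<le> t \<Longrightarrow> t \<le> b \<Longrightarrow> (q has_real_derivative r t) (at t)"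
    and pos: "\<And>t. a \<le> t \<Longrightarrow> t \<le> b \<Longrightarrow> q t > 0"
    and sc: "\<And>t. a \<le> t \<Longrightarrow> t \<le> b \<Longrightarrow> \<bar>r t\<bar> \<le> 2 * q t powr (3/2)"
  shows "\<bar>1 / sqrt (q b) - 1 / sqrt (q a)\<bar> \<le> b - a"
proof -
  \<comment> \<open>The derivative of \<open>q powr (-1/2)\<close> is
    \<open>- r / 2 * q powr (-3/2)\<close>, so self-concordance says exactly that this function has
    slope at most one in absolute value.\<close>
  define p where "p t = q t powr (-1/2)" for t
  define p' where "p' t = (-1/2) * q t powr (-3/2) * r t" for t
  have p: "(p has_real_derivative p' t) (at t)" if t: "a \<le> t" "t \<le> b" for t
    unfolding p_def p'_def
    using DERIV_chain2[OF has_real_derivative_powr[OF pos[OF t], of "-1/2"] deriv[OF t]] by simp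
  have p': "\<bar>p' t\<bar> \<le> 1" if t: "a \<le> t" "t \<le> b" for t
  proof -
    have "\<bar>p' t\<bar> = 1/2 * q t powr (-3/2) * \<bar>r t\<bar>" by (simp add: p'_def abs_mult)
    also have "\<dots> \<le> 1/2 * q t powr (-3/2) * (2 * q t powr (3/2))"
      by (intro mult_left_mono sc[OF t]) auto
    also have "\<dots> = q t powr (-3/2 + 3/2)" by (simp only: powr_add)
    also have "\<dots> = 1" using pos[OF t] by simp
    finally show ?thesis .
  qed
  have 1: "p b - p a \<le> b - a"
    by (rule DERIV_le_imp_increment_le[where f' = p' and g' = "\<lambda>_. 1", OF assms(1) p])
      (use p' in \<open>force simp: abs_le_iff\<close>)+
  have 2: "(-b) - (-a) \<le> p b - p a"
    by (rule DERIV_le_imp_increment_le[where f' = "\<lambda>_. -1" and g' = p', OF assms(1) _ p])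
      (use p' in \<open>force simp: abs_le_iff intro!: derivative_eq_intros\<close>)+
  have "p t = 1 / sqrt (q t)" if "a \<le> t" "t \<le> b" for t
    using pos[OF that] powr_minus_divide[of "q t" "1/2"] by (simp add: p_def powr_half_sqrt)
  then have "p a = 1 / sqrt (q a)" "p b = 1 / sqrt (q b)" using assms(1) by auto
  then show ?thesis using 1 2 by (simp add: abs_le_iff)
qed

text \<open>Since \<open>1 / sqrt q\<close> grows at most at unit speed, \<open>sqrt (q t)\<close>
  is at least \<open>\<rho> / (1 + \<rho> * t)\<close>. Squaring and integrating over
  \<open>[0, b]\<close> gives the left side.\<close>

lemma self_concordant_deriv_increment:
  fixes q r :: "real \<Rightarrow> real"
  assumes "0 \<le> b"
    and deriv1: "\<And>t. 0 \<le> t \<Longrightarrow> t \<le> b \<Longrightarrow> (p has_real_derivative q t) (at t)"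
    and deriv2: "\<And>t. 0 \<le> t \<Longrightarrow> t \<le> b \<Longrightarrow> (q has_real_derivative r t) (at t)"
    and pos: "\<And>t. 0 \<le> t \<Longrightarrow> t \<le> b \<Longrightarrow> q t > 0"
    and sc: "\<And>t. 0 \<le> t \<Longrightarrow> t \<le> b \<Longrightarrow> \<bar>r t\<bar> \<le> 2 * q t powr (3/2)"
    and \<rho>: "\<rho> = sqrt (q 0)"
  shows "\<rho> - \<rho> / (1 + \<rho> * b) \<le> p b - p 0"
proof -
  have \<rho>0: "\<rho> > 0" using pos[of 0] assms(1) \<rho> by simp
  have "(- \<rho> / (1 + \<rho> * b)) - (- \<rho> / (1 + \<rho> * 0)) \<le> p b - p 0"
  proof (rule DERIV_le_imp_increment_le[where f' = "\<lambda>t. \<rho>\<^sup>2 / (1 + \<rho> * t)\<^sup>2", OF assms(1) _ deriv1])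
    fix t assume t: "0 \<le> t" "t \<le> b"
    have nz: "1 + \<rho> * t > 0" using \<rho>0 t(1) by (simp add: add_pos_nonneg)
    show "((\<lambda>t. - \<rho> / (1 + \<rho> * t)) has_real_derivative \<rho>\<^sup>2 / (1 + \<rho> * t)\<^sup>2) (at t)"
      using nz by (auto intro!: derivative_eq_intros simp: power2_eq_square)
    have "\<bar>1 / sqrt (q t) - 1 / sqrt (q 0)\<bar> \<le> t - 0"
      using t by (intro self_concordant_inverse_sqrt_Lipschitz[where r = r] deriv2 pos sc) auto
    then have "1 / sqrt (q t) \<le> 1 / \<rho> + t" by (simp add: \<rho> abs_le_iff)
    also have "\<dots> = (1 + \<rho> * t) / \<rho>" using \<rho>0 by (simp add: field_simps)
    finally have "\<rho> / (1 + \<rho> * t) \<le> sqrt (q t)"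
      using pos[OF t] nz \<rho>0 by (simp add: field_simps)
    then have "(\<rho> / (1 + \<rho> * t))\<^sup>2 \<le> (sqrt (q t))\<^sup>2"
      using nz \<rho>0 by (intro power_mono) auto
    then show "\<rho>\<^sup>2 / (1 + \<rho> * t)\<^sup>2 \<le> q t" using pos[OF t] by (simp add: power_divide)
  qed
  then show ?thesis by simp
qed

text \<open>The hypotheses combine into \<open>q \<ge> p^2 / \<theta>\<close>, so
  \<open>- 1 / p\<close> increases at rate at least \<open>1 / \<theta>\<close> wherever
  \<open>p\<close> is positive. A value above \<open>\<theta> / (1 - t)\<close> would force
  \<open>p\<close> to blow up before time one.\<close>

lemma barrier_deriv_bound:
  fixes p q :: "real \<Rightarrow> real"
  assumes deriv: "\<And>t. 0 \<le> t \<Longrightarrow> t < 1 \<Longrightarrow> (p has_real_derivative q t) (at t)"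
    and nonneg: "\<And>t. 0 \<le> t \<Longrightarrow> t < 1 \<Longrightarrow> q t \<ge> 0"
    and bar: "\<And>t. 0 \<le> t \<Longrightarrow> t < 1 \<Longrightarrow> (p t)\<^sup>2 \<le> \<theta> * q t"
    and "0 < \<theta>" and t: "0 \<le> t" "t < 1"
  shows "p t * (1 - t) \<le> \<theta>"
proof (rule ccontr)
  assume "\<not> p t * (1 - t) \<le> \<theta>"
  then have gt: "\<theta> < p t * (1 - t)" by simp
  have pt: "p t > 0"
    using gt \<open>0 < \<theta>\<close> t by (smt (verit) mult_nonpos_nonneg)
  \<comment> \<open>The blow-up time of the comparison equation started from \<open>p t\<close>; the
    negated claim places it before one.\<close>
  define s where "s = t + \<theta> / p t"
  have s: "t < s" "s < 1" using gt pt \<open>0 < \<theta>\<close> by (auto simp: s_def field_simps)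
  have mono: "p t \<le> p u" if u: "t \<le> u" "u \<le> s" for u
  proof (rule DERIV_nonneg_imp_nondecreasing[OF u(1)])
    fix v assume "t \<le> v" "v \<le> u"
    then have "0 \<le> v" "v < 1" using t s u by auto
    then show "\<exists>y. (p has_real_derivative y) (at v) \<and> 0 \<le> y"
      using deriv nonneg by blast
  qed
  have "s / \<theta> - t / \<theta> \<le> (- 1 / p s) - (- 1 / p t)"
  proof (rule DERIV_le_imp_increment_le[where f' = "\<lambda>_. 1 / \<theta>" and g' = "\<lambda>u. q u / (p u)\<^sup>2"
        and g = "\<lambda>u. - 1 / p u" and f = "\<lambda>u. u / \<theta>"])
    fix u assume u: "t \<le> u" "u \<le> s"
    have u': "0 \<le> u" "u < 1" "p u > 0" using mono[OF u] pt t s u by auto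
    show "((\<lambda>u. u / \<theta>) has_real_derivative 1 / \<theta>) (at u)"
      using \<open>0 < \<theta>\<close> by (auto intro!: derivative_eq_intros)
    show "((\<lambda>u. - 1 / p u) has_real_derivative q u / (p u)\<^sup>2) (at u)"
      using u' by (auto intro!: derivative_eq_intros deriv simp: power2_eq_square)
    show "1 / \<theta> \<le> q u / (p u)\<^sup>2"
      using bar[OF u'(1,2)] u'(3) \<open>0 < \<theta>\<close> by (simp add: field_simps)
  qed (use s in auto)
  moreover have "s / \<theta> - t / \<theta> = 1 / p t" using pt \<open>0 < \<theta>\<close> by (simp add: s_def field_simps)
  moreover have "p s > 0" using mono[of s] pt s by auto
  ultimately show False by simp
qed

text \<open>Integrates the slope bound \<open>\<theta> / (1 - u)\<close>. This is the origin of the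
  logarithmic price for approaching the boundary.\<close>

lemma barrier_increment_bound:
  fixes p q \<phi> :: "real \<Rightarrow> real"
  assumes deriv1: "\<And>t. 0 \<le> t \<Longrightarrow> t < 1 \<Longrightarrow> (\<phi> has_real_derivative p t) (at t)"
    and deriv2: "\<And>t. 0 \<le> t \<Longrightarrow> t < 1 \<Longrightarrow> (p has_real_derivative q t) (at t)"
    and nonneg: "\<And>t. 0 \<le> t \<Longrightarrow> t < 1 \<Longrightarrow> q t \<ge> 0"
    and bar: "\<And>t. 0 \<le> t \<Longrightarrow> t < 1 \<Longrightarrow> (p t)\<^sup>2 \<le> \<theta> * q t"
    and "0 < \<theta>" and t: "0 \<le> t" "t < 1"
  shows "\<phi> t - \<phi> 0 \<le> - \<theta> * ln (1 - t)"
proof -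
  have "\<phi> t - \<phi> 0 \<le> (- \<theta> * ln (1 - t)) - (- \<theta> * ln (1 - 0))"
  proof (rule DERIV_le_imp_increment_le[where f' = p and g' = "\<lambda>u. \<theta> / (1 - u)"
        and g = "\<lambda>t. - \<theta> * ln (1 - t)"])
    fix u assume u: "0 \<le> u" "u \<le> t"
    then show "((\<lambda>t. - \<theta> * ln (1 - t)) has_real_derivative \<theta> / (1 - u)) (at u)"
      using t by (auto intro!: derivative_eq_intros)
    show "p u \<le> \<theta> / (1 - u)"
      using barrier_deriv_bound[of p q \<theta> u, OF deriv2 nonneg bar \<open>0 < \<theta>\<close>] u t
      by (simp add: field_simps)
  qed (use t deriv1 in auto)
  then show ?thesis by simp
qed

text \<open>Up to time \<open>a\<close> the function \<open>1 / sqrt q\<close> stays above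
  \<open>m\<close>, so \<open>q\<close> is at most \<open>1 / m^2\<close>, and integrating twice
  bounds \<open>\<phi>\<close>. It serves to contradict the barrier property at a boundary point
  reached too early.\<close>

lemma self_concordant_bounded_above:
  fixes q r :: "real \<Rightarrow> real"
  assumes deriv0: "\<And>t. 0 \<le> t \<Longrightarrow> t < a \<Longrightarrow> (\<phi> has_real_derivative p t) (at t)"
    and deriv1: "\<And>t. 0 \<le> t \<Longrightarrow> t < a \<Longrightarrow> (p has_real_derivative q t) (at t)"
    and deriv2: "\<And>t. 0 \<le> t \<Longrightarrow> t < a \<Longrightarrow> (q has_real_derivative r t) (at t)"
    and pos: "\<And>t. 0 \<le> t \<Longrightarrow> t < a \<Longrightarrow> q t > 0"
    and sc: "\<And>t. 0 \<le> t \<Longrightarrow> t < a \<Longrightarrow> \<bar>r t\<bar> \<le> 2 * q t powr (3/2)"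
    and a: "0 < a" "a * sqrt (q 0) < 1"
  shows "\<exists>M. \<forall>t. 0 \<le> t \<and> t < a \<longrightarrow> \<phi> t \<le> M"
proof -
  define m where "m = 1 / sqrt (q 0) - a"
  have m: "m > 0" using a pos[of 0] by (simp add: m_def field_simps)
  have q_le: "q t \<le> 1 / m\<^sup>2" if t: "0 \<le> t" "t < a" for t
  proof -
    have "\<bar>1 / sqrt (q t) - 1 / sqrt (q 0)\<bar> \<le> t - 0"
      using t by (intro self_concordant_inverse_sqrt_Lipschitz[where r = r] deriv2 pos sc) auto
    then have "m \<le> 1 / sqrt (q t)" using t by (simp add: m_def abs_le_iff)
    then have "m\<^sup>2 \<le> (1 / sqrt (q t))\<^sup>2" using m by (intro power_mono) auto
    then show ?thesis using pos[OF t] m by (simp add: power_divide field_simps)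
  qed
  have p_le: "p t \<le> p 0 + a / m\<^sup>2" if t: "0 \<le> t" "t < a" for t
  proof -
    have "p t - p 0 \<le> 1 / m\<^sup>2 * t - 1 / m\<^sup>2 * 0"
    proof (rule DERIV_le_imp_increment_le[where f' = q and g' = "\<lambda>_. 1 / m\<^sup>2"])
      fix u assume "0 \<le> u" "u \<le> t"
      show "((\<lambda>t. 1 / m\<^sup>2 * t) has_real_derivative 1 / m\<^sup>2) (at u)"
        by (rule DERIV_cmult_Id)
    qed (use t q_le deriv1 in auto)
    moreover have "t / m\<^sup>2 \<le> a / m\<^sup>2" using t m by (intro divide_right_mono) auto
    ultimately show ?thesis by simp
  qed
  define N where "N = \<bar>p 0 + a / m\<^sup>2\<bar>"
  have "\<phi> t \<le> \<phi> 0 + N * a" if t: "0 \<le> t" "t < a" for t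
  proof -
    have "\<phi> t - \<phi> 0 \<le> N * t - N * 0"
    proof (rule DERIV_le_imp_increment_le[where f' = p and g' = "\<lambda>_. N"])
      fix u assume u: "0 \<le> u" "u \<le> t"
      show "((\<lambda>t. N * t) has_real_derivative N) (at u)"
        by (auto intro!: derivative_eq_intros)
      show "p u \<le> N" using p_le[of u] u t by (auto simp: N_def)
    qed (use t deriv0 in auto)
    moreover have "N * t \<le> N * a" using t by (intro mult_left_mono) (auto simp: N_def)
    ultimately show ?thesis by simp
  qed
  then show ?thesis by blast
qed

section \<open>Derivatives within a finite-dimensional subspace\<close>

lemma line_in_subspace:
  assumes "subspace S" "x \<in> S" "h \<in> S"
  shows "x + t *\<^sub>R h \<in> S"
  by (intro subspace_add subspace_mul assms)

lemma has_derivative_along_line: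
  assumes "subspace S" "x \<in> S" "h \<in> S"
    and "(f has_derivative f') (at (x + t *\<^sub>R h) within S)"
  shows "((\<lambda>t. f (x + t *\<^sub>R h)) has_derivative (\<lambda>s. f' (s *\<^sub>R h))) (at t)"
proof -
  have g: "((\<lambda>t. x + t *\<^sub>R h) has_derivative (\<lambda>s. s *\<^sub>R h)) (at t)"
    by (auto intro!: derivative_eq_intros)
  have "(f has_derivative f') (at (x + t *\<^sub>R h) within range (\<lambda>t. x + t *\<^sub>R h))"
    using line_in_subspace[OF assms(1-3)] by (intro has_derivative_subset[OF assms(4)]) auto
  from has_derivative_in_compose[OF g this] show ?thesis by simp
qed

text \<open>Restriction to the line through \<open>x\<close> in direction \<open>h\<close> reduces
  the claim to uniqueness of one-variable derivatives.\<close>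

lemma has_derivative_unique_on_subspace:
  assumes "subspace S" "x \<in> S" "h \<in> S"
    and "(f has_derivative f') (at x within S)" "(f has_derivative g') (at x within S)"
  shows "f' h = g' h"
proof -
  have "(\<lambda>s. f' (s *\<^sub>R h)) = (\<lambda>s. g' (s *\<^sub>R h))"
    using assms by (intro has_derivative_unique[where x = 0 and f = "\<lambda>t. f (x + t *\<^sub>R h)"]
        has_derivative_along_line[where S = S]) auto
  then have "f' (1 *\<^sub>R h) = g' (1 *\<^sub>R h)" by metis
  then show ?thesis by simp
qed

text \<open>Difference quotients within \<open>S\<close> only see increments in \<open>S\<close>, so
  the values of the linear map elsewhere may be exchanged.\<close>

lemma has_derivative_cong_on_subspace:
  assumes "subspace S" "x \<in> S" "(f has_derivative f') (at x within S)" "bounded_linear g'"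
    and eq: "\<And>h. h \<in> S \<Longrightarrow> f' h = g' h"
  shows "(f has_derivative g') (at x within S)"
proof -
  have "\<forall>\<^sub>F y in at x within S. norm (f y - f x - f' (y - x)) / norm (y - x) =
      norm (f y - f x - g' (y - x)) / norm (y - x)"
    unfolding eventually_at_filter using subspace_diff[OF assms(1) _ assms(2)] eq
    by (auto intro!: always_eventually)
  with assms(3,4) show ?thesis
    unfolding has_derivative_iff_norm by (auto elim: Lim_transform_eventually)
qed

lemma deriv1_eqI:
  assumes "subspace S" "x \<in> S" "h \<in> S" "(f has_derivative f') (at x within S)"
  shows "deriv1 S f x h = f' h"
  unfolding deriv1_def
  using has_derivative_unique_on_subspace[OF assms(1-3) _ assms(4)] assms(4)
  by (meson differentiableI frechet_derivative_works)

lemma has_derivative_deriv1: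
  assumes "f differentiable (at x within S)"
  shows "(f has_derivative deriv1 S f x) (at x within S)"
  using assms unfolding deriv1_def by (simp add: frechet_derivative_works)

lemma linear_deriv1:
  assumes "f differentiable (at x within S)"
  shows "linear (deriv1 S f x)"
  using has_derivative_deriv1[OF assms] by (rule has_derivative_linear)

lemma has_real_derivative_along_line:
  assumes "subspace S" "x \<in> S" "h \<in> S" "f differentiable (at (x + t *\<^sub>R h) within S)"
  shows "((\<lambda>t. f (x + t *\<^sub>R h)) has_real_derivative deriv1 S f (x + t *\<^sub>R h) h) (at t)"
proof -
  interpret linear "deriv1 S f (x + t *\<^sub>R h)" by (rule linear_deriv1[OF assms(4)])
  show ?thesis
    using has_derivative_along_line[OF assms(1-3) has_derivative_deriv1[OF assms(4)]]
    unfolding has_field_derivative_def by (simp add: scale mult.commute[of _ "deriv1 _ _ _ _"])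
qed

lemma gradient_eqI:
  assumes "subspace S" "x \<in> S" "g \<in> S" "(f has_derivative (\<lambda>h. g \<bullet> h)) (at x within S)"
  shows "gradient S f x = g"
  unfolding gradient_def
proof (rule the_equality)
  fix g' assume g': "g' \<in> S \<and> (f has_derivative (\<lambda>h. g' \<bullet> h)) (at x within S)"
  have gg: "g' - g \<in> S" using assms g' by (auto intro: subspace_diff)
  have "g' \<bullet> (g' - g) = g \<bullet> (g' - g)"
    using has_derivative_unique_on_subspace[OF assms(1,2) gg _ assms(4)] g' by blast
  then have "(g' - g) \<bullet> (g' - g) = 0" by (simp add: inner_diff_left)
  then show "g' = g" by simp
qed (use assms in auto)

section \<open>Orthonormal bases, gradients and Hessians\<close>

locale onb_subspace =
  fixes S :: "'a::real_inner set" and B :: "'a set"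
  assumes finite_basis: "finite B" and span_basis: "span B = S"
    and orthonormal_basis: "\<And>b b'. b \<in> B \<Longrightarrow> b' \<in> B \<Longrightarrow> b \<bullet> b' = (if b = b' then 1 else 0)"
begin

lemma subspace: "subspace S"
  using span_basis subspace_span by blast

lemma basis_in: "b \<in> B \<Longrightarrow> b \<in> S"
  using span_basis span_base by blast

lemma basis_expansion:
  assumes "v \<in> S"
  shows "v = (\<Sum>b\<in>B. (v \<bullet> b) *\<^sub>R b)"
proof -
  obtain a where v: "v = (\<Sum>b\<in>B. a b *\<^sub>R b)"
    using assms span_finite[OF finite_basis] span_basis by auto
  have "v \<bullet> c = a c" if "c \<in> B" for c
  proof -
    have "v \<bullet> c = (\<Sum>b\<in>B. a b * (b \<bullet> c))" by (simp add: v inner_sum_left)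
    also have "\<dots> = (\<Sum>b\<in>B. if b = c then a b else 0)"
      by (intro sum.cong) (auto simp: orthonormal_basis that)
    also have "\<dots> = a c" using that finite_basis by simp
    finally show ?thesis .
  qed
  then show ?thesis by (subst v) (auto intro!: sum.cong)
qed

lemma inner_basis_expansion:
  assumes "v \<in> S"
  shows "v \<bullet> w = (\<Sum>b\<in>B. (v \<bullet> b) * (b \<bullet> w))"
  by (subst basis_expansion[OF assms]) (simp add: inner_sum_left)

lemma basis_combination_in: "(\<Sum>b\<in>B. a b *\<^sub>R b) \<in> S"
  by (intro subspace_sum subspace subspace_mul basis_in)

text \<open>The Riesz representative of the derivative is assembled from the basis; uniqueness then
  identifies it with the definite description behind \<open>gradient\<close>.\<close>

lemma gradient_properties:
  assumes "f differentiable (at x within S)" "x \<in> S"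
  shows gradient_in: "gradient S f x \<in> S"
    and has_derivative_gradient: "(f has_derivative (\<lambda>h. gradient S f x \<bullet> h)) (at x within S)"
    and gradient_expansion: "gradient S f x = (\<Sum>b\<in>B. deriv1 S f x b *\<^sub>R b)"
proof -
  interpret linear "deriv1 S f x" by (rule linear_deriv1[OF assms(1)])
  define g where "g = (\<Sum>b\<in>B. deriv1 S f x b *\<^sub>R b)"
  have g: "g \<in> S" unfolding g_def by (rule basis_combination_in)
  have "(f has_derivative (\<lambda>h. g \<bullet> h)) (at x within S)"
  proof (rule has_derivative_cong_on_subspace[OF subspace assms(2) has_derivative_deriv1[OF assms(1)]])
    fix h assume h: "h \<in> S"
    have "deriv1 S f x h = deriv1 S f x (\<Sum>b\<in>B. (h \<bullet> b) *\<^sub>R b)"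
      using basis_expansion[OF h] by simp
    also have "\<dots> = g \<bullet> h"
      by (simp add: sum scale g_def inner_sum_left inner_commute[of h] mult.commute)
    finally show "deriv1 S f x h = g \<bullet> h" .
  qed (rule bounded_linear_inner_right)
  moreover from gradient_eqI[OF subspace assms(2) g this] have "gradient S f x = g" .
  ultimately show "gradient S f x \<in> S" "(f has_derivative (\<lambda>h. gradient S f x \<bullet> h)) (at x within S)"
    "gradient S f x = (\<Sum>b\<in>B. deriv1 S f x b *\<^sub>R b)" using g by (simp_all add: g_def)
qed

lemma gradient_inner:
  assumes "f differentiable (at x within S)" "x \<in> S" "h \<in> S"
  shows "gradient S f x \<bullet> h = deriv1 S f x h"
  using deriv1_eqI[OF subspace assms(2,3) has_derivative_gradient[OF assms(1,2)]] by simp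

text \<open>Near \<open>x\<close> the gradient is a finite combination of directional derivatives,
  hence differentiable at \<open>x\<close>. The Hessian argument \<open>h\<close> is the direction
  of the second differentiation and therefore comes last in \<open>deriv2\<close>.\<close>

lemma hessian_inner:
  assumes "x \<in> S" "h \<in> S" "k \<in> S" "\<epsilon> > 0"
    and diff: "\<And>y. y \<in> S \<Longrightarrow> dist y x < \<epsilon> \<Longrightarrow> f differentiable (at y within S)"
    and diff1: "\<And>h. h \<in> S \<Longrightarrow> (\<lambda>y. deriv1 S f y h) differentiable (at x within S)"
  shows "hessian S f x h \<bullet> k = deriv2 S f x k h" and "linear (hessian S f x)"
proof -
  let ?G = "\<lambda>y. \<Sum>b\<in>B. deriv1 S f y b *\<^sub>R b"
  let ?H = "\<lambda>h. \<Sum>b\<in>B. deriv2 S f x b h *\<^sub>R b"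
  have "(?G has_derivative ?H) (at x within S)"
    unfolding deriv2_def
    by (intro has_derivative_sum has_derivative_scaleR_left has_derivative_deriv1 diff1 basis_in)
  then have GH: "(gradient S f has_derivative ?H) (at x within S)"
    by (rule has_derivative_transform_within[OF _ assms(4,1)])
      (simp add: gradient_expansion diff)
  then have F: "(gradient S f has_derivative hessian S f x) (at x within S)"
    unfolding hessian_def by (meson differentiableI frechet_derivative_works)
  then show "linear (hessian S f x)" by (rule has_derivative_linear)
  have eq: "hessian S f x h = ?H h"
    by (rule has_derivative_unique_on_subspace[OF subspace assms(1,2) F GH])
  have "((\<lambda>y. deriv1 S f y k) has_derivative (\<lambda>h. \<Sum>b\<in>B. deriv2 S f x b h * (b \<bullet> k))) (at x within S)"
  proof (rule has_derivative_transform_within[OF _ assms(4,1)])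
    show "((\<lambda>y. \<Sum>b\<in>B. deriv1 S f y b * (b \<bullet> k)) has_derivative
        (\<lambda>h. \<Sum>b\<in>B. deriv2 S f x b h * (b \<bullet> k))) (at x within S)"
      unfolding deriv2_def
      by (intro has_derivative_sum has_derivative_mult_left has_derivative_deriv1 diff1 basis_in)
    fix y assume y: "y \<in> S" "dist y x < \<epsilon>"
    have "deriv1 S f y k = gradient S f y \<bullet> k"
      using gradient_inner[OF diff[OF y] y(1) assms(3)] by simp
    then show "(\<Sum>b\<in>B. deriv1 S f y b * (b \<bullet> k)) = deriv1 S f y k"
      by (simp add: gradient_expansion diff y inner_sum_left)
  qed
  from deriv1_eqI[OF subspace assms(1,2) this]
  show "hessian S f x h \<bullet> k = deriv2 S f x k h"
    unfolding eq deriv2_def[of S f x k] by (simp add: inner_sum_left)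
qed

text \<open>Heine-Borel in \<open>S\<close>: basis combinations with coefficients in
  \<open>{- r..r}\<close> form a compact set, built from intervals by products and continuous
  images, and Cauchy-Schwarz puts \<open>K\<close> inside it.\<close>

lemma compact_closed_bounded:
  assumes "K \<subseteq> S" "closed K" "\<And>x. x \<in> K \<Longrightarrow> norm x \<le> r"
  shows "compact K"
proof -
  have comp: "finite A \<Longrightarrow> compact {\<Sum>b\<in>A. a b *\<^sub>R b | a. \<forall>b\<in>A. a b \<in> {- r..r}}" for A :: "'a set"
  proof (induction A rule: finite_induct)
    case (insert c A)
    let ?K = "{\<Sum>b\<in>A. a b *\<^sub>R b | a. \<forall>b\<in>A. a b \<in> {- r..r}}"
    have "compact ((\<lambda>(u, v). u *\<^sub>R c + v) ` ({- r..r} \<times> ?K))"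
      by (intro compact_continuous_image compact_Times insert)
        (auto intro!: continuous_intros simp: split_beta)
    also have "(\<lambda>(u, v). u *\<^sub>R c + v) ` ({- r..r} \<times> ?K) =
        {\<Sum>b\<in>insert c A. a b *\<^sub>R b | a. \<forall>b\<in>insert c A. a b \<in> {- r..r}}" (is "?L = ?R")
    proof
      show "?L \<subseteq> ?R"
      proof clarify
        fix u and a :: "'a \<Rightarrow> real"
        assume u: "u \<in> {- r..r}" and a: "\<forall>b\<in>A. a b \<in> {- r..r}"
        have "(\<Sum>b\<in>A. (a(c := u)) b *\<^sub>R b) = (\<Sum>b\<in>A. a b *\<^sub>R b)"
          using insert by (intro sum.cong) auto
        then show "\<exists>a'. u *\<^sub>R c + (\<Sum>b\<in>A. a b *\<^sub>R b) = (\<Sum>b\<in>insert c A. a' b *\<^sub>R b) \<and>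
            (\<forall>b\<in>insert c A. a' b \<in> {- r..r})"
          using insert u a by (intro exI[of _ "a(c := u)"]) (auto simp del: fun_upd_apply, auto)
      qed
      show "?R \<subseteq> ?L"
        using insert by (force simp: image_iff)
    qed
    finally show ?case .
  qed simp
  have "K \<subseteq> {\<Sum>b\<in>B. a b *\<^sub>R b | a. \<forall>b\<in>B. a b \<in> {- r..r}}"
  proof
    fix x assume x: "x \<in> K"
    have "x \<bullet> b \<in> {- r..r}" if b: "b \<in> B" for b
    proof -
      have "\<bar>x \<bullet> b\<bar> \<le> norm x * norm b" by (rule Cauchy_Schwarz_ineq2)
      also have "norm b = 1" using orthonormal_basis[OF b b] by (simp add: norm_eq_sqrt_inner)
      finally show ?thesis using assms(3)[OF x] by (auto simp: abs_le_iff)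
    qed
    moreover have "x = (\<Sum>b\<in>B. (x \<bullet> b) *\<^sub>R b)" using x assms(1) by (intro basis_expansion) auto
    ultimately show "x \<in> {\<Sum>b\<in>B. a b *\<^sub>R b | a. \<forall>b\<in>B. a b \<in> {- r..r}}" by blast
  qed
  then show ?thesis
    using compact_Int_closed[OF comp[OF finite_basis] assms(2)] by (simp add: Int_absorb1)
qed

text \<open>A vector of \<open>S\<close> outside \<open>span E\<close> would enlarge
  \<open>E\<close> to an independent set with more elements than \<open>B\<close>. Applied to the
  eigenvectors of the Hessian.\<close>

lemma onb_subspace_of_card:
  assumes "finite E" "E \<subseteq> S" "card E = card B"
    and "\<And>b b'. b \<in> E \<Longrightarrow> b' \<in> E \<Longrightarrow> b \<bullet> b' = (if b = b' then 1 else 0)"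
  shows "onb_subspace S E"
proof
  have indep: "independent A" if "\<And>b b'. b \<in> A \<Longrightarrow> b' \<in> A \<Longrightarrow> b \<bullet> b' = (if b = b' then 1 else 0)"
    for A :: "'a set"
    using that by (intro pairwise_orthogonal_independent)
      (force simp: pairwise_def orthogonal_def)+
  have "v \<in> span E" if v: "v \<in> S" for v
  proof (rule ccontr)
    assume "v \<notin> span E"
    then have "independent (insert v E)" "v \<notin> E"
      using indep[of E] assms(4) by (auto simp: independent_insert intro: span_base)
    moreover have "insert v E \<subseteq> span B" using v assms(2) span_basis by auto
    ultimately have "card (insert v E) \<le> card B"
      using independent_span_bound[OF finite_basis] by blast
    with \<open>v \<notin> E\<close> assms(1,3) show False by simp
  qed
  then show "span E = S"
    using span_minimal[OF assms(2) subspace] by blast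
qed (use assms in auto)

end

section \<open>The coordinate spaces and their standard bases\<close>

definition Rn_unit :: "nat \<Rightarrow> fseq"
  where "Rn_unit i = Abs_fseq (\<lambda>j. if j = i then 1 else 0)"

lemma coord_Rn_unit: "coord (Rn_unit i) j = (if j = i then 1 else 0)"
  unfolding Rn_unit_def by (subst Abs_fseq_inverse) auto

lemma inner_Rn_unit: "Rn_unit i \<bullet> x = coord x i"
  by (subst inner_fseq_superset[of "{i}"]) (auto simp: coord_Rn_unit)

lemma coord_sum: "coord (\<Sum>i\<in>A. f i) j = (\<Sum>i\<in>A. coord (f i) j)"
  by (induction A rule: infinite_finite_induct) auto

lemma Rn_unit_inj: "Rn_unit i = Rn_unit j \<longleftrightarrow> i = j"
  by (metis coord_Rn_unit zero_neq_one)

lemma onb_subspace_Rn: "onb_subspace (Rn n) (Rn_unit ` {1..n})"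
proof
  have "Rn n \<subseteq> span (Rn_unit ` {1..n})"
  proof
    fix x assume x: "x \<in> Rn n"
    have "x = (\<Sum>i\<in>{1..n}. coord x i *\<^sub>R Rn_unit i)"
      using x unfolding fseq_eq_iff
      by (auto simp: coord_sum coord_Rn_unit Rn_def if_distrib cong: if_cong)
    also have "\<dots> \<in> span (Rn_unit ` {1..n})"
      by (intro span_sum span_scale span_base) auto
    finally show "x \<in> span (Rn_unit ` {1..n})" .
  qed
  moreover have "subspace (Rn n)" by (auto simp: subspace_def Rn_def)
  then have "span (Rn_unit ` {1..n}) \<subseteq> Rn n"
    by (intro span_minimal) (auto simp: Rn_def coord_Rn_unit)
  ultimately show "span (Rn_unit ` {1..n}) = Rn n" by simp
qed (auto simp: inner_Rn_unit coord_Rn_unit Rn_unit_inj)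

lemma card_Rn_unit: "card (Rn_unit ` {1..n}) = n"
  by (subst card_image) (auto simp: inj_on_def Rn_unit_inj)

section \<open>Self-concordant barriers\<close>

text \<open>Here \<open>\<theta>\<close> is any positive upper bound for the actual barrier
  parameter, so that it can be divided by and later replaced by \<open>c * n\<close>.
  Diagonalisability of the Hessian enters as \<open>eigenbasis\<close> and will be provided by the
  eigenvectors of the algorithm.\<close>

locale sc_barrier = onb_subspace S B for S :: "'a::real_inner set" and B +
  fixes C :: "'a set" and f :: "'a \<Rightarrow> real" and \<theta> :: real
  assumes C_subset: "C \<subseteq> S" and closed_C: "closed C" and convex_C: "convex C"
    and theta_sc: "\<exists>\<theta>'\<le>\<theta>. theta_self_concordant \<theta>' S C f" and theta_pos: "0 < \<theta>"
    and barrier: "barrier S C f"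
    and pos_def: "hessian_pos_def S C f"
    and minimizer: "has_minimizer_on (interior_in S C) f"
    and eigenbasis: "\<And>x. x \<in> interior_in S C \<Longrightarrow>
      \<exists>e lam. orthonormal_eigenbasis (card B) S (hessian S f x) e lam"
begin

abbreviation U :: "'a set"
  where "U \<equiv> interior_in S C"

definition local_norm :: "'a \<Rightarrow> 'a \<Rightarrow> real"
  where "local_norm x h = sqrt (deriv2 S f x h h)"

lemma U_subset_C: "x \<in> U \<Longrightarrow> x \<in> C"
  using interior_of_subset[of "top_of_set S" C] by (auto simp: interior_in_def)

lemma U_subset_S: "x \<in> U \<Longrightarrow> x \<in> S"
  using U_subset_C C_subset by blast

lemma U_open:
  assumes "x \<in> U"
  obtains \<epsilon> where "\<epsilon> > 0" "\<And>y. y \<in> S \<Longrightarrow> dist y x < \<epsilon> \<Longrightarrow> y \<in> U"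
proof -
  have "openin (top_of_set S) U" unfolding interior_in_def by (rule openin_interior_of)
  then show ?thesis using assms that unfolding openin_euclidean_subtopology_iff by blast
qed

lemma U_I:
  assumes "\<epsilon> > 0" "x \<in> S" "\<And>y. y \<in> S \<Longrightarrow> dist y x < \<epsilon> \<Longrightarrow> y \<in> C"
  shows "x \<in> U"
proof -
  have "openin (top_of_set S) (S \<inter> ball x \<epsilon>)" by (intro openin_open_Int) simp
  then show ?thesis unfolding interior_in_def interior_of_def
    using assms by (auto intro!: exI[of _ "S \<inter> ball x \<epsilon>"] simp: dist_commute)
qed

lemma convex_U: "convex U"
  using theta_sc by (auto simp: theta_self_concordant_def self_concordant_def convex_on_def)

lemma
  assumes "x \<in> U"
  shows differentiable: "f differentiable (at x within S)"
    and differentiable1: "h \<in> S \<Longrightarrow> (\<lambda>y. deriv1 S f y h) differentiable (at x within S)"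
    and differentiable2: "h \<in> S \<Longrightarrow> k \<in> S \<Longrightarrow> (\<lambda>y. deriv2 S f y h k) differentiable (at x within S)"
proof -
  have "C_k S 3 U f"
    using theta_sc by (auto simp: theta_self_concordant_def self_concordant_def)
  then show "f differentiable (at x within S)"
    "h \<in> S \<Longrightarrow> (\<lambda>y. deriv1 S f y h) differentiable (at x within S)"
    "h \<in> S \<Longrightarrow> k \<in> S \<Longrightarrow> (\<lambda>y. deriv2 S f y h k) differentiable (at x within S)"
    using assms unfolding deriv2_def by (simp_all add: numeral_3_eq_3)
qed

lemma sc_bound:
  assumes "x \<in> U" "h \<in> S"
  shows "\<bar>deriv3 S f x h h h\<bar> \<le> 2 * deriv2 S f x h h powr (3/2)"
  using theta_sc assms by (auto simp: theta_self_concordant_def self_concordant_def)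

lemma
  assumes "x \<in> U"
  shows hessian_inner_eq: "h \<in> S \<Longrightarrow> k \<in> S \<Longrightarrow> hessian S f x h \<bullet> k = deriv2 S f x k h"
    and linear_hessian: "linear (hessian S f x)"
proof -
  obtain \<epsilon> where \<epsilon>: "\<epsilon> > 0" "\<And>y. y \<in> S \<Longrightarrow> dist y x < \<epsilon> \<Longrightarrow> y \<in> U"
    using U_open[OF assms] by blast
  show "h \<in> S \<Longrightarrow> k \<in> S \<Longrightarrow> hessian S f x h \<bullet> k = deriv2 S f x k h"
    by (rule hessian_inner(1)[OF U_subset_S[OF assms] _ _ \<epsilon>(1) differentiable[OF \<epsilon>(2)] differentiable1[OF assms]])
  have "0 \<in> S" using subspace by (rule subspace_0)
  then show "linear (hessian S f x)"
    by (intro hessian_inner(2)[OF U_subset_S[OF assms] _ _ \<epsilon>(1) differentiable[OF \<epsilon>(2)] differentiable1[OF assms]])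
qed

lemma
  assumes "x \<in> U"
  shows grad_in: "gradient S f x \<in> S"
    and grad_inner: "h \<in> S \<Longrightarrow> gradient S f x \<bullet> h = deriv1 S f x h"
  using gradient_in gradient_inner differentiable[OF assms] U_subset_S[OF assms] by auto

lemma deriv2_pos:
  assumes "x \<in> U" "h \<in> S" "h \<noteq> 0"
  shows "deriv2 S f x h h > 0"
  using pos_def assms hessian_inner_eq[OF assms(1,2,2)] unfolding hessian_pos_def_def by metis

lemma deriv2_0: "x \<in> U \<Longrightarrow> deriv2 S f x 0 0 = 0"
  using hessian_inner_eq[of x 0 0] subspace_0[OF subspace] by simp

lemma deriv2_nonneg: "x \<in> U \<Longrightarrow> h \<in> S \<Longrightarrow> deriv2 S f x h h \<ge> 0"
  using deriv2_pos[of x h] deriv2_0[of x] by (cases "h = 0") auto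

lemma local_norm_pos: "x \<in> U \<Longrightarrow> h \<in> S \<Longrightarrow> h \<noteq> 0 \<Longrightarrow> local_norm x h > 0"
  using deriv2_pos by (simp add: local_norm_def)

lemma local_norm_nonneg: "x \<in> U \<Longrightarrow> h \<in> S \<Longrightarrow> local_norm x h \<ge> 0"
  using deriv2_nonneg by (simp add: local_norm_def)

lemma deriv1_squared_le:
  assumes "x \<in> U" "h \<in> S"
  shows "(deriv1 S f x h)\<^sup>2 \<le> \<theta> * deriv2 S f x h h"
proof -
  obtain \<theta>' where \<theta>': "\<theta>' \<le> \<theta>" "theta_self_concordant \<theta>' S C f" using theta_sc by blast
  then have "0 \<le> \<theta>'" "\<bar>deriv1 S f x h\<bar> \<le> sqrt \<theta>' * sqrt (deriv2 S f x h h)"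
    using assms by (auto simp: theta_self_concordant_def)
  from power_mono[OF this(2) abs_ge_zero, of 2] this(1)
  have "(deriv1 S f x h)\<^sup>2 \<le> \<theta>' * deriv2 S f x h h"
    using deriv2_nonneg[OF assms] by (simp add: power_mult_distrib)
  also have "\<dots> \<le> \<theta> * deriv2 S f x h h"
    using \<theta>'(1) deriv2_nonneg[OF assms] by (rule mult_right_mono)
  finally show ?thesis .
qed

lemma
  assumes "x \<in> S" "h \<in> S" "x + t *\<^sub>R h \<in> U"
  shows line_deriv: "((\<lambda>t. f (x + t *\<^sub>R h)) has_real_derivative deriv1 S f (x + t *\<^sub>R h) h) (at t)"
    and line_deriv1: "((\<lambda>t. deriv1 S f (x + t *\<^sub>R h) h) has_real_derivative
          deriv2 S f (x + t *\<^sub>R h) h h) (at t)"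
    and line_deriv2: "((\<lambda>t. deriv2 S f (x + t *\<^sub>R h) h h) has_real_derivative
          deriv3 S f (x + t *\<^sub>R h) h h h) (at t)"
  using has_real_derivative_along_line[OF subspace assms(1,2) differentiable[OF assms(3)]]
    has_real_derivative_along_line[OF subspace assms(1,2) differentiable1[OF assms(3,2)]]
    has_real_derivative_along_line[OF subspace assms(1,2) differentiable2[OF assms(3,2,2)]]
  unfolding deriv2_def deriv3_def by blast+

lemma segment_in_U:
  assumes "x \<in> U" "z \<in> U" "0 \<le> t" "t \<le> 1"
  shows "x + t *\<^sub>R (z - x) \<in> U"
proof -
  have "(1 - t) *\<^sub>R x + t *\<^sub>R z \<in> U" using convex_U assms by (auto intro: convexD)
  moreover have "(1 - t) *\<^sub>R x + t *\<^sub>R z = x + t *\<^sub>R (z - x)" by (simp add: algebra_simps)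
  ultimately show ?thesis by simp
qed

text \<open>The homothety with centre \<open>y\<close> and ratio \<open>1 - t\<close> maps a ball
  around \<open>x\<close> onto one around \<open>x + t *\<^sub>R (y - x)\<close>, and convexity
  keeps the image in \<open>C\<close>. In the proof \<open>w\<close> is the preimage of
  \<open>v\<close>.\<close>

lemma half_open_segment_in_U:
  assumes "x \<in> U" "y \<in> C" "0 \<le> t" "t < 1"
  shows "x + t *\<^sub>R (y - x) \<in> U"
proof -
  obtain \<epsilon> where \<epsilon>: "\<epsilon> > 0" "\<And>y. y \<in> S \<Longrightarrow> dist y x < \<epsilon> \<Longrightarrow> y \<in> U"
    using U_open[OF assms(1)] by blast
  have S: "x \<in> S" "y \<in> S" using assms C_subset U_subset_S by auto
  show ?thesis
  proof (rule U_I)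
    show "(1 - t) * \<epsilon> > 0" using \<epsilon> assms by simp
    show "x + t *\<^sub>R (y - x) \<in> S" using S by (intro line_in_subspace subspace subspace_diff)
    fix v assume v: "v \<in> S" "dist v (x + t *\<^sub>R (y - x)) < (1 - t) * \<epsilon>"
    define w where "w = x + (1 / (1 - t)) *\<^sub>R (v - (x + t *\<^sub>R (y - x)))"
    have "w \<in> S" unfolding w_def
      using S v by (intro line_in_subspace subspace_add subspace_scale subspace_diff subspace) auto
    moreover have "dist w x = dist v (x + t *\<^sub>R (y - x)) / (1 - t)"
      using assms by (simp add: w_def dist_norm)
    then have "dist w x < \<epsilon>" using v(2) assms by (simp add: pos_divide_less_eq mult.commute)
    ultimately have "w \<in> C" using \<epsilon> U_subset_C by blast
    then have "(1 - t) *\<^sub>R w + t *\<^sub>R y \<in> C" using convex_C assms by (auto intro: convexD)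
    moreover have "(1 - t) *\<^sub>R w + t *\<^sub>R y = v"
      using assms by (simp add: w_def scaleR_add_right) (simp add: algebra_simps)
    ultimately show "v \<in> C" by simp
  qed
qed

text \<open>The line estimate over the whole segment, with \<open>b = 1\<close>. The left side
  equals \<open>\<rho>^2 / (1 + \<rho>)\<close>: quadratic for nearby points, linear far
  away.\<close>

lemma gradient_strongly_monotone:
  assumes "x \<in> U" "z \<in> U"
  defines "\<rho> \<equiv> local_norm x (z - x)"
  shows "\<rho> - \<rho> / (1 + \<rho>) \<le> (gradient S f z - gradient S f x) \<bullet> (z - x)"
proof (cases "z = x")
  case True
  then show ?thesis using assms(1) deriv2_0 by (simp add: \<rho>_def local_norm_def)
next
  case False
  define h where "h = z - x"
  have S: "x \<in> S" "h \<in> S" using assms(1,2) U_subset_S by (auto simp: h_def intro: subspace_diff subspace)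
  have in_U: "x + t *\<^sub>R h \<in> U" if "0 \<le> t" "t \<le> 1" for t
    using segment_in_U[OF assms(1,2) that] by (simp add: h_def)
  have "\<rho> - \<rho> / (1 + \<rho> * 1) \<le> deriv1 S f (x + 1 *\<^sub>R h) h - deriv1 S f (x + 0 *\<^sub>R h) h"
    by (rule self_concordant_deriv_increment[where r = "\<lambda>t. deriv3 S f (x + t *\<^sub>R h) h h h"
        and p = "\<lambda>t. deriv1 S f (x + t *\<^sub>R h) h" and q = "\<lambda>t. deriv2 S f (x + t *\<^sub>R h) h h"])
      (use in_U S line_deriv1 line_deriv2 deriv2_pos sc_bound False in
        \<open>auto simp: \<rho>_def local_norm_def h_def\<close>)
  then show ?thesis
    using grad_inner[OF assms(1) S(2)] grad_inner[OF assms(2) S(2)] by (simp add: h_def inner_diff_left)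
qed

lemma first_order_convexity:
  assumes "x \<in> U" "z \<in> U"
  shows "f x + gradient S f x \<bullet> (z - x) \<le> f z"
proof -
  define h where "h = z - x"
  have S: "x \<in> S" "h \<in> S" using assms U_subset_S by (auto simp: h_def intro: subspace_diff subspace)
  have in_U: "x + t *\<^sub>R h \<in> U" if "0 \<le> t" "t \<le> 1" for t
    using segment_in_U[OF assms that] by (simp add: h_def)
  have mono: "deriv1 S f x h \<le> deriv1 S f (x + t *\<^sub>R h) h" if t: "0 \<le> t" "t \<le> 1" for t
  proof -
    have "(\<lambda>_. 0) t - (\<lambda>_. 0) 0 \<le> deriv1 S f (x + t *\<^sub>R h) h - deriv1 S f (x + 0 *\<^sub>R h) h"
      by (rule DERIV_le_imp_increment_le[where g' = "\<lambda>t. deriv2 S f (x + t *\<^sub>R h) h h" and f' = "\<lambda>_. 0"])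
        (use t in_U S deriv2_nonneg line_deriv1 in auto)
    then show ?thesis by simp
  qed
  have "deriv1 S f x h * 1 - deriv1 S f x h * 0 \<le> f (x + 1 *\<^sub>R h) - f (x + 0 *\<^sub>R h)"
    by (rule DERIV_le_imp_increment_le[where g' = "\<lambda>t. deriv1 S f (x + t *\<^sub>R h) h"
          and f' = "\<lambda>_. deriv1 S f x h"])
      (use mono in_U S line_deriv DERIV_cmult_Id in auto)
  then show ?thesis using grad_inner[OF assms(1) S(2)] by (simp add: h_def)
qed

text \<open>Used to bound the divergence of a comparator pulled from \<open>y\<close> into the
  interior. Only the half-open segment enters, so \<open>y\<close> may lie on the boundary.\<close>

lemma barrier_growth:
  assumes "x \<in> U" "y \<in> C" "0 \<le> t" "t < 1"
  shows "f (x + t *\<^sub>R (y - x)) - f x \<le> - \<theta> * ln (1 - t)"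
proof -
  define h where "h = y - x"
  have S: "x \<in> S" "h \<in> S"
    using assms C_subset U_subset_S by (auto simp: h_def intro!: subspace_diff subspace)
  have in_U: "x + t *\<^sub>R h \<in> U" if "0 \<le> t" "t < 1" for t
    using half_open_segment_in_U[OF assms(1,2) that] by (simp add: h_def)
  have "f (x + t *\<^sub>R h) - f (x + 0 *\<^sub>R h) \<le> - \<theta> * ln (1 - t)"
    by (rule barrier_increment_bound[where p = "\<lambda>t. deriv1 S f (x + t *\<^sub>R h) h"
        and q = "\<lambda>t. deriv2 S f (x + t *\<^sub>R h) h h" and \<phi> = "\<lambda>t. f (x + t *\<^sub>R h)"])
      (use in_U S line_deriv line_deriv1 deriv2_nonneg deriv1_squared_le theta_pos assms in auto)
  then show ?thesis by (simp add: h_def)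
qed

text \<open>Moving a unit of local length away from the minimiser makes the slope at least \<open>1 / 2\<close>; the
  barrier property then limits how far one can go.\<close>

lemma local_norm_from_minimizer:
  assumes "x \<in> U" "gradient S f x = 0" "y \<in> C"
  shows "local_norm x (y - x) \<le> 1 + 2 * \<theta>"
proof (cases "local_norm x (y - x) \<le> 1")
  case False
  define h where "h = y - x"
  define \<rho> where "\<rho> = local_norm x h"
  have \<rho>: "\<rho> > 1" using False by (simp add: \<rho>_def h_def)
  have S: "x \<in> S" "h \<in> S"
    using assms C_subset U_subset_S by (auto simp: h_def intro!: subspace_diff subspace)
  have "h \<noteq> 0" using \<rho> deriv2_0[OF assms(1)] by (auto simp: \<rho>_def local_norm_def)
  have in_U: "x + t *\<^sub>R h \<in> U" if "0 \<le> t" "t < 1" for t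
    using half_open_segment_in_U[OF assms(1,3) that] by (simp add: h_def)
  \<comment> \<open>The time at which the local distance from \<open>x\<close> is one; there the
    increment bound equals \<open>\<rho> / 2\<close>, and \<open>\<rho> > 1\<close> places it before
    the end of the segment.\<close>
  define b where "b = 1 / \<rho>"
  have b: "0 < b" "b < 1" using \<rho> by (auto simp: b_def)
  have "\<rho> - \<rho> / (1 + \<rho> * b) \<le> deriv1 S f (x + b *\<^sub>R h) h - deriv1 S f (x + 0 *\<^sub>R h) h"
    by (rule self_concordant_deriv_increment[where r = "\<lambda>t. deriv3 S f (x + t *\<^sub>R h) h h h"
        and p = "\<lambda>t. deriv1 S f (x + t *\<^sub>R h) h" and q = "\<lambda>t. deriv2 S f (x + t *\<^sub>R h) h h"])
      (use in_U S line_deriv1 line_deriv2 deriv2_pos sc_bound \<open>h \<noteq> 0\<close> b in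
        \<open>auto simp: \<rho>_def local_norm_def\<close>)
  also have "deriv1 S f (x + 0 *\<^sub>R h) h = 0"
    using grad_inner[OF assms(1) S(2)] assms(2) by simp
  finally have "\<rho> / 2 \<le> deriv1 S f (x + b *\<^sub>R h) h" using \<rho> by (simp add: b_def)
  then have "\<rho> / 2 * (1 - b) \<le> deriv1 S f (x + b *\<^sub>R h) h * (1 - b)"
    using b by (intro mult_right_mono) auto
  also have "\<dots> \<le> \<theta>"
    by (rule barrier_deriv_bound[where p = "\<lambda>t. deriv1 S f (x + t *\<^sub>R h) h"
        and q = "\<lambda>t. deriv2 S f (x + t *\<^sub>R h) h h"])
      (use in_U S line_deriv1 deriv2_nonneg deriv1_squared_le theta_pos b in auto)
  finally show ?thesis using \<rho> by (simp add: b_def \<rho>_def h_def field_simps)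
qed (use theta_pos in simp)

section \<open>Spectrum of the Hessian and compactness of the domain\<close>

lemma orthonormal_eigenbasis_properties:
  assumes "x \<in> U" "orthonormal_eigenbasis (card B) S (hessian S f x) e lam"
  shows eigenvalue_pos: "i \<in> {1..card B} \<Longrightarrow> lam i > 0"
    and inner_eigenbasis: "v \<in> S \<Longrightarrow> v \<bullet> w = (\<Sum>i=1..card B. (v \<bullet> e i) * (e i \<bullet> w))"
    and deriv2_eigenbasis: "h \<in> S \<Longrightarrow> deriv2 S f x h h = (\<Sum>i=1..card B. lam i * (h \<bullet> e i)\<^sup>2)"
proof -
  let ?I = "{1..card B}"
  have e: "\<And>i. i \<in> ?I \<Longrightarrow> e i \<in> S" "\<And>i. i \<in> ?I \<Longrightarrow> hessian S f x (e i) = lam i *\<^sub>R e i"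
    "\<And>i j. i \<in> ?I \<Longrightarrow> j \<in> ?I \<Longrightarrow> e i \<bullet> e j = (if i = j then 1 else 0)"
    using assms(2) by (auto simp: orthonormal_eigenbasis_def)
  have inj: "inj_on e ?I"
    by (rule inj_onI) (metis e(3) zero_neq_one)
  have onb: "onb_subspace S (e ` ?I)"
  proof (rule onb_subspace_of_card)
    show "card (e ` ?I) = card B" using card_image[OF inj] by simp
    show "b \<bullet> b' = (if b = b' then 1 else 0)" if "b \<in> e ` ?I" "b' \<in> e ` ?I" for b b'
      using that e(3) inj_on_eq_iff[OF inj] by (smt (verit) image_iff)
  qed (use e(1) in auto)
  show "lam i > 0" if i: "i \<in> ?I" for i
  proof -
    have "e i \<noteq> 0" using e(3)[OF i i] by auto
    then have "0 < hessian S f x (e i) \<bullet> e i"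
      using pos_def assms(1) e(1)[OF i] unfolding hessian_pos_def_def by blast
    then show ?thesis using e i by simp
  qed
  show "v \<bullet> w = (\<Sum>i\<in>?I. (v \<bullet> e i) * (e i \<bullet> w))" if "v \<in> S" for v w
    using onb_subspace.inner_basis_expansion[OF onb that, of w]
    unfolding sum.reindex[OF inj] by (simp add: comp_def)
  show "deriv2 S f x h h = (\<Sum>i\<in>?I. lam i * (h \<bullet> e i)\<^sup>2)" if h: "h \<in> S" for h
  proof -
    interpret H: linear "hessian S f x" by (rule linear_hessian[OF assms(1)])
    have "h = (\<Sum>i\<in>?I. (h \<bullet> e i) *\<^sub>R e i)"
      using onb_subspace.basis_expansion[OF onb h]
      unfolding sum.reindex[OF inj] by (simp add: comp_def)
    then have "hessian S f x h = (\<Sum>i\<in>?I. (h \<bullet> e i) *\<^sub>R hessian S f x (e i))"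
      by (metis (no_types, lifting) H.scale H.sum sum.cong)
    also have "\<dots> = (\<Sum>i\<in>?I. ((h \<bullet> e i) * lam i) *\<^sub>R e i)"
      by (intro sum.cong) (auto simp: e(2))
    finally have "hessian S f x h \<bullet> h = (\<Sum>i\<in>?I. (h \<bullet> e i) * lam i * (e i \<bullet> h))"
      by (simp add: inner_sum_left)
    then show ?thesis
      using hessian_inner_eq[OF assms(1) h h] by (simp add: power2_eq_square inner_commute mult_ac)
  qed
qed

lemma local_norm_coercive:
  assumes "x \<in> U"
  obtains m where "m > 0" "\<And>h. h \<in> S \<Longrightarrow> m * norm h \<le> local_norm x h"
proof -
  obtain e lam where eig: "orthonormal_eigenbasis (card B) S (hessian S f x) e lam"
    using eigenbasis[OF assms] by blast
  note props = orthonormal_eigenbasis_properties[OF assms eig]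
  \<comment> \<open>The least eigenvalue, capped by one; the extra element keeps the minimum
    meaningful for an empty basis.\<close>
  define \<mu> where "\<mu> = Min (insert 1 (lam ` {1..card B}))"
  have \<mu>: "\<mu> > 0" "\<And>i. i \<in> {1..card B} \<Longrightarrow> \<mu> \<le> lam i"
    using props(1) by (auto simp: \<mu>_def simp del: Min_insert intro!: Min_le)
  have "sqrt \<mu> * norm h \<le> local_norm x h" if h: "h \<in> S" for h
  proof -
    have "\<mu> * (h \<bullet> h) = (\<Sum>i=1..card B. \<mu> * (h \<bullet> e i)\<^sup>2)"
      by (subst props(2)[OF h])
        (simp add: sum_distrib_left power2_eq_square inner_commute)
    also have "\<dots> \<le> (\<Sum>i=1..card B. lam i * (h \<bullet> e i)\<^sup>2)"
      using \<mu> by (intro sum_mono mult_right_mono) auto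
    also have "\<dots> = deriv2 S f x h h" using props(3)[OF h] by simp
    finally have "sqrt (\<mu> * (h \<bullet> h)) \<le> sqrt (deriv2 S f x h h)" by simp
    then show ?thesis by (simp add: local_norm_def norm_eq_sqrt_inner real_sqrt_mult)
  qed
  with \<mu> show ?thesis using that[of "sqrt \<mu>"] by simp
qed

lemma gradient_minimizer:
  assumes "x \<in> U" "\<xi> \<in> S" "\<And>y. y \<in> U \<Longrightarrow> f x - \<xi> \<bullet> x \<le> f y - \<xi> \<bullet> y"
  shows "gradient S f x = \<xi>"
proof -
  obtain \<epsilon> where \<epsilon>: "\<epsilon> > 0" "\<And>y. y \<in> S \<Longrightarrow> dist y x < \<epsilon> \<Longrightarrow> y \<in> U"
    using U_open[OF assms(1)] by blast
  \<comment> \<open>Stationarity is tested in the direction of the defect itself, which yields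
    \<open>h \<bullet> h = 0\<close>.\<close>
  define h where "h = gradient S f x - \<xi>"
  have S: "h \<in> S" "x \<in> S"
    using grad_in[OF assms(1)] assms(1,2) U_subset_S by (auto simp: h_def intro: subspace_diff subspace)
  have "deriv1 S f x h - \<xi> \<bullet> h = 0"
  proof (rule DERIV_local_min)
    show "((\<lambda>t. f (x + t *\<^sub>R h) - \<xi> \<bullet> (x + t *\<^sub>R h)) has_real_derivative
        deriv1 S f x h - \<xi> \<bullet> h) (at 0)"
      using line_deriv[OF S(2,1), of 0] assms(1)
      by (auto intro!: derivative_eq_intros simp: inner_add_right)
    show "0 < \<epsilon> / (norm h + 1)" using \<epsilon> by (simp add: add_nonneg_pos)
    show "\<forall>t. \<bar>0 - t\<bar> < \<epsilon> / (norm h + 1) \<longrightarrow>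
        f (x + 0 *\<^sub>R h) - \<xi> \<bullet> (x + 0 *\<^sub>R h) \<le> f (x + t *\<^sub>R h) - \<xi> \<bullet> (x + t *\<^sub>R h)"
    proof (intro allI impI)
      fix t assume "\<bar>0 - t\<bar> < \<epsilon> / (norm h + 1)"
      moreover have "norm h + 1 > 0" by (simp add: add_nonneg_pos)
      ultimately have "\<bar>t\<bar> * (norm h + 1) < \<epsilon>" by (simp add: pos_less_divide_eq)
      moreover have "\<bar>t\<bar> * norm h \<le> \<bar>t\<bar> * (norm h + 1)" by (intro mult_left_mono) auto
      ultimately have "dist (x + t *\<^sub>R h) x < \<epsilon>" by (simp add: dist_norm)
      then have "x + t *\<^sub>R h \<in> U" using \<epsilon>(2) line_in_subspace[OF subspace S(2,1)] by blast
      then show "f (x + 0 *\<^sub>R h) - \<xi> \<bullet> (x + 0 *\<^sub>R h) \<le> f (x + t *\<^sub>R h) - \<xi> \<bullet> (x + t *\<^sub>R h)"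
        using assms(3) by simp
    qed
  qed
  then have "h \<bullet> h = 0"
    using grad_inner[OF assms(1) S(1)] by (simp add: h_def inner_diff_left)
  then show ?thesis by (simp add: h_def)
qed

text \<open>The gradient vanishes at the minimiser, so all of \<open>C\<close> lies within local
  distance \<open>1 + 2 * \<theta>\<close> of it, and the local norm there dominates a multiple of
  the ambient norm.\<close>

lemma compact_C: "compact C"
proof -
  obtain x where x: "x \<in> U" "\<forall>y\<in>U. f x \<le> f y"
    using minimizer unfolding has_minimizer_on_def by blast
  have "gradient S f x = 0" using x subspace_0[OF subspace] by (intro gradient_minimizer) auto
  note bound = local_norm_from_minimizer[OF x(1) this]
  obtain m where m: "m > 0" "\<And>h. h \<in> S \<Longrightarrow> m * norm h \<le> local_norm x h"
    using local_norm_coercive[OF x(1)] by blast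
  show ?thesis
  proof (rule compact_closed_bounded[OF C_subset closed_C])
    fix y assume y: "y \<in> C"
    have "y - x \<in> S" using y x U_subset_S C_subset by (auto intro: subspace_diff subspace)
    then have "m * norm (y - x) \<le> 1 + 2 * \<theta>" using bound[OF y] m(2) order_trans by blast
    then have "norm (y - x) \<le> (1 + 2 * \<theta>) / m" using m(1) by (simp add: field_simps)
    then show "norm y \<le> norm x + (1 + 2 * \<theta>) / m"
      using norm_triangle_ineq2[of y x] by simp
  qed
qed

section \<open>Inversion of the gradient map\<close>

lemma gradient_surj:
  assumes "\<xi> \<in> S"
  obtains x where "x \<in> U" "gradient S f x = \<xi>"
proof -
  let ?g = "\<lambda>x. f x - \<xi> \<bullet> x"
  obtain u where u: "u \<in> U" using minimizer unfolding has_minimizer_on_def by blast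
  \<comment> \<open>A minimiser of \<open>?g\<close> over \<open>U\<close> has gradient
    \<open>\<xi>\<close>. The search is confined to the sublevel set of an arbitrary interior point,
    which turns out to be compact.\<close>
  define L where "L = {x \<in> U. ?g x \<le> ?g u}"
  have cont: "continuous_on U f"
    unfolding continuous_on_eq_continuous_within
    using differentiable differentiable_imp_continuous_within continuous_within_subset U_subset_S
    by (metis subsetI)
  obtain M where M: "\<And>x. x \<in> C \<Longrightarrow> norm x \<le> M"
    using compact_imp_bounded[OF compact_C] unfolding bounded_iff by blast
  have "closed L"
    unfolding closed_sequential_limits
  proof (intro allI impI, elim conjE)
    fix X z assume X: "\<forall>k. X k \<in> L" and lim: "X \<longlonglongrightarrow> z"
    have XU: "X k \<in> U" "?g (X k) \<le> ?g u" for k using X by (auto simp: L_def)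
    have "z \<in> C" using closed_C XU U_subset_C lim unfolding closed_sequential_limits by blast
    \<comment> \<open>The barrier excludes limits on the boundary: \<open>f\<close> would tend to
      infinity along the sequence, while the sublevel condition and the boundedness of
      \<open>C\<close> cap it at \<open>?g u + norm \<xi> * M\<close>.\<close>
    have "z \<in> U"
    proof (rule ccontr)
      assume z: "z \<notin> U"
      have "filterlim f at_top (at z within U)"
        using barrier z \<open>z \<in> C\<close> unfolding barrier_def by blast
      moreover have "filterlim X (at z within U) sequentially"
        unfolding filterlim_at using lim XU z by (auto intro!: always_eventually)
      ultimately have "filterlim (\<lambda>k. f (X k)) at_top sequentially"
        by (rule filterlim_compose)
      then have "eventually (\<lambda>k. f (X k) > ?g u + norm \<xi> * M) sequentially"
        unfolding filterlim_at_top_dense by blast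
      then obtain k where "f (X k) > ?g u + norm \<xi> * M"
        by (auto simp: eventually_sequentially)
      moreover have "\<xi> \<bullet> X k \<le> norm \<xi> * norm (X k)" by (rule norm_cauchy_schwarz)
      moreover have "norm \<xi> * norm (X k) \<le> norm \<xi> * M"
        using M XU U_subset_C by (intro mult_left_mono) auto
      ultimately show False using XU(2)[of k] by simp
    qed
    moreover have "(\<lambda>k. ?g (X k)) \<longlonglongrightarrow> ?g z"
      using cont \<open>z \<in> U\<close> lim XU
      by (intro tendsto_intros) (auto simp: continuous_on_sequentially comp_def)
    then have "?g z \<le> ?g u" using XU(2) by (intro LIMSEQ_le_const2) auto
    ultimately show "z \<in> L" by (simp add: L_def)
  qed
  then have "compact L"
    using compact_Int_closed[OF compact_C] U_subset_C
    by (metis (no_types, lifting) L_def Int_absorb1 mem_Collect_eq subsetI)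
  moreover have "u \<in> L" using u by (simp add: L_def)
  moreover have "continuous_on L ?g"
    by (intro continuous_intros continuous_on_subset[OF cont]) (auto simp: L_def)
  ultimately obtain x where x: "x \<in> L" "\<And>y. y \<in> L \<Longrightarrow> ?g x \<le> ?g y"
    using continuous_attains_inf[of L ?g] by blast
  have "x \<in> U" using x(1) by (simp add: L_def)
  moreover have "?g x \<le> ?g y" if "y \<in> U" for y
    using x that unfolding L_def by force
  ultimately show ?thesis using that gradient_minimizer[OF _ assms] by blast
qed

definition grad_inv :: "'a \<Rightarrow> 'a"
  where "grad_inv = gradient S (fenchel_conjugate U f)"

text \<open>The tangent inequality at \<open>x\<close> says that the supremum is attained
  there.\<close>

lemma fenchel_conjugate_eq:
  assumes "x \<in> U"
  shows "fenchel_conjugate U f (gradient S f x) = gradient S f x \<bullet> x - f x"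
  unfolding fenchel_conjugate_def
  using first_order_convexity[OF assms] assms
  by (intro cSup_eq_maximum) (auto simp: inner_diff_right algebra_simps)

text \<open>Strong monotonicity and Cauchy-Schwarz give
  \<open>\<rho> / (1 + \<rho>) \<le> \<delta> / m\<close>. After clearing the denominator,
  \<open>\<delta> < m / 2\<close> absorbs the term \<open>\<delta> * \<rho>\<close>.\<close>

lemma gradient_inverse_continuous:
  assumes x: "x \<in> U" and m: "m > 0" "\<And>h. h \<in> S \<Longrightarrow> m * norm h \<le> local_norm x h"
    and z: "z \<in> U" and close: "norm (gradient S f z - gradient S f x) < m / 2"
  shows "norm (z - x) \<le> 2 / m\<^sup>2 * norm (gradient S f z - gradient S f x)"
proof (cases "z = x")
  case False
  define \<delta> where "\<delta> = norm (gradient S f z - gradient S f x)"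
  define \<rho> where "\<rho> = local_norm x (z - x)"
  have S: "z - x \<in> S" using x z U_subset_S by (auto intro: subspace_diff subspace)
  have \<rho>: "\<rho> > 0" using local_norm_pos[OF x S] False by (simp add: \<rho>_def)
  have "\<rho> - \<rho> / (1 + \<rho>) \<le> (gradient S f z - gradient S f x) \<bullet> (z - x)"
    unfolding \<rho>_def by (rule gradient_strongly_monotone[OF x z])
  also have "\<dots> \<le> \<delta> * norm (z - x)" unfolding \<delta>_def by (rule norm_cauchy_schwarz)
  also have "\<dots> \<le> \<delta> * (\<rho> / m)"
    using m(1) m(2)[OF S] by (intro mult_left_mono) (auto simp: \<delta>_def \<rho>_def field_simps)
  finally have "\<rho> * (\<rho> / (1 + \<rho>)) \<le> \<rho> * (\<delta> / m)"
    using \<rho> by (simp add: field_simps power2_eq_square)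
  then have "\<rho> / (1 + \<rho>) \<le> \<delta> / m" using \<rho> by (simp only: mult_le_cancel_left_pos)
  then have "\<rho> * m \<le> \<delta> * (1 + \<rho>)" using \<rho> m(1) by (simp add: field_simps)
  moreover have "\<delta> * \<rho> \<le> m / 2 * \<rho>" using close \<rho> by (intro mult_right_mono) (auto simp: \<delta>_def)
  ultimately have "\<rho> * m \<le> 2 * \<delta>" by (simp add: algebra_simps)
  then have "\<rho> \<le> 2 * \<delta> / m" using m(1) by (simp add: field_simps)
  then have "m * norm (z - x) \<le> 2 * \<delta> / m" using m(2)[OF S] by (simp add: \<rho>_def)
  then show ?thesis using m(1) by (simp add: \<delta>_def power2_eq_square field_simps)
qed simp

text \<open>If \<open>z\<close> has gradient \<open>y\<close>, the tangent inequalities at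
  \<open>x\<close> and \<open>z\<close> sandwich the first-order remainder of the conjugate between
  zero and \<open>(y - \<xi>) \<bullet> (z - x)\<close>. The Lipschitz bound makes this quadratic in
  \<open>norm (y - \<xi>)\<close>, so the conjugate has gradient \<open>x\<close> at
  \<open>\<xi>\<close>.\<close>

lemma grad_inv_gradient:
  assumes x: "x \<in> U"
  shows "grad_inv (gradient S f x) = x"
  unfolding grad_inv_def
proof (rule gradient_eqI[OF subspace grad_in[OF x] U_subset_S[OF x]])
  define \<xi> where "\<xi> = gradient S f x"
  obtain m where m: "m > 0" "\<And>h. h \<in> S \<Longrightarrow> m * norm h \<le> local_norm x h"
    using local_norm_coercive[OF x] by blast
  show "(fenchel_conjugate U f has_derivative (\<lambda>h. x \<bullet> h)) (at (gradient S f x) within S)"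
  proof (rule has_derivativeI_sandwich[where e = "m / 2" and H = "\<lambda>y. 2 / m\<^sup>2 * norm (y - \<xi>)"])
    show "((\<lambda>y. 2 / m\<^sup>2 * norm (y - \<xi>)) \<longlongrightarrow> 0) (at (gradient S f x) within S)"
      by (rule tendsto_eq_intros refl | simp add: \<xi>_def)+
    fix y assume y: "y \<in> S" "y \<noteq> gradient S f x" "dist y (gradient S f x) < m / 2"
    obtain z where z: "z \<in> U" "gradient S f z = y" using gradient_surj[OF y(1)] by blast
    have "norm (z - x) \<le> 2 / m\<^sup>2 * norm (gradient S f z - gradient S f x)"
      using y z by (intro gradient_inverse_continuous[OF x m]) (auto simp: dist_norm)
    then have zx: "norm (z - x) \<le> 2 / m\<^sup>2 * norm (y - \<xi>)" by (simp add: z \<xi>_def)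
    define R where "R = fenchel_conjugate U f y - fenchel_conjugate U f \<xi> - x \<bullet> (y - \<xi>)"
    have conj: "fenchel_conjugate U f y = y \<bullet> z - f z" "fenchel_conjugate U f \<xi> = \<xi> \<bullet> x - f x"
      using fenchel_conjugate_eq[OF z(1)] fenchel_conjugate_eq[OF x] z(2) by (auto simp: \<xi>_def)
    have "f x + \<xi> \<bullet> (z - x) \<le> f z" "f z + y \<bullet> (x - z) \<le> f x"
      using first_order_convexity[OF x z(1)] first_order_convexity[OF z(1) x] z(2) by (auto simp: \<xi>_def)
    then have "0 \<le> R" "R \<le> (y - \<xi>) \<bullet> (z - x)"
      unfolding R_def conj by (simp_all add: inner_diff_left inner_diff_right inner_commute)
    moreover have "(y - \<xi>) \<bullet> (z - x) \<le> norm (y - \<xi>) * norm (z - x)" by (rule norm_cauchy_schwarz)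
    moreover have "norm (y - \<xi>) * norm (z - x) \<le> norm (y - \<xi>) * (2 / m\<^sup>2 * norm (y - \<xi>))"
      using zx by (intro mult_left_mono) auto
    ultimately have "norm R \<le> norm (y - \<xi>) * (2 / m\<^sup>2 * norm (y - \<xi>))" by simp
    then show "norm (fenchel_conjugate U f y - fenchel_conjugate U f (gradient S f x) -
        x \<bullet> (y - gradient S f x)) / norm (y - gradient S f x) \<le> 2 / m\<^sup>2 * norm (y - \<xi>)"
      using y(2) unfolding R_def \<xi>_def by (simp add: divide_le_eq mult.commute)
  qed (use m in \<open>auto intro: bounded_linear_inner_right\<close>)
qed

lemma
  assumes "\<xi> \<in> S"
  shows grad_inv_in_U: "grad_inv \<xi> \<in> U" and gradient_grad_inv: "gradient S f (grad_inv \<xi>) = \<xi>"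
proof -
  obtain x where "x \<in> U" "gradient S f x = \<xi>" using gradient_surj[OF assms] by blast
  then show "grad_inv \<xi> \<in> U" "gradient S f (grad_inv \<xi>) = \<xi>" using grad_inv_gradient by auto
qed

section \<open>The Dikin ellipsoid\<close>

lemma Dikin_half_open:
  assumes x: "x \<in> U" and h: "h \<in> S" "local_norm x h \<le> 1" and t: "0 \<le> t" "t < 1"
  shows "x + t *\<^sub>R h \<in> U"
proof (cases "h = 0")
  case False
  have xS: "x \<in> S" using U_subset_S[OF x] .
  show ?thesis
  proof (rule ccontr)
    assume nt: "x + t *\<^sub>R h \<notin> U"
    define N where "N = {s. 0 \<le> s \<and> x + s *\<^sub>R h \<notin> U}"
    \<comment> \<open>The first exit time of the ray. As \<open>U\<close> is relatively open, the
      point reached then is outside \<open>U\<close>; as a limit it is in \<open>C\<close>, so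
      \<open>f\<close> must diverge there.\<close>
    define a where "a = Inf N"
    have N: "t \<in> N" "bdd_below N" using nt t by (auto simp: N_def intro!: bdd_belowI[of _ 0])
    have a: "0 \<le> a" "a \<le> t"
      using N unfolding a_def by (auto intro!: cInf_greatest cInf_lower simp: N_def)
    have below: "x + s *\<^sub>R h \<in> U" if "0 \<le> s" "s < a" for s
      using that cInf_lower[OF _ N(2), of s] unfolding a_def N_def by force
    have not_a: "x + a *\<^sub>R h \<notin> U"
    proof
      assume "x + a *\<^sub>R h \<in> U"
      then obtain \<epsilon> where \<epsilon>: "\<epsilon> > 0" "\<And>y. y \<in> S \<Longrightarrow> dist y (x + a *\<^sub>R h) < \<epsilon> \<Longrightarrow> y \<in> U"
        using U_open by blast
      have "a + \<epsilon> / norm h \<le> Inf N"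
      proof (rule cInf_greatest)
        fix s assume s: "s \<in> N"
        then have "a \<le> s" using cInf_lower[OF _ N(2)] by (simp add: a_def)
        have "\<not> dist (x + s *\<^sub>R h) (x + a *\<^sub>R h) < \<epsilon>"
          using s \<epsilon>(2)[OF line_in_subspace[OF subspace xS h(1)]] by (auto simp: N_def)
        also have "dist (x + s *\<^sub>R h) (x + a *\<^sub>R h) = (s - a) * norm h"
          using \<open>a \<le> s\<close> by (simp add: dist_norm flip: scaleR_diff_left)
        finally show "a + \<epsilon> / norm h \<le> s" using False by (simp add: field_simps)
      qed (use N in auto)
      moreover have "\<epsilon> / norm h > 0" using \<epsilon>(1) False by simp
      ultimately show False by (simp add: a_def)
    qed
    then have a0: "0 < a" using a x by (cases "a = 0") auto
    have lim: "((\<lambda>s. x + s *\<^sub>R h) \<longlongrightarrow> x + a *\<^sub>R h) (at_left a)"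
      by (auto intro!: tendsto_eq_intros)
    have ev: "eventually (\<lambda>s. s \<in> {0<..<a}) (at_left a)"
      using a0 by (rule eventually_at_leftI[rotated])
    have "x + a *\<^sub>R h \<in> C"
      by (rule Lim_in_closed_set[OF closed_C _ _ lim])
        (use below U_subset_C in \<open>auto intro!: eventually_mono[OF ev]\<close>)
    with not_a have "filterlim f at_top (at (x + a *\<^sub>R h) within U)"
      using barrier unfolding barrier_def by blast
    moreover have "filterlim (\<lambda>s. x + s *\<^sub>R h) (at (x + a *\<^sub>R h) within U) (at_left a)"
      unfolding filterlim_at
      using lim False below by (auto intro!: eventually_mono[OF ev])
    ultimately have top: "filterlim (\<lambda>s. f (x + s *\<^sub>R h)) at_top (at_left a)"
      by (rule filterlim_compose)
    \<comment> \<open>Since \<open>a \<le> t < 1\<close>, the local length travelled is strictly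
      below one; this bounds \<open>f\<close> up to time \<open>a\<close> and contradicts the
      divergence.\<close>
    have "a * sqrt (deriv2 S f (x + 0 *\<^sub>R h) h h) < 1"
    proof -
      have "a * local_norm x h \<le> a * 1" using h a by (intro mult_left_mono) auto
      then show ?thesis using a t by (simp add: local_norm_def)
    qed
    then have "\<exists>M. \<forall>s. 0 \<le> s \<and> s < a \<longrightarrow> f (x + s *\<^sub>R h) \<le> M"
      by (intro self_concordant_bounded_above[where p = "\<lambda>t. deriv1 S f (x + t *\<^sub>R h) h"
            and q = "\<lambda>t. deriv2 S f (x + t *\<^sub>R h) h h" and r = "\<lambda>t. deriv3 S f (x + t *\<^sub>R h) h h h"]
          line_deriv line_deriv1 line_deriv2 deriv2_pos sc_bound a0 xS h False below)
    then obtain M where M: "\<And>s. 0 \<le> s \<Longrightarrow> s < a \<Longrightarrow> f (x + s *\<^sub>R h) \<le> M" by blast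
    have "eventually (\<lambda>s. f (x + s *\<^sub>R h) > M) (at_left a)"
      using top unfolding filterlim_at_top_dense by blast
    moreover have "eventually (\<lambda>s. f (x + s *\<^sub>R h) \<le> M) (at_left a)"
      by (rule eventually_mono[OF ev]) (auto intro: M)
    ultimately have "eventually (\<lambda>s. False) (at_left a)"
      by eventually_elim simp
    then show False by simp
  qed
qed (use x in simp)

text \<open>The endpoint is reached as a limit, whence membership in \<open>C\<close> rather than in
  its interior. Local length exactly one has to be covered because the algorithm plays such
  points.\<close>

lemma Dikin_ellipsoid:
  assumes x: "x \<in> U" and h: "h \<in> S" "local_norm x h \<le> 1"
  shows "x + h \<in> C"
proof -
  have lim: "((\<lambda>s. x + s *\<^sub>R h) \<longlongrightarrow> x + 1 *\<^sub>R h) (at_left 1)"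
    by (auto intro!: tendsto_eq_intros)
  have ev: "eventually (\<lambda>s. s \<in> {0<..<1}) (at_left (1::real))"
    by (rule eventually_at_leftI[where a = 0]) auto
  have "x + 1 *\<^sub>R h \<in> C"
    by (rule Lim_in_closed_set[OF closed_C _ _ lim])
      (use Dikin_half_open[OF assms] U_subset_C in \<open>auto intro!: eventually_mono[OF ev]\<close>)
  then show ?thesis by simp
qed

end

section \<open>The bank\<close>

text \<open>The last conclusion drives the analysis of the bank: had one account covered the open
  demand with money to spare, nothing would remain, so a positive remainder means that every account
  was emptied.\<close>

lemma withdraw_correct:
  assumes "withdraw v ss b = (w, r)" "distinct ss" "\<And>s. s \<in> set ss \<Longrightarrow> 0 \<le> v s" "0 \<le> b"
  shows "0 \<le> r" "sum w (set ss) + r = b" "\<And>s. 0 \<le> w s" "\<And>s. s \<in> set ss \<Longrightarrow> w s \<le> v s"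
    "\<And>s. s \<notin> set ss \<Longrightarrow> w s = 0" "\<And>s. 0 < r \<Longrightarrow> s \<in> set ss \<Longrightarrow> w s = v s"
proof -
  have "0 \<le> r \<and> sum w (set ss) + r = b \<and> (\<forall>s. 0 \<le> w s) \<and> (\<forall>s\<in>set ss. w s \<le> v s) \<and>
      (\<forall>s. s \<notin> set ss \<longrightarrow> w s = 0) \<and> (0 < r \<longrightarrow> (\<forall>s\<in>set ss. w s = v s))"
    using assms
  proof (induction ss arbitrary: b w r)
    case (Cons s ss)
    define a where "a = min (v s) b"
    obtain w' r' where w': "withdraw v ss (b - a) = (w', r')" by fastforce
    have wr: "w = w'(s := a)" "r = r'"
      using Cons.prems(1) w' by (auto simp: a_def Let_def)
    have a: "0 \<le> a" "a \<le> v s" "0 \<le> b - a" using Cons.prems(3)[of s] Cons.prems(4) by (auto simp: a_def)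
    have IH: "0 \<le> r'" "sum w' (set ss) + r' = b - a" "\<forall>s. 0 \<le> w' s" "\<forall>s\<in>set ss. w' s \<le> v s"
      "\<forall>s. s \<notin> set ss \<longrightarrow> w' s = 0" "0 < r' \<longrightarrow> (\<forall>s\<in>set ss. w' s = v s)"
      using Cons.IH[OF w' _ _ a(3)] Cons.prems(2,3) by simp_all
    have s: "s \<notin> set ss" using Cons.prems(2) by simp
    have "sum w (set ss) = sum w' (set ss)" using s by (intro sum.cong) (auto simp: wr)
    then have sum: "sum w (set (s # ss)) = a + sum w' (set ss)" using s by (simp add: wr)
    have "0 < r' \<Longrightarrow> a = v s"
    proof (rule ccontr)
      assume "0 < r'" "a \<noteq> v s"
      then have "a = b" by (auto simp: a_def min_def split: if_splits)
      then show False using IH(1-3) \<open>0 < r'\<close> sum_nonneg[of "set ss" w'] by simp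
    qed
    then show ?case using IH a s sum by (auto simp: wr)
  qed simp
  then show "0 \<le> r" "sum w (set ss) + r = b" "\<And>s. 0 \<le> w s" "\<And>s. s \<in> set ss \<Longrightarrow> w s \<le> v s"
    "\<And>s. s \<notin> set ss \<Longrightarrow> w s = 0" "\<And>s. 0 < r \<Longrightarrow> s \<in> set ss \<Longrightarrow> w s = v s"
    by blast+
qed

section \<open>Elementary sums\<close>

lemma sum_div_sqrt_partial_sums:
  fixes a :: "nat \<Rightarrow> real"
  assumes "\<And>t. 0 \<le> a t"
  shows "(\<Sum>t=1..m. a t / sqrt (\<Sum>r=1..t. a r)) \<le> 2 * sqrt (\<Sum>r=1..m. a r)"
proof (induction m)
  case (Suc m)
  define D where "D = (\<Sum>r=1..m. a r)"
  define x where "x = a (Suc m)"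
  have nonneg: "0 \<le> D" "0 \<le> x" using assms by (auto simp: D_def x_def sum_nonneg)
  \<comment> \<open>Each term is dominated by a difference of square roots, so the sum telescopes.
    For \<open>D + x = 0\<close> the quotient is zero by the convention on division.\<close>
  have "x / sqrt (D + x) \<le> 2 * (sqrt (D + x) - sqrt D)"
  proof (cases "D + x = 0")
    case False
    then have pos: "sqrt (D + x) > 0" using nonneg by simp
    have "2 * (sqrt D * sqrt (D + x)) \<le> (sqrt D)\<^sup>2 + (sqrt (D + x))\<^sup>2"
      using sum_squares_bound[of "sqrt D" "sqrt (D + x)"] by simp
    then have "x \<le> 2 * (sqrt (D + x) * sqrt (D + x) - sqrt D * sqrt (D + x))"
      using nonneg by simp
    then have "x \<le> 2 * (sqrt (D + x) - sqrt D) * sqrt (D + x)" by (simp add: algebra_simps)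
    then show ?thesis using pos by (simp add: pos_divide_le_eq)
  qed (use nonneg in auto)
  then show ?case using Suc by (simp add: D_def x_def)
qed simp

text \<open>Distinct positive integers sum to at least \<open>1 + ... + card A\<close>. They are
  added in increasing order, so each new maximum exceeds the number of elements before it.\<close>

lemma card_squared_le_sum:
  fixes A :: "nat set"
  assumes "finite A" "0 \<notin> A"
  shows "(card A)\<^sup>2 \<le> 2 * \<Sum>A"
  using assms
proof (induction A rule: finite_linorder_max_induct)
  case (insert b A)
  have "A \<subseteq> {1..<b}" using insert by (auto simp: Suc_le_eq intro: gr0I)
  then have "card A \<le> b - 1" using card_mono[of "{1..<b}" A] by simp
  moreover have "b > 0" using insert by (auto intro: gr0I)
  moreover have "b \<notin> A" using insert by auto
  ultimately show ?case using insert by (auto simp: power2_eq_square)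
qed simp

lemma harmonic_sum_le:
  assumes "0 < m"
  shows "(\<Sum>k=1..m. 1 / real k) \<le> 1 + ln (real m)"
  using assms
proof (induction m rule: nat_induct_non_zero)
  case (Suc m)
  have "ln (real m / real (Suc m)) \<le> real m / real (Suc m) - 1"
    using Suc by (intro ln_le_minus_one) simp
  also have "real m / real (Suc m) - 1 = - (1 / real (Suc m))" by (simp add: field_simps)
  finally have "1 / real (Suc m) \<le> ln (real (Suc m)) - ln (real m)"
    using Suc by (subst (asm) ln_div) auto
  then show ?case using Suc by simp
qed simp

section \<open>Accounts, deposits and loans\<close>

locale banker_schedule = banker_bolo +
  assumes n_pos: "1 \<le> n" and T_ge: "2 \<le> T"
    and ord: "\<And>t. t \<in> {1..T} \<Longrightarrow> distinct (ord t) \<and> set (ord t) = arrived t"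
begin

definition unarrived :: "nat \<Rightarrow> nat set"
  where "unarrived t = {1..<t} - arrived t"

lemma pending_eq: "pending t = card (unarrived t)"
  by (simp add: pending_def unarrived_def)

lemma unarrived_iff: "s \<in> unarrived t \<longleftrightarrow> 1 \<le> s \<and> s < t \<and> t \<le> s + d s"
  by (auto simp: unarrived_def arrived_def)

lemma arrived_subset: "arrived t \<subseteq> {1..<t}"
  by (auto simp: arrived_def)

lemma sigma_ge: "8 * real n \<le> sigma t"
  by (simp add: sigma_def)

lemma sigma_pos: "0 < sigma t"
  using sigma_ge[of t] n_pos by simp

lemma balance_Suc:
  "balance (Suc t) s = (if s = Suc t then sigma (Suc t) else balance t s) - sigma2 (Suc t) s"
  by (simp add: sigma2_def round_withdraw_def Let_def)

lemma balance_properties: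
  assumes "t \<le> T"
  shows "(\<forall>s. 0 \<le> balance t s) \<and> (\<forall>s. s \<notin> {1..t} \<longrightarrow> balance t s = 0)"
  using assms
proof (induction t)
  case (Suc t)
  define v where "v = (balance t)(Suc t := sigma (Suc t))"
  obtain w r where wr: "withdraw v (ord (Suc t)) (sigma (Suc t)) = (w, r)" by fastforce
  have v: "0 \<le> v s" for s using Suc sigma_pos[of "Suc t"] by (auto simp: v_def)
  have o: "distinct (ord (Suc t))" "set (ord (Suc t)) = arrived (Suc t)" using ord[of "Suc t"] Suc by auto
  note W = withdraw_correct[OF wr o(1) v less_imp_le[OF sigma_pos]]
  have "balance (Suc t) = (\<lambda>s. v s - w s)" using wr by (simp add: v_def Let_def)
  moreover have "w s \<le> v s" for s using W(4,5)[of s] v[of s] by (cases "s \<in> set (ord (Suc t))") auto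
  moreover have "v s - w s = 0" if "s \<notin> {1..Suc t}" for s
  proof -
    have "s \<notin> set (ord (Suc t))" using o(2) arrived_subset[of "Suc t"] that by auto
    then show ?thesis using W(5)[of s] Suc that by (auto simp: v_def)
  qed
  ultimately show ?case by simp
qed simp

lemma round_withdraw_correct:
  assumes t: "t \<in> {1..T}"
  shows sigma2_sum: "(\<Sum>s\<in>{1..<t}. sigma2 t s) + bank t = sigma t"
    and sigma2_nonneg: "0 \<le> sigma2 t s" and bank_nonneg: "0 \<le> bank t"
    and sigma2_unarrived: "s \<notin> arrived t \<Longrightarrow> sigma2 t s = 0"
    and bank_pos: "0 < bank t \<Longrightarrow> s \<in> arrived t \<Longrightarrow> sigma2 t s = balance (t - 1) s"
proof -
  define v where "v = (balance (t - 1))(t := sigma t)"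
  have wr: "withdraw v (ord t) (sigma t) = (sigma2 t, bank t)"
    by (simp add: v_def sigma2_def[abs_def] bank_def round_withdraw_def)
  have v: "0 \<le> v s" for s using balance_properties[of "t - 1"] sigma_pos[of t] t by (auto simp: v_def)
  have o: "distinct (ord t)" "set (ord t) = arrived t" using ord[OF t] by auto
  note W = withdraw_correct[OF wr o(1) v less_imp_le[OF sigma_pos], unfolded o(2)]
  show "s \<notin> arrived t \<Longrightarrow> sigma2 t s = 0" for s by (rule W(5))
  then have "(\<Sum>s\<in>{1..<t}. sigma2 t s) = (\<Sum>s\<in>arrived t. sigma2 t s)"
    using arrived_subset[of t] by (intro sum.mono_neutral_right) auto
  then show "(\<Sum>s\<in>{1..<t}. sigma2 t s) + bank t = sigma t" using W(2) by simp
  show "0 \<le> sigma2 t s" "0 \<le> bank t" using W(1,3) by auto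
  show "sigma2 t s = balance (t - 1) s" if "0 < bank t" "s \<in> arrived t"
  proof -
    \<comment> \<open>The deposit made in round \<open>t\<close> does not alter the account of an
      arrived round, which is strictly earlier.\<close>
    have "s \<noteq> t" using that arrived_subset[of t] by auto
    then show ?thesis using W(6)[OF that] by (simp add: v_def)
  qed
qed

lemma balance_eq:
  assumes "s \<in> {1..t}" "t \<le> T"
  shows "balance t s = sigma s - (\<Sum>r\<in>{s<..t}. sigma2 r s)"
  using assms
proof (induction t)
  case (Suc t)
  have eq: "{s<..Suc t} = insert (Suc t) {s<..t}" if "s \<le> t" using that by auto
  show ?case
  proof (cases "s = Suc t")
    case True
    have "s \<notin> arrived s" using arrived_subset[of s] by auto
    then show ?thesis using True Suc sigma2_unarrived[of s s] by (simp add: balance_Suc del: balance.simps)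
  next
    case False
    then show ?thesis using Suc eq by (simp add: balance_Suc del: balance.simps)
  qed
qed simp

text \<open>The final balance is nonnegative. This inequality is what makes the divergences at the
  dual points telescope.\<close>

lemma withdrawn_le_sigma:
  assumes "s \<in> {1..T}"
  shows "(\<Sum>r\<in>{s<..T}. sigma2 r s) \<le> sigma s"
  using balance_eq[OF assms] balance_properties[of T] by (metis diff_ge_0_iff_ge order_refl)

lemma balance_le_sigma:
  assumes "s \<in> {1..t}" "t \<le> T"
  shows "balance t s \<le> sigma s"
proof -
  have "0 \<le> (\<Sum>r\<in>{s<..t}. sigma2 r s)"
    using assms by (intro sum_nonneg sigma2_nonneg) auto
  then show ?thesis using balance_eq[OF assms] by simp
qed

text \<open>Conservation of money: round \<open>r\<close> pays in \<open>sigma r\<close> and takes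
  out \<open>sigma r - bank r\<close>, so the total balance rises by exactly the loan.\<close>

lemma sum_balance:
  assumes "t \<le> T"
  shows "(\<Sum>s=1..t. balance t s) = (\<Sum>r=1..t. bank r)"
  using assms
proof (induction t)
  case (Suc t)
  have t: "Suc t \<in> {1..T}" using Suc by simp
  have "Suc t \<notin> arrived (Suc t)" using arrived_subset[of "Suc t"] by auto
  then have 0: "sigma2 (Suc t) (Suc t) = 0" by (rule sigma2_unarrived[OF t])
  have "(\<Sum>s=1..t. balance (Suc t) s) = (\<Sum>s=1..t. balance t s - sigma2 (Suc t) s)"
    by (intro sum.cong) (auto simp: balance_Suc simp del: balance.simps)
  then have "(\<Sum>s=1..Suc t. balance (Suc t) s) =
      sigma (Suc t) + (\<Sum>s=1..t. balance t s) - (\<Sum>s=1..t. sigma2 (Suc t) s)"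
    using 0 by (simp add: balance_Suc sum_subtractf del: balance.simps)
  also have "(\<Sum>s=1..t. sigma2 (Suc t) s) = sigma (Suc t) - bank (Suc t)"
    using sigma2_sum[OF t] by (simp add: atLeastLessThanSuc_atLeastAtMost)
  finally show ?case using Suc by (simp del: balance.simps)
qed simp

text \<open>Whenever the bank has to lend, every arrived account has just been emptied, so all the money
  lent so far sits in the accounts of the current and of the unarrived rounds.\<close>

lemma sum_bank_le:
  assumes G: "\<And>t. t \<in> {1..T} \<Longrightarrow> (\<Sum>s\<in>insert t (unarrived t). sigma s) \<le> G" and "t \<le> T"
  shows "(\<Sum>r=1..t. bank r) \<le> G"
  using \<open>t \<le> T\<close>
proof (induction t)
  case 0
  have "0 \<le> (\<Sum>s\<in>insert 1 (unarrived 1). sigma s)"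
    using sigma_pos by (intro sum_nonneg less_imp_le)
  also have "\<dots> \<le> G" using T_ge by (intro G) auto
  finally show ?case by simp
next
  case (Suc t)
  have t: "Suc t \<in> {1..T}" using Suc by simp
  show ?case
  proof (cases "0 < bank (Suc t)")
    case True
    have "balance (Suc t) s = 0" if "s \<in> arrived (Suc t)" for s
      using bank_pos[OF t True that] that arrived_subset[of "Suc t"]
      by (auto simp: balance_Suc simp del: balance.simps)
    then have "(\<Sum>s=1..Suc t. balance (Suc t) s) =
        (\<Sum>s\<in>insert (Suc t) (unarrived (Suc t)). balance (Suc t) s)"
      by (intro sum.mono_neutral_right) (auto simp: unarrived_def simp del: balance.simps)
    also have "\<dots> \<le> (\<Sum>s\<in>insert (Suc t) (unarrived (Suc t)). sigma s)"
      using Suc by (intro sum_mono balance_le_sigma) (auto simp: unarrived_iff)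
    also have "\<dots> \<le> G" by (rule G[OF t])
    finally show ?thesis using sum_balance[of "Suc t"] Suc by simp
  next
    case False
    then have "bank (Suc t) = 0" using bank_nonneg[OF t] by simp
    then show ?thesis using Suc by simp
  qed
qed

section \<open>Size of the step parameters and pending counts\<close>

lemma ln_T: "1 / 2 \<le> ln (real T)"
proof -
  have "ln 2 \<le> ln (real T)" using T_ge by simp
  then show ?thesis using ln2_ge_two_thirds by simp
qed

lemma finite_unarrived [simp]: "finite (unarrived t)"
  by (simp add: unarrived_def)

text \<open>Double counting of the pairs of a round \<open>s\<close> and a round \<open>r\<close> in
  which \<open>s\<close> is pending; for fixed \<open>s\<close> the latter lie in
  \<open>{s<..s + d s}\<close>.\<close>

lemma pending_sum_le_total_delay:
  assumes "t \<le> T"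
  shows "pending_sum t \<le> total_delay"
proof -
  have "pending_sum t \<le> (\<Sum>r=1..T. pending r)"
    unfolding pending_sum_def using assms by (intro sum_mono2) auto
  also have "\<dots> = (\<Sum>r=1..T. \<Sum>s=1..T. of_bool (s \<in> unarrived r))"
  proof (rule sum.cong[OF refl])
    fix r assume "r \<in> {1..T}"
    then have "{1..T} \<inter> {s. s \<in> unarrived r} = unarrived r" by (auto simp: unarrived_iff)
    then show "pending r = (\<Sum>s=1..T. of_bool (s \<in> unarrived r))"
      by (simp add: pending_eq sum_of_bool_eq)
  qed
  also have "\<dots> = (\<Sum>s=1..T. \<Sum>r=1..T. of_bool (s \<in> unarrived r))" by (rule sum.swap)
  also have "\<dots> \<le> (\<Sum>s=1..T. d s)"
  proof (rule sum_mono)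
    fix s
    have "{1..T} \<inter> {r. s \<in> unarrived r} \<subseteq> {s<..s + d s}" by (auto simp: unarrived_iff)
    from card_mono[OF _ this] show "(\<Sum>r=1..T. of_bool (s \<in> unarrived r)) \<le> d s"
      by (simp add: sum_of_bool_eq)
  qed
  finally show ?thesis by (simp add: total_delay_def)
qed

lemma pending_le: "pending t \<le> t"
proof -
  have "card (unarrived t) \<le> card {1..<t}" by (intro card_mono) (auto simp: unarrived_def)
  then show ?thesis by (simp add: pending_eq)
qed

lemma pending_le_pending_sum: "1 \<le> t \<Longrightarrow> pending t \<le> pending_sum t"
  unfolding pending_sum_def by (intro member_le_sum) auto

text \<open>Each pending count is at most \<open>T\<close>, so \<open>pending_sum t + 1\<close> is
  at most \<open>2 * T^2\<close>, hence at most \<open>T^3\<close> as \<open>T \<ge> 2\<close>. The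
  inner logarithm of the step size thus becomes a multiple of \<open>ln T\<close>.\<close>

lemma ln_pending_sum_le:
  assumes "t \<le> T"
  shows "ln (real (pending_sum t) + 1) \<le> 3 * ln (real T)"
proof -
  have "pending_sum t \<le> (\<Sum>r=1..t. T)"
    unfolding pending_sum_def
  proof (rule sum_mono)
    fix r assume "r \<in> {1..t}"
    then show "pending r \<le> T" using pending_le[of r] assms by auto
  qed
  also have "\<dots> \<le> T * T" using assms by simp
  finally have "pending_sum t + 1 \<le> T * T + T * T" using T_ge by (intro add_mono) auto
  also have "\<dots> = 2 * (T * T)" by simp
  also have "\<dots> \<le> T * (T * T)" using T_ge by (intro mult_right_mono) auto
  also have "\<dots> = T ^ 3" by (simp add: power3_eq_cube)
  finally have "real (pending_sum t) + 1 \<le> real T ^ 3" by (metis of_nat_1 of_nat_add of_nat_le_iff of_nat_power)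
  then have "ln (real (pending_sum t) + 1) \<le> ln (real T ^ 3)"
    using T_ge by (subst ln_le_cancel_iff) auto
  also have "\<dots> = 3 * ln (real T)" using T_ge by (simp add: ln_realpow)
  finally show ?thesis .
qed

definition rate1 :: "nat \<Rightarrow> real"
  where "rate1 t = sqrt (ln (real T) / (real n * real t))"

definition rate2 :: "nat \<Rightarrow> real"
  where "rate2 t = (if pending_sum t = 0 then 0 else real (pending t) *
    sqrt (ln (real (pending_sum t) + 1) * ln (real T) / (real n * real (pending_sum t))))"

lemma sigma_eq: "sigma t = max (inverse (rate1 t + rate2 t)) (8 * real n)"
  by (simp add: sigma_def rate1_def rate2_def)

lemma rate1_pos: "1 \<le> t \<Longrightarrow> 0 < rate1 t"
  using ln_T n_pos by (auto simp: rate1_def intro!: divide_pos_pos)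

lemma rate2_nonneg: "0 \<le> rate2 t"
  using ln_T by (auto simp: rate2_def)

text \<open>Either summand of the rate alone bounds its inverse: \<open>rate1\<close> in terms of
  time, \<open>rate2\<close> in terms of the pending count, with logarithms replaced by their lower
  bound \<open>1 / 2\<close>. The count enters through a lower bound \<open>m\<close> because later
  only predecessors within a given set are counted.\<close>

lemma sigma_le:
  assumes "1 \<le> t" "t \<le> T"
  shows sigma_le_time: "sigma t \<le> 8 * real n + sqrt (2 * real n * real T)"
    and sigma_le_pending: "1 \<le> m \<Longrightarrow> m \<le> pending t \<Longrightarrow>
      sigma t \<le> 8 * real n + 2 * sqrt (real n * real total_delay) / real m"
proof -
  have max_le: "sigma t \<le> 8 * real n + c" if "inverse (rate1 t + rate2 t) \<le> c" "0 \<le> c" for c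
    using that n_pos by (simp add: sigma_eq)
  have "inverse (rate1 t + rate2 t) \<le> inverse (rate1 t)"
    using rate1_pos[OF assms(1)] rate2_nonneg[of t] by (intro le_imp_inverse_le) auto
  also have "\<dots> = sqrt (real n * real t / ln (real T))"
    by (simp add: rate1_def real_sqrt_inverse[symmetric])
  also have "\<dots> \<le> sqrt (2 * real n * real T)"
  proof (rule real_sqrt_le_mono)
    have "real n * real t / ln (real T) \<le> real n * real t / (1 / 2)"
      using ln_T by (intro divide_left_mono) auto
    also have "\<dots> = 2 * real n * real t" by simp
    also have "\<dots> \<le> 2 * real n * real T" using assms by (intro mult_left_mono) auto
    finally show "real n * real t / ln (real T) \<le> 2 * real n * real T" .
  qed
  finally show "sigma t \<le> 8 * real n + sqrt (2 * real n * real T)"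
    by (rule max_le) simp
  assume m: "1 \<le> m" "m \<le> pending t"
  define P where "P = real (pending_sum t)"
  have P: "1 \<le> P" using pending_le_pending_sum[OF assms(1)] m by (simp add: P_def)
  have "ln 2 \<le> ln (P + 1)" using P by simp
  then have lnP: "1 / 2 \<le> ln (P + 1)" using ln2_ge_two_thirds by simp
  have prod: "1 / 4 \<le> ln (P + 1) * ln (real T)"
    using mult_mono[OF lnP ln_T] lnP by simp
  define q where "q = ln (P + 1) * ln (real T) / (real n * P)"
  have q: "q > 0" unfolding q_def using prod n_pos P by (intro divide_pos_pos) auto
  have r2: "rate2 t = real (pending t) * sqrt q"
    using P by (simp add: rate2_def P_def q_def)
  have "real m * sqrt q \<le> rate1 t + rate2 t"
    using m q rate1_pos[OF assms(1)] by (simp add: r2 mult_right_mono add_increasing)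
  then have "inverse (rate1 t + rate2 t) \<le> inverse (real m * sqrt q)"
    using m q by (intro le_imp_inverse_le) auto
  also have "\<dots> = sqrt (inverse q) / real m" by (simp add: real_sqrt_inverse divide_inverse mult.commute)
  also have "\<dots> \<le> sqrt (4 * (real n * real total_delay)) / real m"
  proof (intro divide_right_mono real_sqrt_le_mono)
    have "inverse q = real n * P / (ln (P + 1) * ln (real T))" by (simp add: q_def)
    also have "\<dots> \<le> real n * P / (1 / 4)" using prod P by (intro divide_left_mono) auto
    also have "\<dots> \<le> 4 * (real n * real total_delay)"
      using pending_sum_le_total_delay[OF assms(2)] by (simp add: P_def mult_left_mono)
    finally show "inverse q \<le> 4 * (real n * real total_delay)" .
  qed simp
  also have "\<dots> = 2 * sqrt (real n * real total_delay) / real m" by (simp add: real_sqrt_mult)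
  finally show "sigma t \<le> 8 * real n + 2 * sqrt (real n * real total_delay) / real m"
    by (rule max_le) simp
qed

text \<open>Elements are added in increasing order. The first is charged the time bound, one with
  \<open>k \<ge> 1\<close> predecessors in \<open>A\<close> a multiple of \<open>1 / k\<close>, and
  each the floor \<open>8 * n\<close>; hence the harmonic sum ends at
  \<open>card A - 1\<close>.\<close>

lemma sum_sigma_le:
  assumes "finite A" "A \<subseteq> {1..T}" "\<And>s. s \<in> A \<Longrightarrow> card {r\<in>A. r < s} \<le> pending s"
  shows "(\<Sum>s\<in>A. sigma s) \<le> 8 * real n * real (card A) + sqrt (2 * real n * real T) +
    2 * sqrt (real n * real total_delay) * (\<Sum>k=1..card A - 1. 1 / real k)"
  using assms
proof (induction A rule: finite_linorder_max_induct)
  case (insert b A)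
  have b: "b \<notin> A" "1 \<le> b" "b \<le> T" using insert by auto
  show ?case
  proof (cases "A = {}")
    case True
    then show ?thesis using sigma_le_time[OF b(2,3)] by simp
  next
    case False
    then have c: "1 \<le> card A" using insert by (simp add: Suc_le_eq card_gt_0_iff)
    have "{r \<in> insert b A. r < b} = A" using insert by auto
    then have "card A \<le> pending b" using insert.prems(2)[of b] by simp
    from sigma_le_pending[OF b(2,3) c this]
    have 1: "sigma b \<le> 8 * real n + 2 * sqrt (real n * real total_delay) / real (card A)" .
    have 2: "(\<Sum>s\<in>A. sigma s) \<le> 8 * real n * real (card A) + sqrt (2 * real n * real T) +
      2 * sqrt (real n * real total_delay) * (\<Sum>k=1..card A - 1. 1 / real k)"
    proof (rule insert.IH)
      fix s assume s: "s \<in> A"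
      have "{r \<in> insert b A. r < s} = {r \<in> A. r < s}" using insert.hyps s by auto
      then show "card {r \<in> A. r < s} \<le> pending s" using insert.prems(2)[of s] s by simp
    qed (use insert in auto)
    have "(\<Sum>k=1..card A. 1 / real k) = (\<Sum>k=1..card A - 1. 1 / real k) + 1 / real (card A)"
      using c by (cases "card A") auto
    then show ?thesis using 1 2 b insert.hyps by (simp add: algebra_simps)
  qed
qed simp

text \<open>A round \<open>s\<close> pending in \<open>t\<close> has delay at least
  \<open>t - s\<close>, and these gaps are distinct positive integers.\<close>

lemma pending_squared_le: "1 \<le> t \<Longrightarrow> t \<le> T \<Longrightarrow> (pending t)\<^sup>2 \<le> 2 * total_delay"
proof -
  assume t: "1 \<le> t" "t \<le> T"
  have inj: "inj_on (\<lambda>s. t - s) (unarrived t)" by (auto simp: inj_on_def unarrived_iff)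
  have "(card ((\<lambda>s. t - s) ` unarrived t))\<^sup>2 \<le> 2 * \<Sum>((\<lambda>s. t - s) ` unarrived t)"
    by (intro card_squared_le_sum) (auto simp: unarrived_iff)
  then have "(pending t)\<^sup>2 \<le> 2 * (\<Sum>s\<in>unarrived t. t - s)"
    by (simp add: card_image[OF inj] sum.reindex[OF inj] pending_eq)
  also have "(\<Sum>s\<in>unarrived t. t - s) \<le> (\<Sum>s\<in>unarrived t. d s)"
    by (intro sum_mono) (auto simp: unarrived_iff)
  also have "\<dots> \<le> total_delay"
    unfolding total_delay_def using t by (intro sum_mono2) (auto simp: unarrived_iff)
  finally show ?thesis by simp
qed

lemma sum_bank_bound:
  "(\<Sum>t=1..T. bank t) \<le> 8 * real n * (sqrt (2 * real total_delay) + 1) +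
    sqrt (2 * real n * real T) + 2 * sqrt (real n * real total_delay) * (1 + ln (real T))"
proof (rule sum_bank_le)
  fix t assume t: "t \<in> {1..T}"
  define A where "A = insert t (unarrived t)"
  have card_A: "card A = pending t + 1"
    by (simp add: A_def pending_eq unarrived_iff)
  have "(\<Sum>s\<in>A. sigma s) \<le> 8 * real n * real (card A) + sqrt (2 * real n * real T) +
    2 * sqrt (real n * real total_delay) * (\<Sum>k=1..card A - 1. 1 / real k)"
  proof (rule sum_sigma_le)
    fix s assume "s \<in> A"
    \<comment> \<open>A member of \<open>A\<close> before \<open>s\<close> is still missing in round
      \<open>t\<close>, hence also in the round \<open>s \<le> t\<close>.\<close>
    then have "{r \<in> A. r < s} \<subseteq> unarrived s" by (auto simp: A_def unarrived_iff)
    then show "card {r \<in> A. r < s} \<le> pending s" by (auto simp: pending_eq intro: card_mono)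
  qed (use t in \<open>auto simp: A_def unarrived_iff\<close>)
  also have "\<dots> \<le> 8 * real n * (sqrt (2 * real total_delay) + 1) + sqrt (2 * real n * real T) +
    2 * sqrt (real n * real total_delay) * (1 + ln (real T))"
  proof (intro add_mono mult_left_mono order_refl)
    have "(real (pending t))\<^sup>2 \<le> 2 * real total_delay"
      using pending_squared_le[of t] t by (metis atLeastAtMost_iff of_nat_le_iff of_nat_mult of_nat_numeral of_nat_power)
    then show "real (card A) \<le> sqrt (2 * real total_delay) + 1"
      unfolding card_A by (simp add: real_le_rsqrt)
    show "(\<Sum>k=1..card A - 1. 1 / real k) \<le> 1 + ln (real T)"
    proof (cases "pending t = 0")
      case False
      then have "(\<Sum>k=1..pending t. 1 / real k) \<le> 1 + ln (real (pending t))"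
        by (intro harmonic_sum_le) simp
      also have "ln (real (pending t)) \<le> ln (real T)"
        using False pending_le[of t] t by simp
      finally show ?thesis by (simp add: card_A)
    qed (use ln_T in \<open>simp add: card_A\<close>)
  qed auto
  finally show "(\<Sum>s\<in>insert t (unarrived t). sigma s) \<le> 8 * real n * (sqrt (2 * real total_delay) + 1) +
    sqrt (2 * real n * real T) + 2 * sqrt (real n * real total_delay) * (1 + ln (real T))"
    by (simp add: A_def)
qed simp

text \<open>Up to logarithms and \<open>sqrt n\<close>, both rates are \<open>a t\<close> divided by
  the square root of the partial sum of \<open>a\<close>, with \<open>a = 1\<close> and
  \<open>a = pending\<close>, so one summation lemma serves both.\<close>

lemma sum_inverse_sigma_bound:
  "(\<Sum>t=1..T. 1 / sigma t) \<le>
    4 * ln (real T) * (sqrt (real T) + sqrt (real total_delay)) / sqrt (real n)"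
proof -
  define L where "L = ln (real T)"
  have L: "1 / 2 \<le> L" using ln_T by (simp add: L_def)
  have n: "sqrt (real n) > 0" using n_pos by simp
  \<comment> \<open>As \<open>L \<ge> 1 / 2\<close>, \<open>sqrt L\<close> is at most
    \<open>2 * L\<close>. The other rate produces \<open>sqrt (3 * L^2)\<close>, which obeys the
    same bound, so both share one factor.\<close>
  have "L \<le> (2 * L)\<^sup>2"
    using mult_right_mono[OF L, of "4 * L"] L by (simp add: power2_eq_square)
  then have sqrt_L: "sqrt L \<le> 2 * L" using L by (intro real_le_lsqrt) auto
  have term_le: "1 / sigma t \<le> 2 * L / sqrt (real n) *
      (1 / sqrt (\<Sum>r=1..t. 1) + real (pending t) / sqrt (\<Sum>r=1..t. real (pending r)))"
    if t: "t \<in> {1..T}" for t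
  proof -
    have r: "rate1 t + rate2 t > 0" using rate1_pos[of t] rate2_nonneg[of t] t by (simp add: add_pos_nonneg)
    have "inverse (rate1 t + rate2 t) \<le> sigma t" by (simp add: sigma_eq)
    then have "inverse (sigma t) \<le> inverse (inverse (rate1 t + rate2 t))"
      using r by (intro le_imp_inverse_le) auto
    then have "1 / sigma t \<le> rate1 t + rate2 t" by (simp add: inverse_eq_divide)
    also have "rate1 t \<le> 2 * L / sqrt (real n) * (1 / sqrt (real t))"
      using divide_right_mono[OF sqrt_L, of "sqrt (real n) * sqrt (real t)"]
      by (simp add: rate1_def L_def real_sqrt_divide real_sqrt_mult)
    also have "rate2 t \<le> 2 * L / sqrt (real n) * (real (pending t) / sqrt (real (pending_sum t)))"
    proof (cases "pending_sum t = 0")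
      case False
      have "ln (real (pending_sum t) + 1) * L \<le> (3 * L) * L"
        using ln_pending_sum_le[of t] t L by (intro mult_right_mono) (auto simp: L_def)
      also have "\<dots> \<le> (2 * L)\<^sup>2" using L by (simp add: power2_eq_square)
      finally have "sqrt (ln (real (pending_sum t) + 1) * L) \<le> 2 * L"
        using L by (intro real_le_lsqrt) auto
      then have "real (pending t) * (sqrt (ln (real (pending_sum t) + 1) * L) /
            (sqrt (real n) * sqrt (real (pending_sum t)))) \<le>
          real (pending t) * (2 * L / (sqrt (real n) * sqrt (real (pending_sum t))))"
        by (intro mult_left_mono divide_right_mono) auto
      then show ?thesis using False
        by (simp add: rate2_def L_def real_sqrt_divide real_sqrt_mult mult_ac)
    qed (simp add: rate2_def)
    finally show ?thesis by (simp add: pending_sum_def distrib_left)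
  qed
  have "(\<Sum>t=1..T. 1 / sigma t) \<le> (\<Sum>t=1..T. 2 * L / sqrt (real n) *
      (1 / sqrt (\<Sum>r=1..t. 1) + real (pending t) / sqrt (\<Sum>r=1..t. real (pending r))))"
    by (intro sum_mono term_le)
  also have "\<dots> = 2 * L / sqrt (real n) * ((\<Sum>t=1..T. 1 / sqrt (\<Sum>r=1..t. 1)) +
      (\<Sum>t=1..T. real (pending t) / sqrt (\<Sum>r=1..t. real (pending r))))"
    by (simp only: sum_distrib_left[symmetric] sum.distrib)
  also have "\<dots> \<le> 2 * L / sqrt (real n) *
      (2 * sqrt (\<Sum>r=1..T. 1) + 2 * sqrt (\<Sum>r=1..T. real (pending r)))"
    using L by (intro mult_left_mono add_mono sum_div_sqrt_partial_sums) auto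
  also have "(\<Sum>r=1..T. real (pending r)) = real (pending_sum T)" by (simp add: pending_sum_def)
  also have "2 * L / sqrt (real n) * (2 * sqrt (\<Sum>r=1..T. 1) + 2 * sqrt (real (pending_sum T))) \<le>
      2 * L / sqrt (real n) * (2 * sqrt (real T) + 2 * sqrt (real total_delay))"
    using L pending_sum_le_total_delay[of T] by (intro mult_left_mono add_mono) auto
  finally show ?thesis by (simp add: L_def distrib_left add_divide_distrib mult.assoc)
qed

end

section \<open>Regret\<close>

context sc_barrier
begin

definition bregman :: "'a \<Rightarrow> 'a \<Rightarrow> real"
  where "bregman y x = f y - f x - gradient S f x \<bullet> (y - x)"

lemma bregman_nonneg: "x \<in> U \<Longrightarrow> y \<in> U \<Longrightarrow> 0 \<le> bregman y x"
  using first_order_convexity[of x y] by (simp add: bregman_def)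

lemma bregman_three_point:
  "(gradient S f x - gradient S f z) \<bullet> (x - y) = bregman y x - bregman y z + bregman x z"
  by (simp add: bregman_def inner_diff_left inner_diff_right)

text \<open>As a function of the gradient \<open>\<xi>\<close> of \<open>f\<close> at
  \<open>x\<close>, the divergence is \<open>f y - \<xi> \<bullet> y\<close> plus the conjugate at
  \<open>\<xi>\<close>, which is convex. The proof averages the tangent inequalities from the points
  \<open>z i\<close> to \<open>x\<close>.\<close>

lemma bregman_convex_in_gradient:
  assumes "x \<in> U" "finite I" "\<And>i. i \<in> I \<Longrightarrow> 0 \<le> w i" "sum w I = 1"
    and z: "\<And>i. i \<in> I \<Longrightarrow> z i \<in> U"
    and grad: "gradient S f x = (\<Sum>i\<in>I. w i *\<^sub>R gradient S f (z i))"
  shows "bregman y x \<le> (\<Sum>i\<in>I. w i * bregman y (z i))"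
proof -
  have "bregman y x = (\<Sum>i\<in>I. w i * (f y - f x)) - gradient S f x \<bullet> (y - x)"
    using assms(4) by (simp add: bregman_def flip: sum_distrib_right)
  also have "\<dots> = (\<Sum>i\<in>I. w i * (f y - f x - gradient S f (z i) \<bullet> (y - x)))"
    unfolding grad by (simp add: inner_sum_left right_diff_distrib sum_subtractf)
  also have "\<dots> \<le> (\<Sum>i\<in>I. w i * bregman y (z i))"
  proof (intro sum_mono mult_left_mono)
    fix i assume i: "i \<in> I"
    show "f y - f x - gradient S f (z i) \<bullet> (y - x) \<le> bregman y (z i)"
      using first_order_convexity[OF z[OF i] assms(1)]
      by (simp add: bregman_def inner_diff_right)
  qed (use assms in auto)
  finally show ?thesis .
qed

text \<open>The hypothesis says that the local dual norm of the gradient step is at most \<open>r\<close>; the lower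
  bound on the Hessian along the segment then turns this into a bound on the local norm of \<open>z - x\<close>.\<close>

lemma bregman_le_square:
  assumes x: "x \<in> U" and z: "z \<in> U" and r: "0 \<le> r" "r \<le> 1 / 8"
    and step: "(gradient S f z - gradient S f x) \<bullet> (z - x) \<le> r * local_norm x (z - x)"
  shows "bregman x z \<le> 8 / 7 * r\<^sup>2"
proof -
  define \<rho> where "\<rho> = local_norm x (z - x)"
  have "z - x \<in> S" using x z U_subset_S by (auto intro: subspace_diff subspace)
  then have \<rho>: "0 \<le> \<rho>" using local_norm_nonneg[OF x] by (simp add: \<rho>_def)
  have "\<rho> \<le> 8 / 7 * r"
  proof (cases "\<rho> = 0")
    case False
    have "\<rho> - \<rho> / (1 + \<rho>) \<le> r * \<rho>"
      using gradient_strongly_monotone[OF x z] step by (simp add: \<rho>_def)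
    then have "\<rho> * (\<rho> / (1 + \<rho>)) \<le> \<rho> * r"
      using \<rho> by (simp add: field_simps power2_eq_square)
    then have "\<rho> / (1 + \<rho>) \<le> r" using \<rho> False by (simp only: mult_le_cancel_left)
    then have "\<rho> \<le> r * (1 + \<rho>)" using \<rho> by (simp add: pos_divide_le_eq)
    \<comment> \<open>The bound \<open>1 / 8\<close> on \<open>r\<close> leaves
      \<open>7 / 8 * \<rho> \<le> r\<close>, the source of the factor \<open>8 / 7\<close>.\<close>
    also have "\<dots> \<le> r + \<rho> / 8" using mult_right_mono[OF r(2) \<rho>] by (simp add: algebra_simps)
    finally show ?thesis by simp
  qed (use r in simp)
  \<comment> \<open>The divergence is at most its symmetrisation, which is the inner product
    controlled by \<open>step\<close>.\<close>
  have "bregman x z \<le> (gradient S f z - gradient S f x) \<bullet> (z - x)"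
    using first_order_convexity[OF x z]
    by (simp add: bregman_def inner_diff_left inner_diff_right)
  also have "\<dots> \<le> r * \<rho>" using step by (simp add: \<rho>_def)
  also have "\<dots> \<le> r * (8 / 7 * r)" using r(1) \<open>\<rho> \<le> 8 / 7 * r\<close> by (rule mult_left_mono[rotated])
  finally show ?thesis by (simp add: power2_eq_square)
qed

end

text \<open>All coordinates but \<open>t\<close> are drawn first and held fixed, so the last
  hypothesis is the vanishing of a conditional expectation. Finite supports turn the integrals into
  finite sums.\<close>

lemma expectation_Pi_pmf_resample:
  fixes h :: "('a \<Rightarrow> 'b) \<Rightarrow> real"
  assumes "finite A" "t \<in> A" "\<And>x. x \<in> A \<Longrightarrow> finite (set_pmf (p x))"
    and zero: "\<And>g. g \<in> set_pmf (Pi_pmf (A - {t}) dflt p) \<Longrightarrow>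
      measure_pmf.expectation (p t) (\<lambda>u. h (g(t := u))) = 0"
  shows "measure_pmf.expectation (Pi_pmf A dflt p) h = 0"
proof -
  let ?Q = "Pi_pmf (A - {t}) dflt p"
  have fin: "finite (set_pmf ?Q)"
    using assms by (intro finite_subset[OF set_Pi_pmf_subset'] finite_PiE_dflt) auto
  have "Pi_pmf A dflt p = Pi_pmf (insert t (A - {t})) dflt p"
    using assms(2) by (simp add: insert_absorb)
  also have "\<dots> = p t \<bind> (\<lambda>u. ?Q \<bind> (\<lambda>g. return_pmf (g(t := u))))"
    using assms(1) by (intro Pi_pmf_insert') auto
  also have "\<dots> = ?Q \<bind> (\<lambda>g. p t \<bind> (\<lambda>u. return_pmf (g(t := u))))"
    by (rule bind_commute_pmf)
  also have "\<dots> = ?Q \<bind> (\<lambda>g. map_pmf (\<lambda>u. g(t := u)) (p t))"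
    by (simp add: map_pmf_def)
  finally have "measure_pmf.expectation (Pi_pmf A dflt p) h =
      (\<Sum>g\<in>set_pmf ?Q. pmf ?Q g *\<^sub>R measure_pmf.expectation (map_pmf (\<lambda>u. g(t := u)) (p t)) h)"
    using fin assms(2,3) by (simp add: pmf_expectation_bind[OF fin])
  also have "\<dots> = 0" using zero by simp
  finally show ?thesis .
qed

locale banker_regret = banker_schedule n C \<Psi> T l d ord e lam +
    sc_barrier "Rn n" "Rn_unit ` {1..n}" C \<Psi> \<theta>
    for n C \<Psi> T l d ord e lam \<theta> +
  assumes loss_polar: "\<And>t. t \<in> {1..T} \<Longrightarrow> l t \<in> polar_set (Rn n) C"
    and eigen: "\<And>t x. t \<in> {1..T} \<Longrightarrow> x \<in> interior_in (Rn n) C \<Longrightarrow>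
      orthonormal_eigenbasis n (Rn n) (hessian (Rn n) \<Psi> x) (e t x) (lam t x)"
begin

lemma grad_conj_eq: "grad_conj = grad_inv"
  by (simp add: grad_conj_def grad_inv_def)

lemma x0_in_U: "x0 \<in> U" and grad_x0: "grad x0 = 0"
  using grad_inv_in_U[of 0] gradient_grad_inv[of 0] subspace_0[OF subspace]
  by (auto simp: x0_def grad_conj_eq)

definition outcomes :: "(nat \<times> real) set"
  where "outcomes = {1..n} \<times> {-1, 1}"

section \<open>One round with a given iterate\<close>

context
  fixes t x i
  assumes t: "t \<in> {1..T}" and x: "x \<in> U" and i: "i \<in> {1..n}"
begin

lemma eigenvector_in: "e t x i \<in> Rn n"
  using eigen[OF t x] i by (auto simp: orthonormal_eigenbasis_def)

lemma lam_pos: "0 < lam t x i"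
  using eigenvalue_pos[of x "e t x" "lam t x" i] eigen[OF t x] x i
  unfolding card_Rn_unit by blast

lemma deriv2_eigen: "h \<in> Rn n \<Longrightarrow>
    deriv2 (Rn n) \<Psi> x h h = (\<Sum>j=1..n. lam t x j * (h \<bullet> e t x j)\<^sup>2)"
  using deriv2_eigenbasis[of x "e t x" "lam t x" h] eigen[OF t x] x
  unfolding card_Rn_unit by blast

text \<open>All terms of the eigenvector expansion of the squared local norm are nonnegative, so
  each one is at most their sum.\<close>

lemma local_norm_ge_eigen:
  assumes h: "h \<in> Rn n"
  shows "lam t x i powr (1/2) * \<bar>e t x i \<bullet> h\<bar> \<le> local_norm x h"
proof -
  have lam_j: "0 < lam t x j" if "j \<in> {1..n}" for j
    using eigenvalue_pos[of x "e t x" "lam t x" j] eigen[OF t x] x that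
    unfolding card_Rn_unit by blast
  have "lam t x i * (h \<bullet> e t x i)\<^sup>2 \<le> (\<Sum>j=1..n. lam t x j * (h \<bullet> e t x j)\<^sup>2)"
    using i less_imp_le[OF lam_j] by (intro member_le_sum) auto
  then have "sqrt (lam t x i * (h \<bullet> e t x i)\<^sup>2) \<le> local_norm x h"
    unfolding local_norm_def deriv2_eigen[OF h] by (rule real_sqrt_le_mono)
  then show ?thesis
    using lam_pos by (simp add: real_sqrt_mult powr_half_sqrt inner_commute)
qed

text \<open>The scaling by the inverse square root of the eigenvalue gives the displacement local
  norm exactly one, so the Dikin ellipsoid contains the action.\<close>

lemma action_at_in_C:
  assumes "\<omega> t = (i, \<epsilon>)" "\<epsilon> \<in> {-1, 1}"
  shows "action_at \<omega> t x \<in> C"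
proof -
  define h where "h = (\<epsilon> * lam t x i powr (-1/2)) *\<^sub>R e t x i"
  have h: "h \<in> Rn n" using eigenvector_in by (auto simp: h_def intro: subspace_scale subspace)
  have eps: "\<epsilon>\<^sup>2 = 1" using assms(2) by auto
  have inner: "h \<bullet> e t x j = (if j = i then \<epsilon> * lam t x i powr (-1/2) else 0)" if "j \<in> {1..n}" for j
    using eigen[OF t x] i that by (auto simp: h_def orthonormal_eigenbasis_def)
  have "deriv2 (Rn n) \<Psi> x h h =
      (\<Sum>j=1..n. if j = i then lam t x i * (\<epsilon> * lam t x i powr (-1/2))\<^sup>2 else 0)"
    unfolding deriv2_eigen[OF h] by (intro sum.cong) (auto simp: inner)
  also have "\<dots> = lam t x i * (lam t x i powr (-1/2))\<^sup>2"
    using i eps by (simp add: power_mult_distrib)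
  also have "(lam t x i powr (-1/2))\<^sup>2 = inverse (lam t x i)"
    using lam_pos powr_minus[of "lam t x i" "1/2"]
    by (simp add: powr_half_sqrt power_inverse)
  finally have "local_norm x h = 1" using lam_pos by (simp add: local_norm_def)
  then have "x + h \<in> C" using Dikin_ellipsoid[OF x h] by simp
  then show ?thesis using assms(1) by (simp add: action_at_def h_def)
qed

lemma abs_loss_at_le:
  assumes "\<omega> t = (i, \<epsilon>)" "\<epsilon> \<in> {-1, 1}"
  shows "\<bar>loss_at \<omega> t x\<bar> \<le> 1"
  using loss_polar[OF t] action_at_in_C[where \<omega> = \<omega>, OF assms] by (simp add: polar_set_def loss_at_def)

lemma estimate_at_in: "\<omega> t = (i, \<epsilon>) \<Longrightarrow> estimate_at \<omega> t x \<in> Rn n"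
  using eigenvector_in by (auto simp: estimate_at_def intro: subspace_scale subspace)

text \<open>The revealed loss is at most one in absolute value, and the eigenvalue factor turns the
  component of \<open>h\<close> along the eigenvector into a part of its local norm.\<close>

lemma estimate_at_dual_norm:
  assumes "\<omega> t = (i, \<epsilon>)" "\<epsilon> \<in> {-1, 1}" "h \<in> Rn n"
  shows "\<bar>estimate_at \<omega> t x \<bullet> h\<bar> \<le> real n * local_norm x h"
proof -
  have "\<bar>estimate_at \<omega> t x \<bullet> h\<bar> = real n * (\<bar>loss_at \<omega> t x\<bar> * (lam t x i powr (1/2) * \<bar>e t x i \<bullet> h\<bar>))"
    using assms(1,2) by (auto simp: estimate_at_def abs_mult)
  also have "\<dots> \<le> real n * (1 * local_norm x h)"
    using abs_loss_at_le[where \<omega> = \<omega>, OF assms(1,2)] local_norm_ge_eigen[OF assms(3)]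
    by (intro mult_left_mono mult_mono) auto
  finally show ?thesis by simp
qed

lemma z_at_properties:
  assumes \<omega>: "\<omega> t = (i, \<epsilon>)" "\<epsilon> \<in> {-1, 1}"
  shows z_at_in_U: "z_at \<omega> t x \<in> U"
    and grad_z_at: "grad (z_at \<omega> t x) = grad x - (1 / sigma t) *\<^sub>R estimate_at \<omega> t x"
    and bregman_z_at: "sigma t * bregman x (z_at \<omega> t x) \<le> 8 / 7 * (real n)\<^sup>2 / sigma t"
proof -
  define z where "z = z_at \<omega> t x"
  have in_S: "grad x - (1 / sigma t) *\<^sub>R estimate_at \<omega> t x \<in> Rn n"
    using grad_in[OF x] estimate_at_in[where \<omega> = \<omega>, OF \<omega>(1)] by (intro subspace_diff subspace_scale subspace)
  show z: "z_at \<omega> t x \<in> U"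
    and gz: "grad (z_at \<omega> t x) = grad x - (1 / sigma t) *\<^sub>R estimate_at \<omega> t x"
    unfolding z_at_def grad_conj_eq using grad_inv_in_U[OF in_S] gradient_grad_inv[OF in_S] .
  have zx: "z - x \<in> Rn n" using z x U_subset_S by (auto simp: z_def intro: subspace_diff subspace)
  \<comment> \<open>This bounds the dual local norm of the step; the floor \<open>8 * n\<close> of
    \<open>sigma\<close> is what makes it at most \<open>1 / 8\<close>.\<close>
  define r where "r = real n / sigma t"
  have "bregman x z \<le> 8 / 7 * r\<^sup>2"
  proof (rule bregman_le_square[OF x z[folded z_def]])
    show "0 \<le> r" "r \<le> 1 / 8"
      using sigma_pos[of t] sigma_ge[of t] by (auto simp: r_def field_simps)
    have "(grad z - grad x) \<bullet> (z - x) = - (estimate_at \<omega> t x \<bullet> (z - x)) / sigma t"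
      unfolding z_def gz by simp
    also have "\<dots> \<le> (real n * local_norm x (z - x)) / sigma t"
      using estimate_at_dual_norm[where \<omega> = \<omega>, OF \<omega> zx] sigma_pos[of t]
      by (intro divide_right_mono) (auto simp: abs_le_iff)
    finally show "(grad z - grad x) \<bullet> (z - x) \<le> r * local_norm x (z - x)" by (simp add: r_def)
  qed
  then have "sigma t * bregman x z \<le> sigma t * (8 / 7 * r\<^sup>2)"
    using sigma_pos[of t] by (intro mult_left_mono) auto
  also have "\<dots> = 8 / 7 * (real n)\<^sup>2 / sigma t"
    using sigma_pos[of t] by (simp add: r_def power2_eq_square)
  finally show "sigma t * bregman x (z_at \<omega> t x) \<le> 8 / 7 * (real n)\<^sup>2 / sigma t" by (simp add: z_def)
qed

end

section \<open>Iterates and the pathwise bound\<close>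

definition valid :: "(nat \<Rightarrow> nat \<times> real) \<Rightarrow> nat \<Rightarrow> bool"
  where "valid \<omega> t \<longleftrightarrow> (\<forall>s\<in>{1..<t}. \<omega> s \<in> outcomes)"

lemma z_at_in_U': "t \<in> {1..T} \<Longrightarrow> x \<in> U \<Longrightarrow> \<omega> t \<in> outcomes \<Longrightarrow> z_at \<omega> t x \<in> U"
  using z_at_in_U[of t x _ \<omega>] by (auto simp: outcomes_def)

text \<open>Every vector of \<open>Rn n\<close> is the gradient at a unique point of
  \<open>U\<close>, recovered by \<open>grad_conj\<close>. By induction the earlier dual points lie
  in \<open>U\<close>, so their gradient mixture is such a vector.\<close>

lemma iterate_properties:
  assumes "t \<in> {1..T}" "valid \<omega> t"
  shows iterate_in_U: "iterate \<omega> t \<in> U"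
    and grad_iterate: "grad (iterate \<omega> t) =
      (\<Sum>s\<in>{1..<t}. (sigma2 t s / sigma t) *\<^sub>R grad (z_at \<omega> s (iterate \<omega> s)))
        + (bank t / sigma t) *\<^sub>R grad x0"
proof -
  have "iterate \<omega> t \<in> U \<and> grad (iterate \<omega> t) =
      (\<Sum>s\<in>{1..<t}. (sigma2 t s / sigma t) *\<^sub>R grad (z_at \<omega> s (iterate \<omega> s)))
        + (bank t / sigma t) *\<^sub>R grad x0"
    using assms
  proof (induction t rule: less_induct)
    case (less t)
    let ?\<theta> = "(\<Sum>s\<in>{1..<t}. (sigma2 t s / sigma t) *\<^sub>R grad (z_at \<omega> s (iterate \<omega> s)))
        + (bank t / sigma t) *\<^sub>R grad x0"
    have "z_at \<omega> s (iterate \<omega> s) \<in> U" if s: "s \<in> {1..<t}" for s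
    proof -
      have "s \<in> {1..T}" "valid \<omega> s" "\<omega> s \<in> outcomes" using less.prems s by (auto simp: valid_def)
      then show ?thesis using less.IH[of s] s z_at_in_U' by auto
    qed
    then have "?\<theta> \<in> Rn n"
      using x0_in_U by (intro subspace_add subspace_sum subspace_scale subspace grad_in) auto
    then have "grad_inv ?\<theta> \<in> U" "grad (grad_inv ?\<theta>) = ?\<theta>"
      by (rule grad_inv_in_U, rule gradient_grad_inv)
    then show ?case
      unfolding iterate.simps[of \<omega> t] grad_conj_eq by simp
  qed
  then show "iterate \<omega> t \<in> U" "grad (iterate \<omega> t) =
      (\<Sum>s\<in>{1..<t}. (sigma2 t s / sigma t) *\<^sub>R grad (z_at \<omega> s (iterate \<omega> s)))
        + (bank t / sigma t) *\<^sub>R grad x0" by auto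
qed

text \<open>Predictability: the iterate of round \<open>t\<close> can be held fixed while the
  outcome of that round is averaged.\<close>

lemma iterate_cong:
  assumes "\<And>s. s \<in> {1..<t} \<Longrightarrow> \<omega> s = \<omega>' s"
  shows "iterate \<omega> t = iterate \<omega>' t"
  using assms
proof (induction t rule: less_induct)
  case (less t)
  have "z_at \<omega> s (iterate \<omega> s) = z_at \<omega>' s (iterate \<omega>' s)" if s: "s \<in> {1..<t}" for s
  proof -
    have "iterate \<omega> s = iterate \<omega>' s" using less s by auto
    then show ?thesis
      using less.prems[OF s] by (simp add: z_at_def estimate_at_def loss_at_def action_at_def)
  qed
  then have "(\<Sum>s\<in>{1..<t}. (sigma2 t s / sigma t) *\<^sub>R grad (z_at \<omega> s (iterate \<omega> s))) =
      (\<Sum>s\<in>{1..<t}. (sigma2 t s / sigma t) *\<^sub>R grad (z_at \<omega>' s (iterate \<omega>' s)))"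
    by (intro sum.cong) auto
  then show ?case unfolding iterate.simps[of \<omega> t] iterate.simps[of \<omega>' t] by simp
qed

lemma linearized_regret_le:
  assumes y: "y \<in> U" and \<omega>: "\<And>t. t \<in> {1..T} \<Longrightarrow> \<omega> t \<in> outcomes"
  shows "(\<Sum>t=1..T. estimate_at \<omega> t (iterate \<omega> t) \<bullet> (iterate \<omega> t - y)) \<le>
    (\<Sum>t=1..T. bank t) * bregman y x0 + 8 / 7 * (real n)\<^sup>2 * (\<Sum>t=1..T. 1 / sigma t)"
proof -
  define x where "x = iterate \<omega>"
  define z where "z t = z_at \<omega> t (x t)" for t
  have valid: "valid \<omega> t" if "t \<in> {1..T}" for t using \<omega> that by (auto simp: valid_def)
  have xU: "x t \<in> U" if "t \<in> {1..T}" for t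
    using iterate_in_U[OF that valid[OF that]] by (simp add: x_def)
  have out: "fst (\<omega> t) \<in> {1..n}" "\<omega> t = (fst (\<omega> t), snd (\<omega> t))" "snd (\<omega> t) \<in> {-1, 1}"
    if "t \<in> {1..T}" for t
    using \<omega>[OF that] by (auto simp: outcomes_def)
  have zU: "z t \<in> U" if "t \<in> {1..T}" for t
    unfolding z_def by (rule z_at_in_U'[where \<omega> = \<omega>, OF that xU[OF that] \<omega>[OF that]])
  \<comment> \<open>Rounds start at one, which leaves index zero free for the loan of the bank with
    point \<open>x0\<close>; the weights over \<open>{0..<t}\<close> then form a convex
    combination.\<close>
  have split: "(\<Sum>s\<in>{0..<t}. F s) = F 0 + (\<Sum>s\<in>{1..<t}. F s)" if "t \<in> {1..T}"
    for t and F :: "nat \<Rightarrow> 'z::comm_monoid_add"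
    using that sum.atLeast_Suc_lessThan[of 0 t F] by simp
  have step: "estimate_at \<omega> t (x t) \<bullet> (x t - y) \<le>
      (\<Sum>s\<in>{1..<t}. sigma2 t s * bregman y (z s)) + bank t * bregman y x0
        - sigma t * bregman y (z t) + 8 / 7 * (real n)\<^sup>2 * (1 / sigma t)"
    if t: "t \<in> {1..T}" for t
  proof -
    note zt = z_at_properties[where \<omega> = \<omega>, OF t xU[OF t] out(1)[OF t] out(2,3)[OF t], folded z_def]
    have "estimate_at \<omega> t (x t) = sigma t *\<^sub>R (grad (x t) - grad (z t))"
      using sigma_pos[of t] by (simp add: zt(2))
    then have "estimate_at \<omega> t (x t) \<bullet> (x t - y) =
        sigma t * ((grad (x t) - grad (z t)) \<bullet> (x t - y))"
      by (simp only: inner_scaleR_left)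
    then have three_point: "estimate_at \<omega> t (x t) \<bullet> (x t - y) =
        sigma t * bregman y (x t) - sigma t * bregman y (z t) + sigma t * bregman (x t) (z t)"
      unfolding bregman_three_point by (simp add: algebra_simps)
    have "bregman y (x t) \<le> (\<Sum>s\<in>{0..<t}. ((if s = 0 then bank t else sigma2 t s) / sigma t) *
        bregman y (if s = 0 then x0 else z s))"
    proof (rule bregman_convex_in_gradient[OF xU[OF t]])
      show "0 \<le> (if s = 0 then bank t else sigma2 t s) / sigma t" for s
        using sigma2_nonneg[OF t] bank_nonneg[OF t] sigma_pos[of t] by simp
      have "(\<Sum>s\<in>{1..<t}. (if s = 0 then bank t else sigma2 t s) / sigma t) =
          (\<Sum>s\<in>{1..<t}. sigma2 t s) / sigma t"
        by (simp add: sum_divide_distrib)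
      then show "(\<Sum>s\<in>{0..<t}. (if s = 0 then bank t else sigma2 t s) / sigma t) = 1"
        using sigma2_sum[OF t] sigma_pos[of t] unfolding split[OF t] by (simp add: field_simps)
      show "(if s = 0 then x0 else z s) \<in> U" if "s \<in> {0..<t}" for s
        using x0_in_U zU that t by auto
      have "grad (x t) = (bank t / sigma t) *\<^sub>R grad x0 +
          (\<Sum>s\<in>{1..<t}. (sigma2 t s / sigma t) *\<^sub>R grad (z s))"
        using grad_iterate[OF t valid[OF t]] by (simp add: x_def z_def add.commute)
      also have "(\<Sum>s\<in>{1..<t}. (sigma2 t s / sigma t) *\<^sub>R grad (z s)) =
          (\<Sum>s\<in>{1..<t}. ((if s = 0 then bank t else sigma2 t s) / sigma t) *\<^sub>R
            grad (if s = 0 then x0 else z s))"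
        by (intro sum.cong) auto
      finally show "grad (x t) = (\<Sum>s\<in>{0..<t}. ((if s = 0 then bank t else sigma2 t s) / sigma t) *\<^sub>R
            grad (if s = 0 then x0 else z s))"
        unfolding split[OF t] by simp
    qed (rule finite_atLeastLessThan)
    also have "\<dots> = (bank t * bregman y x0 + (\<Sum>s\<in>{1..<t}. sigma2 t s * bregman y (z s))) / sigma t"
    proof -
      have "(\<Sum>s\<in>{1..<t}. ((if s = 0 then bank t else sigma2 t s) / sigma t) *
          bregman y (if s = 0 then x0 else z s)) = (\<Sum>s\<in>{1..<t}. sigma2 t s * bregman y (z s) / sigma t)"
      proof (rule sum.cong[OF refl])
        fix s assume "s \<in> {1..<t}"
        then have "s \<noteq> 0" by simp
        then show "((if s = 0 then bank t else sigma2 t s) / sigma t) *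
            bregman y (if s = 0 then x0 else z s) = sigma2 t s * bregman y (z s) / sigma t"
          by (simp only: if_False times_divide_eq_left)
      qed
      then show ?thesis
        unfolding split[OF t] add_divide_distrib sum_divide_distrib by simp
    qed
    finally have convex: "sigma t * bregman y (x t) \<le>
        bank t * bregman y x0 + (\<Sum>s\<in>{1..<t}. sigma2 t s * bregman y (z s))"
      using sigma_pos[of t] by (simp add: pos_le_divide_eq mult.commute)
    have "sigma t * bregman (x t) (z t) \<le> 8 / 7 * (real n)\<^sup>2 * (1 / sigma t)"
      using zt(3) by simp
    with three_point convex show ?thesis by linarith
  qed
  have "(\<Sum>t=1..T. \<Sum>s\<in>{1..<t}. sigma2 t s * bregman y (z s)) =
      (\<Sum>t=1..T. \<Sum>s | s \<in> {1..T} \<and> s < t. sigma2 t s * bregman y (z s))"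
    by (intro sum.cong) auto
  also have "\<dots> = (\<Sum>s=1..T. \<Sum>t | t \<in> {1..T} \<and> s < t. sigma2 t s * bregman y (z s))"
    by (intro sum.swap_restrict) auto
  also have "\<dots> = (\<Sum>s=1..T. (\<Sum>t\<in>{s<..T}. sigma2 t s) * bregman y (z s))"
    unfolding sum_distrib_right by (intro sum.cong) auto
  \<comment> \<open>The divergence at \<open>z s\<close> is weighted by the total payout of account
    \<open>s\<close>. Its bound \<open>sigma s\<close> produces exactly the term that round
    \<open>s\<close> subtracts.\<close>
  also have "\<dots> \<le> (\<Sum>s=1..T. sigma s * bregman y (z s))"
    using withdrawn_le_sigma bregman_nonneg[OF zU y] by (intro sum_mono mult_right_mono) auto
  finally have swap: "(\<Sum>t=1..T. \<Sum>s\<in>{1..<t}. sigma2 t s * bregman y (z s)) \<le>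
      (\<Sum>s=1..T. sigma s * bregman y (z s))" .
  have "(\<Sum>t=1..T. estimate_at \<omega> t (x t) \<bullet> (x t - y)) \<le>
      (\<Sum>t=1..T. (\<Sum>s\<in>{1..<t}. sigma2 t s * bregman y (z s)) + bank t * bregman y x0
        - sigma t * bregman y (z t) + 8 / 7 * (real n)\<^sup>2 * (1 / sigma t))"
    by (intro sum_mono step)
  also have "\<dots> = (\<Sum>t=1..T. \<Sum>s\<in>{1..<t}. sigma2 t s * bregman y (z s)) +
      (\<Sum>t=1..T. bank t) * bregman y x0 - (\<Sum>t=1..T. sigma t * bregman y (z t)) +
      8 / 7 * (real n)\<^sup>2 * (\<Sum>t=1..T. 1 / sigma t)"
    by (simp only: sum.distrib sum_subtractf sum_distrib_left sum_distrib_right)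
  finally show ?thesis using swap by (simp add: x_def)
qed

section \<open>Expectation over the outcomes\<close>

lemma expectation_outcome:
  "measure_pmf.expectation (pair_pmf (pmf_of_set {1..n}) (pmf_of_set {-1, 1})) g =
    (\<Sum>i=1..n. g (i, -1) + g (i, 1)) / (2 * real n)" for g :: "nat \<times> real \<Rightarrow> real"
proof -
  have "measure_pmf.expectation (pair_pmf (pmf_of_set {1..n}) (pmf_of_set {-1, 1})) g =
      (\<Sum>u\<in>{1..n} \<times> {-1, 1}. pmf (pair_pmf (pmf_of_set {1..n}) (pmf_of_set {-1, 1})) u *\<^sub>R g u)"
    using n_pos by (intro integral_measure_pmf) auto
  also have "\<dots> = (\<Sum>i=1..n. \<Sum>\<epsilon>\<in>{-1, 1}. g (i, \<epsilon>) / (2 * real n))"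
    unfolding sum.cartesian_product
    using n_pos by (intro sum.cong) (auto simp: pmf_pair)
  also have "\<dots> = (\<Sum>i=1..n. g (i, -1) + g (i, 1)) / (2 * real n)"
    by (simp add: sum_divide_distrib add_divide_distrib)
  finally show ?thesis .
qed

text \<open>Averaging over the sign removes the part of the estimate stemming from
  \<open>l t \<bullet> x\<close> and the displacement of the action; in the rest the powers of the
  eigenvalue cancel. The factor \<open>n\<close> offsets the uniform draw of the index, so the
  eigenvector expansion of \<open>l t \<bullet> (x - y)\<close> appears.\<close>

lemma estimate_unbiased:
  assumes t: "t \<in> {1..T}" and x: "x \<in> U" and y: "y \<in> U"
  shows "measure_pmf.expectation (pair_pmf (pmf_of_set {1..n}) (pmf_of_set {-1, 1}))
    (\<lambda>u. estimate_at (g(t := u)) t x \<bullet> (x - y) - l t \<bullet> (action_at (g(t := u)) t x - y)) = 0"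
proof -
  let ?h = "\<lambda>u. estimate_at (g(t := u)) t x \<bullet> (x - y) - l t \<bullet> (action_at (g(t := u)) t x - y)"
  have pair: "?h (i, -1) + ?h (i, 1) =
      2 * real n * ((l t \<bullet> e t x i) * (e t x i \<bullet> (x - y))) - 2 * (l t \<bullet> (x - y))"
    if i: "i \<in> {1..n}" for i
  proof -
    define a where "a = lam t x i powr (1/2)"
    define b where "b = lam t x i powr (-1/2)"
    have "b * a = lam t x i powr (-1/2 + 1/2)" unfolding a_def b_def by (simp only: powr_add)
    then have ab: "b * a = 1" using lam_pos[OF t x i] by simp
    have h: "?h (i, \<epsilon>) = real n * (l t \<bullet> x + \<epsilon> * b * (l t \<bullet> e t x i)) * \<epsilon> * a * (e t x i \<bullet> (x - y))
        - (l t \<bullet> (x - y) + \<epsilon> * b * (l t \<bullet> e t x i))" for \<epsilon>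
      by (simp add: estimate_at_def loss_at_def action_at_def a_def b_def inner_add_right
          inner_diff_right[of "l t"])
    have "?h (i, -1) + ?h (i, 1) =
        2 * real n * (b * a) * ((l t \<bullet> e t x i) * (e t x i \<bullet> (x - y))) - 2 * (l t \<bullet> (x - y))"
      unfolding h by (simp add: algebra_simps)
    then show ?thesis by (simp add: ab)
  qed
  have "l t \<in> Rn n" using loss_polar[OF t] by (simp add: polar_set_def)
  then have expand: "l t \<bullet> (x - y) = (\<Sum>i=1..n. (l t \<bullet> e t x i) * (e t x i \<bullet> (x - y)))"
    using inner_eigenbasis[of x "e t x" "lam t x" "l t" "x - y"] eigen[OF t x] x
    unfolding card_Rn_unit by blast
  have "(\<Sum>i=1..n. ?h (i, -1) + ?h (i, 1)) =
      (\<Sum>i=1..n. 2 * real n * ((l t \<bullet> e t x i) * (e t x i \<bullet> (x - y))) - 2 * (l t \<bullet> (x - y)))"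
    by (intro sum.cong refl pair)
  also have "\<dots> = 2 * real n * (\<Sum>i=1..n. (l t \<bullet> e t x i) * (e t x i \<bullet> (x - y)))
      - 2 * real n * (l t \<bullet> (x - y))"
    by (simp add: sum_subtractf sum_distrib_left)
  also have "\<dots> = 0" using expand by simp
  finally show ?thesis unfolding expectation_outcome by simp
qed

lemma finite_randomness: "finite (set_pmf randomness)"
  unfolding randomness_def using n_pos
  by (intro finite_subset[OF set_Pi_pmf_subset'] finite_PiE_dflt) auto

lemma randomness_outcomes: "\<omega> \<in> set_pmf randomness \<Longrightarrow> t \<in> {1..T} \<Longrightarrow> \<omega> t \<in> outcomes"
  using n_pos by (auto simp: randomness_def set_Pi_pmf PiE_dflt_def outcomes_def)

lemma integrable_randomness: "integrable (measure_pmf randomness) h" for h :: "_ \<Rightarrow> real"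
  by (rule integrable_measure_pmf_finite[OF finite_randomness])

lemma expectation_randomness_le:
  fixes h :: "_ \<Rightarrow> real"
  assumes "\<And>\<omega>. (\<And>t. t \<in> {1..T} \<Longrightarrow> \<omega> t \<in> outcomes) \<Longrightarrow> h \<omega> \<le> b"
  shows "measure_pmf.expectation randomness h \<le> b"
  using assms randomness_outcomes
  by (intro measure_pmf.integral_le_const integrable_randomness) (auto simp: AE_measure_pmf_iff)

lemma expected_estimate_gap:
  assumes t: "t \<in> {1..T}" and y: "y \<in> U"
  shows "measure_pmf.expectation randomness (\<lambda>\<omega>. estimate_at \<omega> t (iterate \<omega> t) \<bullet> (iterate \<omega> t - y) -
      l t \<bullet> (action \<omega> t - y)) = 0"
  unfolding randomness_def
proof (rule expectation_Pi_pmf_resample[OF _ t])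
  fix g assume g: "g \<in> set_pmf (Pi_pmf ({1..T} - {t}) (0, 0)
      (\<lambda>_. pair_pmf (pmf_of_set {1..n}) (pmf_of_set {-1, 1::real})))"
  \<comment> \<open>Validity constrains rounds before \<open>t\<close> only, so the default value of
    \<open>g\<close> at \<open>t\<close> is harmless.\<close>
  have "valid g t"
    unfolding valid_def outcomes_def using g t n_pos
    by (auto simp: set_Pi_pmf PiE_dflt_def)
  then have U: "iterate g t \<in> U" by (rule iterate_in_U[OF t])
  have it: "iterate (g(t := u)) t = iterate g t" for u by (rule iterate_cong) auto
  show "measure_pmf.expectation (pair_pmf (pmf_of_set {1..n}) (pmf_of_set {-1, 1}))
      (\<lambda>u. estimate_at (g(t := u)) t (iterate (g(t := u)) t) \<bullet> (iterate (g(t := u)) t - y) -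
        l t \<bullet> (action (g(t := u)) t - y)) = 0"
    unfolding action_def it by (rule estimate_unbiased[OF t U y])
qed (use n_pos in auto)

lemma expected_regret_interior:
  assumes y: "y \<in> U"
  shows "measure_pmf.expectation randomness (\<lambda>\<omega>. \<Sum>t=1..T. l t \<bullet> (action \<omega> t - y)) \<le>
    (\<Sum>t=1..T. bank t) * bregman y x0 + 8 / 7 * (real n)\<^sup>2 * (\<Sum>t=1..T. 1 / sigma t)"
proof -
  let ?E = "measure_pmf.expectation randomness"
  let ?g = "\<lambda>\<omega> t. estimate_at \<omega> t (iterate \<omega> t) \<bullet> (iterate \<omega> t - y)"
  have "?E (\<lambda>\<omega>. \<Sum>t=1..T. ?g \<omega> t) - ?E (\<lambda>\<omega>. \<Sum>t=1..T. l t \<bullet> (action \<omega> t - y)) =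
      ?E (\<lambda>\<omega>. \<Sum>t=1..T. ?g \<omega> t - l t \<bullet> (action \<omega> t - y))"
    unfolding sum_subtractf by (intro Bochner_Integration.integral_diff[symmetric] integrable_randomness)
  also have "\<dots> = (\<Sum>t=1..T. ?E (\<lambda>\<omega>. ?g \<omega> t - l t \<bullet> (action \<omega> t - y)))"
    by (intro Bochner_Integration.integral_sum integrable_randomness)
  also have "\<dots> = 0" using expected_estimate_gap[OF _ y] by simp
  finally have "?E (\<lambda>\<omega>. \<Sum>t=1..T. l t \<bullet> (action \<omega> t - y)) = ?E (\<lambda>\<omega>. \<Sum>t=1..T. ?g \<omega> t)" by simp
  also have "\<dots> \<le> (\<Sum>t=1..T. bank t) * bregman y x0 + 8 / 7 * (real n)\<^sup>2 * (\<Sum>t=1..T. 1 / sigma t)"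
    by (rule expectation_randomness_le) (rule linearized_regret_le[OF y])
  finally show ?thesis .
qed

section \<open>Comparators in the whole action set\<close>

lemma action_in_C:
  assumes "t \<in> {1..T}" "\<And>s. s \<in> {1..T} \<Longrightarrow> \<omega> s \<in> outcomes"
  shows "action \<omega> t \<in> C"
proof -
  have "valid \<omega> t" using assms by (auto simp: valid_def)
  then have U: "iterate \<omega> t \<in> U" by (rule iterate_in_U[OF assms(1)])
  obtain i \<epsilon> where "\<omega> t = (i, \<epsilon>)" "i \<in> {1..n}" "\<epsilon> \<in> {-1, 1}"
    using assms(2)[OF assms(1)] unfolding outcomes_def by blast
  then show ?thesis unfolding action_def using action_at_in_C[OF assms(1) U] by blast
qed

lemma loss_diff_le:
  assumes "t \<in> {1..T}" "u \<in> C" "v \<in> C"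
  shows "l t \<bullet> (u - v) \<le> 2"
proof -
  have "\<bar>l t \<bullet> u\<bar> \<le> 1" "\<bar>l t \<bullet> v\<bar> \<le> 1"
    using loss_polar[OF assms(1)] assms by (auto simp: polar_set_def)
  then show ?thesis by (simp add: inner_diff_right)
qed

lemma expected_regret_trivial:
  assumes "y \<in> C"
  shows "measure_pmf.expectation randomness (\<lambda>\<omega>. \<Sum>t=1..T. l t \<bullet> (action \<omega> t - y)) \<le> 2 * real T"
proof (rule expectation_randomness_le)
  fix \<omega> assume "\<And>t. t \<in> {1..T} \<Longrightarrow> \<omega> t \<in> outcomes"
  then have "(\<Sum>t=1..T. l t \<bullet> (action \<omega> t - y)) \<le> (\<Sum>t=1..T. 2)"
    using assms by (intro sum_mono loss_diff_le action_in_C) auto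
  then show "(\<Sum>t=1..T. l t \<bullet> (action \<omega> t - y)) \<le> 2 * real T" by simp
qed

lemma expected_regret:
  assumes y: "y \<in> C"
  shows "measure_pmf.expectation randomness (\<lambda>\<omega>. \<Sum>t=1..T. l t \<bullet> (action \<omega> t - y)) \<le>
    (\<Sum>t=1..T. bank t) * (\<theta> * ln (real T)) + 8 / 7 * (real n)\<^sup>2 * (\<Sum>t=1..T. 1 / sigma t) + 2"
proof -
  \<comment> \<open>Pulling \<open>y\<close> towards \<open>x0\<close> by the fraction
    \<open>1 / T\<close> costs at most two over all rounds, while \<open>- ln (1 - s)\<close> is
    only \<open>ln T\<close>.\<close>
  define s where "s = 1 - 1 / real T"
  have s: "0 \<le> s" "s < 1" using T_ge by (auto simp: s_def)
  define v where "v = x0 + s *\<^sub>R (y - x0)"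
  have v: "v \<in> U" unfolding v_def by (rule half_open_segment_in_U[OF x0_in_U y s])
  \<comment> \<open>The gradient at \<open>x0\<close> vanishes, so the divergence is just the
    increase of \<open>\<Psi>\<close>.\<close>
  have "bregman v x0 \<le> - \<theta> * ln (1 - s)"
    using barrier_growth[OF x0_in_U y s] by (simp add: bregman_def grad_x0 v_def)
  also have "\<dots> = \<theta> * ln (real T)" using T_ge by (simp add: s_def ln_div)
  finally have breg: "bregman v x0 \<le> \<theta> * ln (real T)" .
  have "(\<Sum>t=1..T. l t \<bullet> (action \<omega> t - y)) \<le> (\<Sum>t=1..T. l t \<bullet> (action \<omega> t - v)) + 2" for \<omega>
  proof -
    have "v - y = (1 / real T) *\<^sub>R (x0 - y)" by (simp add: v_def s_def algebra_simps)
    then have "l t \<bullet> (v - y) \<le> 2 / real T" if "t \<in> {1..T}" for t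
      using loss_diff_le[OF that U_subset_C[OF x0_in_U] y] by (simp add: divide_right_mono)
    then have "(\<Sum>t=1..T. l t \<bullet> (v - y)) \<le> (\<Sum>t=1..T. 2 / real T)" by (intro sum_mono) auto
    also have "\<dots> = 2" using T_ge by simp
    finally have "(\<Sum>t=1..T. l t \<bullet> (v - y)) \<le> 2" .
    moreover have "(\<Sum>t=1..T. l t \<bullet> (action \<omega> t - y)) =
        (\<Sum>t=1..T. l t \<bullet> (action \<omega> t - v)) + (\<Sum>t=1..T. l t \<bullet> (v - y))"
      by (simp add: inner_diff_right flip: sum.distrib)
    ultimately show ?thesis by simp
  qed
  then have "measure_pmf.expectation randomness (\<lambda>\<omega>. \<Sum>t=1..T. l t \<bullet> (action \<omega> t - y)) \<le>
      measure_pmf.expectation randomness (\<lambda>\<omega>. (\<Sum>t=1..T. l t \<bullet> (action \<omega> t - v)) + 2)"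
    by (intro integral_mono integrable_randomness)
  also have "\<dots> = measure_pmf.expectation randomness (\<lambda>\<omega>. \<Sum>t=1..T. l t \<bullet> (action \<omega> t - v)) + 2"
    by (subst Bochner_Integration.integral_add) (auto intro: integrable_randomness)
  also have "\<dots> \<le> (\<Sum>t=1..T. bank t) * bregman v x0 + 8 / 7 * (real n)\<^sup>2 * (\<Sum>t=1..T. 1 / sigma t) + 2"
    using expected_regret_interior[OF v] by simp
  also have "\<dots> \<le> (\<Sum>t=1..T. bank t) * (\<theta> * ln (real T)) + 8 / 7 * (real n)\<^sup>2 * (\<Sum>t=1..T. 1 / sigma t) + 2"
    using breg bank_nonneg by (intro add_mono mult_left_mono sum_nonneg) auto
  finally show ?thesis .
qed

text \<open>With \<open>L = ln T \<ge> 1 / 2\<close> one has \<open>L \<le> 2 * L^2\<close> and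
  \<open>1 \<le> 4 * L^2\<close>. The loans contribute
  \<open>16 * L + 6 * L^2 \<le> 38 * L^2\<close> times \<open>c\<close>, the stability terms
  \<open>10 * L^2\<close>, and the displacement of the comparator \<open>8 * L^2\<close>. One
  logarithm of the loan term comes from the divergence of the comparator, the other from the
  harmonic sum.\<close>

lemma pseudo_regret_bound:
  assumes \<theta>: "\<theta> = c * real n" and "0 < c"
  shows "pseudo_regret \<le> (38 * c + 18) * ln (real T) ^ 2 *
    (real n powr (3/2) * sqrt (real T) + real n ^ 2 * sqrt (real total_delay))"
  unfolding pseudo_regret_def
proof (rule cSUP_least)
  show "C \<noteq> {}" using x0_in_U U_subset_C by blast
next
  fix y assume y: "y \<in> C"
  define L where "L = ln (real T)"
  define s where "s = sqrt (real n)"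
  define X where "X = sqrt (real T)"
  define Y where "Y = sqrt (real total_delay)"
  define N where "N = real n"
  define W where "W = N * s * X + N ^ 2 * Y"
  have L: "1 / 2 \<le> L" using ln_T by (simp add: L_def)
  have LL: "L \<le> 2 * L\<^sup>2" "1 \<le> 4 * L\<^sup>2"
    using mult_right_mono[OF L, of L] mult_mono[OF L L] L by (auto simp: power2_eq_square)
  have s: "1 \<le> s" "s * s = N" using n_pos by (auto simp: s_def N_def)
  have X: "1 \<le> X" "X * X = real T" using T_ge by (auto simp: X_def)
  have Y: "0 \<le> Y" by (simp add: Y_def)
  have N: "1 \<le> N" using n_pos by (simp add: N_def)
  have sN: "s \<le> N" using mult_left_mono[OF s(1), of s] s by simp
  have "real n powr (3/2) = N powr (1 + 1/2)" by (simp add: N_def)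
  also have "\<dots> = N * s" unfolding powr_add using N by (simp add: powr_half_sqrt s_def N_def)
  finally have goal: "real n powr (3/2) * sqrt (real T) + real n ^ 2 * sqrt (real total_delay) = W"
    by (simp add: W_def X_def Y_def N_def)
  have NsX: "1 \<le> N * s * X"
    using mult_mono[OF mult_mono[OF N s(1)] X(1)] N s by simp
  have NsX_W: "N * s * X \<le> W" using Y by (simp add: W_def)
  have W: "1 \<le> W" using NsX NsX_W by simp
  let ?R = "measure_pmf.expectation randomness (\<lambda>\<omega>. \<Sum>t=1..T. l t \<bullet> (action \<omega> t - y))"
  have "?R \<le> (38 * c + 18) * L\<^sup>2 * W"
  proof (cases "T < n")
    case True
    \<comment> \<open>Here \<open>T = X * X \<le> s * X\<close> is already below the target, so the
      trivial regret bound is good enough.\<close>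
    have "X \<le> s" using True by (simp add: X_def s_def)
    then have "X * X \<le> s * X" using X by (intro mult_right_mono) auto
    also have "\<dots> \<le> N * (s * X)" using mult_right_mono[OF N, of "s * X"] s X by simp
    finally have "real T \<le> W" using NsX_W by (simp add: X mult.assoc)
    then have "?R \<le> 2 * W" using expected_regret_trivial[OF y] by simp
    also have "\<dots> \<le> (18 * L\<^sup>2) * W" using LL W by (intro mult_right_mono) auto
    also have "\<dots> \<le> ((38 * c + 18) * L\<^sup>2) * W"
      using W \<open>0 < c\<close> by (intro mult_right_mono) auto
    finally show ?thesis by simp
  next
    case False
    \<comment> \<open>This absorbs the dimension term \<open>8 * N = 8 * s * s\<close> of the loans
      into \<open>8 * s * X\<close>.\<close>
    have sX: "s \<le> X" using False by (simp add: X_def s_def)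
    have "(\<Sum>t=1..T. bank t) \<le> 8 * N * (sqrt 2 * Y + 1) + sqrt 2 * s * X + 2 * (s * Y) * (1 + L)"
      using sum_bank_bound by (simp add: N_def Y_def s_def X_def L_def real_sqrt_mult)
    also have "\<dots> \<le> 8 * N * (2 * Y + 1) + 2 * s * X + 2 * (N * Y) * (3 * L)"
      using sN s X Y N L sqrt2_less_2
      by (intro add_mono mult_left_mono mult_mono mult_right_mono) auto
    also have "8 * N * (2 * Y + 1) \<le> 16 * (N * Y) + 8 * (s * X)"
      using mult_left_mono[OF sX, of s] s by (simp add: algebra_simps)
    finally have "(\<Sum>t=1..T. bank t) \<le> 10 * (s * X) + (16 + 6 * L) * (N * Y)"
      by (simp add: algebra_simps)
    also have "\<dots> \<le> (16 + 6 * L) * (s * X) + (16 + 6 * L) * (N * Y)"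
      using mult_right_mono[of 10 "16 + 6 * L" "s * X"] L s(1) X(1) by simp
    finally have "(\<Sum>t=1..T. bank t) * (c * N * L) \<le>
        ((16 + 6 * L) * (s * X) + (16 + 6 * L) * (N * Y)) * (c * N * L)"
      using \<open>0 < c\<close> N L by (intro mult_right_mono) auto
    also have "\<dots> = c * ((16 * L + 6 * L\<^sup>2) * W)"
      by (simp add: W_def power2_eq_square algebra_simps)
    also have "\<dots> \<le> c * ((38 * L\<^sup>2) * W)"
      using \<open>0 < c\<close> W LL by (intro mult_left_mono mult_right_mono) auto
    finally have bank: "(\<Sum>t=1..T. bank t) * (\<theta> * L) \<le> 38 * c * L\<^sup>2 * W"
      by (simp add: \<theta> N_def)
    have "8 / 7 * N\<^sup>2 * (\<Sum>t=1..T. 1 / sigma t) \<le> 8 / 7 * N\<^sup>2 * (4 * L * (X + Y) / s)"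
      using sum_inverse_sigma_bound
      by (intro mult_left_mono) (auto simp: L_def X_def Y_def s_def)
    \<comment> \<open>From \<open>N = s * s\<close> the quotient \<open>N^2 / s\<close> becomes
      \<open>N * s\<close>, that is \<open>n powr (3/2)\<close>.\<close>
    also have "\<dots> = 32 / 7 * L * (N * s * X + N * s * Y)"
      using s by (simp add: power2_eq_square field_simps flip: s(2))
    also have "\<dots> \<le> 5 * L * W"
    proof (intro mult_mono)
      have "N * s * Y \<le> N * N * Y" using sN N Y by (intro mult_right_mono mult_left_mono) auto
      then show "N * s * X + N * s * Y \<le> W" by (simp add: W_def power2_eq_square)
      show "0 \<le> N * s * X + N * s * Y"
        using N s(1) X(1) Y by (intro add_nonneg_nonneg mult_nonneg_nonneg) auto
    qed (use L in auto)
    also have "\<dots> \<le> 10 * L\<^sup>2 * W" using LL W by (intro mult_right_mono) auto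
    finally have rate: "8 / 7 * N\<^sup>2 * (\<Sum>t=1..T. 1 / sigma t) \<le> 10 * L\<^sup>2 * W" .
    have "2 * 1 \<le> (8 * L\<^sup>2) * W" using LL W by (intro mult_mono) auto
    then have "?R \<le> 38 * c * L\<^sup>2 * W + 10 * L\<^sup>2 * W + 8 * L\<^sup>2 * W"
      using expected_regret[OF y] bank rate by (simp add: L_def N_def)
    then show ?thesis by (simp add: algebra_simps)
  qed
  then show "?R \<le> (38 * c + 18) * ln (real T) ^ 2 *
      (real n powr (3/2) * sqrt (real T) + real n ^ 2 * sqrt (real total_delay))"
    unfolding goal by (simp add: L_def)
qed

end

theorem theorem7p1:
  "\<exists>p::nat. \<forall>c>0. \<exists>K::real. \<forall>n C \<Psi> \<theta> T l d ord e lam.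
     n \<ge> 1 \<and> C \<subseteq> Rn n \<and> closed C \<and> convex C \<and> interior_in (Rn n) C \<noteq> {} \<and>
     T \<ge> 2 \<and> (\<forall>t\<in>{1..T}. l t \<in> polar_set (Rn n) C) \<and>
     theta_self_concordant \<theta> (Rn n) C \<Psi> \<and> \<theta> \<le> c * real n \<and> barrier (Rn n) C \<Psi> \<and>
     legendre (Rn n) C \<Psi> \<and> hessian_pos_def (Rn n) C \<Psi> \<and>
     has_minimizer_on (interior_in (Rn n) C) \<Psi> \<and>
     (\<forall>t\<in>{1..T}. distinct (ord t) \<and> set (ord t) = banker_bolo.arrived d t) \<and>
     (\<forall>t\<in>{1..T}. \<forall>x\<in>interior_in (Rn n) C.
        orthonormal_eigenbasis n (Rn n) (hessian (Rn n) \<Psi> x) (e t x) (lam t x))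
     \<longrightarrow>
     banker_bolo.pseudo_regret n C \<Psi> T l d ord e lam
       \<le> K * ln (real T) ^ p *
          (real n powr (3/2) * sqrt (real T) +
           real n ^ 2 * sqrt (real (banker_bolo.total_delay T d)))"
proof (rule exI[of _ 2], intro allI impI)
  fix c :: real
  assume c: "0 < c"
  show "\<exists>K::real. \<forall>n C \<Psi> \<theta> T l d ord e lam.
     n \<ge> 1 \<and> C \<subseteq> Rn n \<and> closed C \<and> convex C \<and> interior_in (Rn n) C \<noteq> {} \<and>
     T \<ge> 2 \<and> (\<forall>t\<in>{1..T}. l t \<in> polar_set (Rn n) C) \<and>
     theta_self_concordant \<theta> (Rn n) C \<Psi> \<and> \<theta> \<le> c * real n \<and> barrier (Rn n) C \<Psi> \<and>
     legendre (Rn n) C \<Psi> \<and> hessian_pos_def (Rn n) C \<Psi> \<and>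
     has_minimizer_on (interior_in (Rn n) C) \<Psi> \<and>
     (\<forall>t\<in>{1..T}. distinct (ord t) \<and> set (ord t) = banker_bolo.arrived d t) \<and>
     (\<forall>t\<in>{1..T}. \<forall>x\<in>interior_in (Rn n) C.
        orthonormal_eigenbasis n (Rn n) (hessian (Rn n) \<Psi> x) (e t x) (lam t x))
     \<longrightarrow>
     banker_bolo.pseudo_regret n C \<Psi> T l d ord e lam
       \<le> K * ln (real T) ^ 2 *
          (real n powr (3/2) * sqrt (real T) +
           real n ^ 2 * sqrt (real (banker_bolo.total_delay T d)))"
  proof (rule exI[of _ "38 * c + 18"], intro allI impI, elim conjE)
    fix n :: nat and C :: "fseq set" and \<Psi> :: "fseq \<Rightarrow> real" and \<theta> :: real and T :: nat
      and l :: "nat \<Rightarrow> fseq" and d :: "nat \<Rightarrow> nat" and ord :: "nat \<Rightarrow> nat list"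
      and e :: "nat \<Rightarrow> fseq \<Rightarrow> nat \<Rightarrow> fseq" and lam :: "nat \<Rightarrow> fseq \<Rightarrow> nat \<Rightarrow> real"
    assume *: "n \<ge> 1" "C \<subseteq> Rn n" "closed C" "convex C" "T \<ge> 2"
      "\<forall>t\<in>{1..T}. l t \<in> polar_set (Rn n) C"
      "theta_self_concordant \<theta> (Rn n) C \<Psi>" "\<theta> \<le> c * real n" "barrier (Rn n) C \<Psi>"
      "hessian_pos_def (Rn n) C \<Psi>" "has_minimizer_on (interior_in (Rn n) C) \<Psi>"
      "\<forall>t\<in>{1..T}. distinct (ord t) \<and> set (ord t) = banker_bolo.arrived d t"
      and eigen: "\<forall>t\<in>{1..T}. \<forall>x\<in>interior_in (Rn n) C.
        orthonormal_eigenbasis n (Rn n) (hessian (Rn n) \<Psi> x) (e t x) (lam t x)"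
    interpret onb_subspace "Rn n" "Rn_unit ` {1..n}" by (rule onb_subspace_Rn)
    \<comment> \<open>The eigenvectors supplied for round one diagonalise the Hessian at every
      interior point.\<close>
    have "1 \<in> {1..T}" using * by simp
    with eigen have "\<exists>e' lam'. orthonormal_eigenbasis n (Rn n) (hessian (Rn n) \<Psi> x) e' lam'"
      if "x \<in> interior_in (Rn n) C" for x using that by blast
    \<comment> \<open>The barrier parameter of the locale becomes \<open>c * n\<close>, which is
      positive even when \<open>\<theta>\<close> is zero.\<close>
    then interpret banker_regret n C \<Psi> T l d ord e lam "c * real n"
      using * c eigen by unfold_locales (auto simp: card_Rn_unit simp del: One_nat_def)
    show "banker_bolo.pseudo_regret n C \<Psi> T l d ord e lam
       \<le> (38 * c + 18) * ln (real T) ^ 2 *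
          (real n powr (3/2) * sqrt (real T) +
           real n ^ 2 * sqrt (real (banker_bolo.total_delay T d)))"
      by (rule pseudo_regret_bound[OF refl c])
  qed
qed

end
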